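(* Let $n\ge1$, let $J_n\in\mathbb{C}^{n\times n}$ satisfy $J_n^*=J_n^{-1}=-J_n$, and let $Q\in L^1_{\mathrm{loc}}(\mathbb{R}_+,\mathbb{C}^{n\times n})$. For a subspace $\theta\subset\mathbb{C}^n$ put $\theta^\times=\mathbb{C}^n\ominus J_n\theta$. Then: (i) For any subspace $\theta\subset\mathbb{C}^n$ one has $D^+_{\theta,0}(Q)=D^+_\theta(Q)$. Moreover, $(D^+_\theta(Q))^*=D^+_{\theta^\times}(Q^* )$. (ii) The equality $\widetilde A=D^+_\theta(Q)$ establishes a bijective correspondence between all subspaces $\theta\subset\mathbb{C}^n$ and all extensions $\widetilde A\in\mathrm{Ext}\{D^+_{\min}(Q),D^+_{\min}(Q^* )\}$. In particular, $D^+_{\min}(Q)=D^+_{\{0\}}(Q)$ and hence $\mathrm{dom}\,D^+_{\min}(Q)=\{y\in\mathrm{dom}\,D^+_{\max}(Q): y(0)=0\}$. (iii) The dual pair $\{D^+_{\min}(Q),D^+_{\min}(Q^* )\}$ is correct if and only if $n=2p$ (that is, $n$ is even). If this condition is satisfied, then the equality $\widetilde A=D^+_\theta(Q)$ gives a bijective correspondence between all subspaces $\theta\subset\mathbb{C}^{2p}$ with $\dim\theta=p$ and all quasi-selfadjoint extensions $\widetilde A\in\mathrm{Ext}\{D^+_{\min}(Q),D^+_{\min}(Q^* )\}$.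
   Context: $\mathbb{R}_+=[0,\infty)$ and $D(Q)y=J_ny'+Q(x)y$. The maximal operator $D^+_{\max}(Q)$ in $L^2(\mathbb{R}_+,\mathbb{C}^n)$ has domain $\{y\in L^2: y\in AC_{\mathrm{loc}}(\mathbb{R}_+,\mathbb{C}^n),\ D(Q)y\in L^2\}$ and acts as $y\mapsto D(Q)y$. The minimal operator $D^+_{\min}(Q)$ is the closure of its restriction to those $y\in\mathrm{dom}\,D^+_{\max}(Q)$ with compact support and $y(0)=0$. For a subspace $\theta\subset\mathbb{C}^n$, $D^+_\theta(Q)$ is the restriction of $D^+_{\max}(Q)$ to $\{y\in\mathrm{dom}\,D^+_{\max}(Q): y(0)\in\theta\}$, and $D^+_{\theta,0}(Q)$ is the closure of the restriction of $D^+_{\max}(Q)$ to $\{y\in\mathrm{dom}\,D^+_{\max}(Q): y(0)\in\theta,\ \mathrm{supp}\,y\text{ compact in }[0,\infty)\}$. $Q^*$ denotes the potential $x\mapsto Q(x)^*$. Operators $A,B$ in a Hilbert space form a dual pair $\{A,B\}$ if $(Af,g)=(f,Bg)$ for all $f\in\mathrm{dom}\,A$, $g\in\mathrm{dom}\,B$. $\mathrm{Ext}\{A,B\}$ is the set of proper extensions, i.e. operators $\widetilde A$ with $A\subset\widetilde A\subset B^*$ (non-strict inclusions). For a dual pair of closed densely defined operators, $\widetilde A\in\mathrm{Ext}\{A,B\}$ is quasi-selfadjoint if $\dim(\mathrm{dom}\,\widetilde A/\mathrm{dom}\,A)=\dim(\mathrm{dom}\,\widetilde A^*/\mathrm{dom}\,B)$,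 and $\{A,B\}$ is called correct if it admits a quasi-selfadjoint extension. The operators $D^+_{\min}(Q)$, $D^+_{\min}(Q^* )$ form a dual pair of closed densely defined operators with $(D^+_{\min}(Q))^*=D^+_{\max}(Q^* )$. *)

theory Defs
  imports "HOL-Analysis.Analysis" "HOL-Library.Equipollence"
begin

section \<open>Complex coordinate space\<close>

text \<open>
  \<^typ>\<open>complex^'n\<close> with the subspaces \<^const>\<open>vec.subspace\<close> and dimension \<^const>\<open>vec.dim\<close>
  of the library is a complex vector space.  The class instance \<^class>\<open>real_inner\<close> on this type
  is only the real part of the Hermitian product defined here (linear in the first argument).
\<close>

definition cdot :: "complex^'n \<Rightarrow> complex^'n \<Rightarrow> complex" where
  "cdot u v = (\<Sum>i\<in>UNIV. u $ i * cnj (v $ i))"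

definition hermitian_adjoint :: "complex^'n^'m \<Rightarrow> complex^'m^'n" where
  "hermitian_adjoint A = map_matrix cnj (transpose A)"

definition theta_cross :: "complex^'n^'n \<Rightarrow> (complex^'n) set \<Rightarrow> (complex^'n) set" where
  "theta_cross J \<theta> = {v. \<forall>u \<in> (*v) J ` \<theta>. cdot v u = 0}"

section \<open>The Hilbert space of square integrable functions on the half-line\<close>

definition sq_integrable :: "(real \<Rightarrow> complex^'n) \<Rightarrow> bool" where
  "sq_integrable f \<longleftrightarrow> f \<in> borel_measurable (lebesgue_on {0..}) \<and>
     integrable (lebesgue_on {0..}) (\<lambda>x. (norm (f x))\<^sup>2)"

definition L2_rel :: "(real \<Rightarrow> complex^'n) \<Rightarrow> (real \<Rightarrow> complex^'n) \<Rightarrow> bool" where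
  "L2_rel f g \<longleftrightarrow> sq_integrable f \<and> sq_integrable g \<and> (AE x in lebesgue_on {0..}. f x = g x)"

lemma cdot_commute: "cdot v u = cnj (cdot u v)"
  by (simp add: cdot_def mult.commute)

lemma cdot_add_left: "cdot (u + v) w = cdot u w + cdot v w"
  by (simp add: cdot_def distrib_right sum.distrib)

lemma cdot_scale_left: "cdot (c *s u) w = c * cdot u w"
  by (simp add: cdot_def sum_distrib_left mult.assoc)

lemma cdot_self: "cdot u u = of_real ((norm u)\<^sup>2)"
  by (simp add: cdot_def norm_vec_def L2_set_def sum_nonneg complex_norm_square[symmetric])

lemma norm_scale_vec: "norm (c *s u) = cmod c * norm (u :: complex^'n)"
proof -
  have "(norm (c *s u))\<^sup>2 = (cmod c * norm u)\<^sup>2"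
    by (simp add: norm_vec_def L2_set_def sum_nonneg norm_mult power_mult_distrib sum_distrib_left)
  then show ?thesis by (simp add: power2_eq_iff_nonneg)
qed

lemma norm_cdot_le: "cmod (cdot u v) \<le> real CARD('n) * ((norm u)\<^sup>2 + (norm v)\<^sup>2)"
  for u v :: "complex^'n"
proof -
  have "cmod (u $ i * cnj (v $ i)) \<le> (norm u)\<^sup>2 + (norm v)\<^sup>2" for i
  proof -
    have "cmod (u $ i * cnj (v $ i)) \<le> norm u * norm v"
      by (simp add: norm_mult mult_mono component_le_norm_cart Finite_Cartesian_Product.norm_nth_le)
    also have "\<dots> \<le> (norm u)\<^sup>2 + (norm v)\<^sup>2"
      using sum_squares_bound[of "norm u" "norm v"]
        mult_nonneg_nonneg[OF norm_ge_zero[of u] norm_ge_zero[of v]] by linarith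
    finally show ?thesis .
  qed
  then have "cmod (cdot u v) \<le> (\<Sum>i\<in>(UNIV::'n set). (norm u)\<^sup>2 + (norm v)\<^sup>2)"
    unfolding cdot_def by (intro sum_norm_le) auto
  then show ?thesis by simp
qed

lemma borel_measurable_nth:
  fixes f :: "'a \<Rightarrow> complex^'n"
  assumes "f \<in> borel_measurable M" shows "(\<lambda>x. f x $ i) \<in> borel_measurable M"
  by (rule borel_measurable_continuous_on[OF _ assms]) (intro continuous_intros)

lemma borel_measurable_scale_vec:
  fixes f :: "'a \<Rightarrow> complex^'n"
  assumes "f \<in> borel_measurable M" shows "(\<lambda>x. c *s f x) \<in> borel_measurable M"
proof (rule borel_measurable_continuous_on[OF _ assms])
  show "continuous_on UNIV (\<lambda>v :: complex^'n. c *s v)"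
    unfolding vector_scalar_mult_def by (intro continuous_intros)
qed

lemma borel_measurable_cdot:
  fixes f g :: "'a \<Rightarrow> complex^'n"
  assumes "f \<in> borel_measurable M" "g \<in> borel_measurable M"
  shows "(\<lambda>x. cdot (f x) (g x)) \<in> borel_measurable M"
proof -
  have "(\<lambda>x. cnj (g x $ i)) \<in> borel_measurable M" for i
    by (rule borel_measurable_continuous_on[OF _ borel_measurable_nth[OF assms(2)]])
       (intro continuous_intros)
  then show ?thesis
    unfolding cdot_def using borel_measurable_nth[OF assms(1)] by measurable
qed

lemma sq_integrable_zero: "sq_integrable (\<lambda>x. 0)"
  by (simp add: sq_integrable_def)

lemma sq_integrable_add:
  assumes "sq_integrable f" "sq_integrable g"
  shows "sq_integrable (\<lambda>x. f x + g x)"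
proof -
  have meas: "f \<in> borel_measurable (lebesgue_on {0..})" "g \<in> borel_measurable (lebesgue_on {0..})"
    using assms by (auto simp: sq_integrable_def)
  have int: "integrable (lebesgue_on {0..}) (\<lambda>x. 2 * (norm (f x))\<^sup>2 + 2 * (norm (g x))\<^sup>2)"
    using assms by (auto simp: sq_integrable_def)
  have le: "(norm (f x + g x))\<^sup>2 \<le> 2 * (norm (f x))\<^sup>2 + 2 * (norm (g x))\<^sup>2" for x
  proof -
    have "(norm (f x + g x))\<^sup>2 \<le> (norm (f x) + norm (g x))\<^sup>2"
      by (simp add: norm_triangle_ineq power_mono)
    also have "\<dots> \<le> 2 * (norm (f x))\<^sup>2 + 2 * (norm (g x))\<^sup>2"
      using sum_squares_bound[of "norm (f x)" "norm (g x)"] by (simp add: power2_sum)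
    finally show ?thesis .
  qed
  have "integrable (lebesgue_on {0..}) (\<lambda>x. (norm (f x + g x))\<^sup>2)"
    by (rule Bochner_Integration.integrable_bound[OF int]) (use meas le in auto)
  with meas show ?thesis by (simp add: sq_integrable_def)
qed

lemma sq_integrable_scale:
  assumes "sq_integrable f" shows "sq_integrable (\<lambda>x. c *s f x)"
  using assms
  by (auto simp: sq_integrable_def norm_scale_vec power_mult_distrib borel_measurable_scale_vec)

lemma sq_integrable_minus:
  assumes "sq_integrable f" shows "sq_integrable (\<lambda>x. - f x)"
  using assms by (auto simp: sq_integrable_def)

lemma integrable_cdot:
  assumes "sq_integrable f" "sq_integrable g"
  shows "integrable (lebesgue_on {0..}) (\<lambda>x. cdot (f x) (g x))"
proof -
  have int: "integrable (lebesgue_on {0..})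
      (\<lambda>x. real CARD('a) * ((norm (f x))\<^sup>2 + (norm (g x))\<^sup>2))"
    using assms by (auto simp: sq_integrable_def)
  show ?thesis
  proof (rule Bochner_Integration.integrable_bound[OF int])
    show "(\<lambda>x. cdot (f x) (g x)) \<in> borel_measurable (lebesgue_on {0..})"
      using assms by (intro borel_measurable_cdot) (auto simp: sq_integrable_def)
    show "AE x in lebesgue_on {0..}. norm (cdot (f x) (g x))
        \<le> norm (real CARD('a) * ((norm (f x))\<^sup>2 + (norm (g x))\<^sup>2))"
      using norm_cdot_le by (intro AE_I2) (auto intro: order_trans)
  qed
qed

quotient_type 'n L2 = "real \<Rightarrow> complex^'n" / partial: "L2_rel :: (real \<Rightarrow> complex^'n) \<Rightarrow> _"
  morphisms rep_L2 abs_L2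
proof (rule part_equivpI)
  show "\<exists>f :: real \<Rightarrow> complex^'n. L2_rel f f"
    by (rule exI[of _ "\<lambda>x. 0"]) (simp add: L2_rel_def sq_integrable_zero)
  show "symp (L2_rel :: (real \<Rightarrow> complex^'n) \<Rightarrow> _)"
    by (auto simp: symp_def L2_rel_def)
  show "transp (L2_rel :: (real \<Rightarrow> complex^'n) \<Rightarrow> _)"
    by (auto simp: transp_def L2_rel_def)
qed

instantiation L2 :: (finite) ab_group_add
begin

lift_definition zero_L2 :: "'a L2" is "\<lambda>x. 0"
  by (simp add: L2_rel_def sq_integrable_zero)

lift_definition plus_L2 :: "'a L2 \<Rightarrow> 'a L2 \<Rightarrow> 'a L2" is "\<lambda>f g x. f x + g x"
  by (auto simp: L2_rel_def sq_integrable_add)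

lift_definition uminus_L2 :: "'a L2 \<Rightarrow> 'a L2" is "\<lambda>f x. - f x"
  by (auto simp: L2_rel_def sq_integrable_minus)

definition minus_L2 :: "'a L2 \<Rightarrow> 'a L2 \<Rightarrow> 'a L2" where
  "minus_L2 f g = f + - g"

instance
proof
  fix a b c :: "'a L2"
  show "a + b + c = a + (b + c)"
    by transfer (auto simp: L2_rel_def sq_integrable_add add.assoc)
  show "a + b = b + a"
    by transfer (auto simp: L2_rel_def sq_integrable_add add.commute)
  show "0 + a = a"
    by transfer (auto simp: L2_rel_def)
  show "- a + a = 0"
    by transfer (auto simp: L2_rel_def sq_integrable_zero)
  show "a - b = a + - b"
    by (rule minus_L2_def)
qed

end

lift_definition scaleL2 :: "complex \<Rightarrow> ('n::finite) L2 \<Rightarrow> 'n L2" is "\<lambda>c f x. c *s f x"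
  by (auto simp: L2_rel_def sq_integrable_scale)

lift_definition cinner :: "('n::finite) L2 \<Rightarrow> 'n L2 \<Rightarrow> complex"
  is "\<lambda>f g. integral\<^sup>L (lebesgue_on {0..}) (\<lambda>x. cdot (f x) (g x))"
  by (rule integral_cong_AE)
     (auto simp: L2_rel_def sq_integrable_def intro!: borel_measurable_cdot)

interpretation L2: vector_space "scaleL2 :: complex \<Rightarrow> ('n::finite) L2 \<Rightarrow> 'n L2"
proof
  fix a b :: complex and x y :: "('n::finite) L2"
  show "scaleL2 a (x + y) = scaleL2 a x + scaleL2 a y"
    by transfer (auto simp: L2_rel_def sq_integrable_add sq_integrable_scale vec.scale_right_distrib)
  show "scaleL2 (a + b) x = scaleL2 a x + scaleL2 b x"
    by transfer (auto simp: L2_rel_def sq_integrable_add sq_integrable_scale vec.scale_left_distrib)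
  show "scaleL2 a (scaleL2 b x) = scaleL2 (a * b) x"
    by transfer (auto simp: L2_rel_def sq_integrable_scale)
  show "scaleL2 1 x = x"
    by transfer (auto simp: L2_rel_def)
qed

lemma cinner_commute: "cinner g f = cnj (cinner f g)"
proof (transfer)
  fix f g :: "real \<Rightarrow> complex^'n"
  assume "L2_rel g g" "L2_rel f f"
  show "integral\<^sup>L (lebesgue_on {0..}) (\<lambda>x. cdot (g x) (f x)) =
        cnj (integral\<^sup>L (lebesgue_on {0..}) (\<lambda>x. cdot (f x) (g x)))"
    by (subst Bochner_Integration.integral_cnj[symmetric]) (simp flip: cdot_commute)
qed

lemma cinner_add_left: "cinner (f + g) h = cinner f h + cinner g h"
  by transfer (simp add: L2_rel_def cdot_add_left integrable_cdot)

lemma cinner_scale_left: "cinner (scaleL2 c f) h = c * cinner f h"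
  by transfer (simp add: L2_rel_def cdot_scale_left)

lemma cinner_self: "cinner f f = of_real (Re (cinner f f)) \<and> 0 \<le> Re (cinner f f) \<and>
  (Re (cinner f f) = 0 \<longleftrightarrow> f = 0)"
proof transfer
  fix f :: "real \<Rightarrow> complex^'n"
  assume "L2_rel f f"
  then have sq: "sq_integrable f" by (simp add: L2_rel_def)
  define I where "I = integral\<^sup>L (lebesgue_on {0..}) (\<lambda>x. (norm (f x))\<^sup>2)"
  have *: "integral\<^sup>L (lebesgue_on {0..}) (\<lambda>x. cdot (f x) (f x)) = of_real I"
    unfolding I_def cdot_self
    by (rule integral_of_real) (use sq in \<open>simp add: sq_integrable_def\<close>)
  have "I = 0 \<longleftrightarrow> (AE x in lebesgue_on {0..}. (norm (f x))\<^sup>2 = 0)"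
    unfolding I_def
    by (rule integral_nonneg_eq_0_iff_AE) (use sq in \<open>auto simp: sq_integrable_def\<close>)
  then have "I = 0 \<longleftrightarrow> L2_rel f (\<lambda>x. 0)"
    using sq by (simp add: L2_rel_def sq_integrable_zero)
  moreover have "0 \<le> I" unfolding I_def by simp
  ultimately show "integral\<^sup>L (lebesgue_on {0..}) (\<lambda>x. cdot (f x) (f x)) =
        of_real (Re (integral\<^sup>L (lebesgue_on {0..}) (\<lambda>x. cdot (f x) (f x)))) \<and>
      0 \<le> Re (integral\<^sup>L (lebesgue_on {0..}) (\<lambda>x. cdot (f x) (f x))) \<and>
      (Re (integral\<^sup>L (lebesgue_on {0..}) (\<lambda>x. cdot (f x) (f x))) = 0 \<longleftrightarrow>
        L2_rel f (\<lambda>x. 0))"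
    by (simp add: *)
qed

instantiation L2 :: (finite) real_vector
begin

definition scaleR_L2 :: "real \<Rightarrow> 'a L2 \<Rightarrow> 'a L2" where
  "scaleR_L2 r f = scaleL2 (of_real r) f"

instance
  by standard (simp_all add: scaleR_L2_def L2.scale_right_distrib L2.scale_left_distrib)

end

text \<open>The instance below provides the norm and the topology, also for pairs of functions.\<close>

instantiation L2 :: (finite) real_inner
begin

definition inner_L2 :: "'a L2 \<Rightarrow> 'a L2 \<Rightarrow> real" where
  "inner_L2 f g = Re (cinner f g)"

definition norm_L2 :: "'a L2 \<Rightarrow> real" where
  "norm_L2 f = sqrt (inner f f)"

definition dist_L2 :: "'a L2 \<Rightarrow> 'a L2 \<Rightarrow> real" where
  "dist_L2 f g = norm (f - g)"

definition sgn_L2 :: "'a L2 \<Rightarrow> 'a L2" where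
  "sgn_L2 f = inverse (norm f) *\<^sub>R f"

definition uniformity_L2 :: "('a L2 \<times> 'a L2) filter" where
  "uniformity_L2 = (INF e\<in>{0<..}. principal {(x, y). dist x y < e})"

definition open_L2 :: "'a L2 set \<Rightarrow> bool" where
  "open_L2 U \<longleftrightarrow> (\<forall>x\<in>U. eventually (\<lambda>(x', y). x' = x \<longrightarrow> y \<in> U) uniformity)"

instance
proof
  fix a :: real and x y z :: "'a L2" and U :: "'a L2 set"
  show "dist x y = norm (x - y)"
    by (rule dist_L2_def)
  show "sgn x = x /\<^sub>R norm x"
    by (rule sgn_L2_def)
  show "(uniformity :: ('a L2 \<times> 'a L2) filter) = (INF e\<in>{0<..}. principal {(x, y). dist x y < e})"
    by (rule uniformity_L2_def)
  show "open U = (\<forall>x\<in>U. \<forall>\<^sub>F (x', y) in uniformity. x' = x \<longrightarrow> y \<in> U)"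
    by (rule open_L2_def)
  show "inner x y = inner y x"
    using cinner_commute[of x y] by (simp add: inner_L2_def)
  show "inner (x + y) z = inner x z + inner y z"
    by (simp add: inner_L2_def cinner_add_left)
  show "inner (a *\<^sub>R x) y = a * inner x y"
    by (simp add: inner_L2_def scaleR_L2_def cinner_scale_left)
  show "0 \<le> inner x x" "inner x x = 0 \<longleftrightarrow> x = 0"
    using cinner_self[of x] by (simp_all add: inner_L2_def)
  show "norm x = sqrt (inner x x)"
    by (rule norm_L2_def)
qed

end

section \<open>Operators, adjoints and dual pairs\<close>

text \<open>
  An operator is represented by its graph, so that \<open>A \<subseteq> B\<close> is inclusion of operators,
  \<^const>\<open>Domain\<close> is the domain and \<^const>\<open>closure\<close> (for the product topology) is the
  closure of a closable operator.
\<close>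

type_synonym 'n operator = "('n L2 \<times> 'n L2) set"

definition is_operator :: "('n::finite) operator \<Rightarrow> bool" where
  "is_operator A \<longleftrightarrow> single_valued A \<and> (0, 0) \<in> A \<and>
     (\<forall>(f, k)\<in>A. \<forall>(g, h)\<in>A. (f + g, k + h) \<in> A) \<and>
     (\<forall>c. \<forall>(f, k)\<in>A. (scaleL2 c f, scaleL2 c k) \<in> A)"

definition densely_defined :: "('n::finite) operator \<Rightarrow> bool" where
  "densely_defined A \<longleftrightarrow> closure (Domain A) = UNIV"

text \<open>For a densely defined operator \<open>A\<close> this is the graph of the usual adjoint.\<close>

definition adj :: "('n::finite) operator \<Rightarrow> 'n operator" where
  "adj A = {(g, h). \<forall>(f, k)\<in>A. cinner k g = cinner f h}"

definition dual_pair :: "('n::finite) operator \<Rightarrow> 'n operator \<Rightarrow> bool" where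
  "dual_pair A B \<longleftrightarrow> is_operator A \<and> is_operator B \<and>
     (\<forall>(f, k)\<in>A. \<forall>(g, h)\<in>B. cinner k g = cinner f h)"

definition Ext :: "('n::finite) operator \<Rightarrow> 'n operator \<Rightarrow> 'n operator set" where
  "Ext A B = {T. is_operator T \<and> A \<subseteq> T \<and> T \<subseteq> adj B}"

text \<open>\<open>basis_mod V W S\<close>: the cosets of the elements of \<open>S\<close> are distinct and form a
  (Hamel) basis of the complex vector space \<open>V / W\<close>.\<close>

definition basis_mod :: "('n::finite) L2 set \<Rightarrow> 'n L2 set \<Rightarrow> 'n L2 set \<Rightarrow> bool" where
  "basis_mod V W S \<longleftrightarrow> S \<subseteq> V \<and>
     (\<forall>F c. finite F \<longrightarrow> F \<subseteq> S \<longrightarrow> (\<Sum>v\<in>F. scaleL2 (c v) v) \<in> W \<longrightarrow> (\<forall>v\<in>F. c v = 0)) \<and>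
     (\<forall>v\<in>V. \<exists>s\<in>L2.span S. v - s \<in> W)"

text \<open>Equality of \<open>dim (V / W)\<close> and \<open>dim (V' / W')\<close> as (possibly infinite) cardinals.\<close>

definition same_quotient_dim ::
    "('n::finite) L2 set \<Rightarrow> 'n L2 set \<Rightarrow> 'n L2 set \<Rightarrow> 'n L2 set \<Rightarrow> bool" where
  "same_quotient_dim V W V' W' \<longleftrightarrow>
     (\<exists>S S'. basis_mod V W S \<and> basis_mod V' W' S' \<and> S \<approx> S')"

definition quasi_selfadjoint :: "('n::finite) operator \<Rightarrow> 'n operator \<Rightarrow> 'n operator \<Rightarrow> bool" where
  "quasi_selfadjoint A B T \<longleftrightarrow> T \<in> Ext A B \<and>
     same_quotient_dim (Domain T) (Domain A) (Domain (adj T)) (Domain B)"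

definition correct_dual_pair :: "('n::finite) operator \<Rightarrow> 'n operator \<Rightarrow> bool" where
  "correct_dual_pair A B \<longleftrightarrow> dual_pair A B \<and> closed A \<and> closed B \<and>
     densely_defined A \<and> densely_defined B \<and> (\<exists>T. quasi_selfadjoint A B T)"

section \<open>Dirac type operators on the half-line\<close>

definition absolutely_continuous_on_interval ::
    "real \<Rightarrow> real \<Rightarrow> (real \<Rightarrow> 'a::real_normed_vector) \<Rightarrow> bool" where
  "absolutely_continuous_on_interval a b f \<longleftrightarrow>
     (\<forall>\<epsilon>>0. \<exists>\<delta>>0. \<forall>(m::nat) s t.
        (\<forall>i<m. a \<le> s i \<and> s i \<le> t i \<and> t i \<le> b) \<longrightarrow>
        (\<forall>i<m. \<forall>j<m. i \<noteq> j \<longrightarrow> {s i<..<t i} \<inter> {s j<..<t j} = {}) \<longrightarrow>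
        (\<Sum>i<m. t i - s i) < \<delta> \<longrightarrow>
        (\<Sum>i<m. norm (f (t i) - f (s i))) < \<epsilon>)"

definition AC_loc :: "(real \<Rightarrow> complex^'n) set" where
  "AC_loc = {y. \<forall>b\<ge>0. absolutely_continuous_on_interval 0 b y}"

definition L1_loc :: "(real \<Rightarrow> complex^'n^'n) set" where
  "L1_loc = {Q. \<forall>b\<ge>0. set_integrable lebesgue {0..b} Q}"

definition adjoint_potential :: "(real \<Rightarrow> complex^'n^'n) \<Rightarrow> real \<Rightarrow> complex^'n^'n" where
  "adjoint_potential Q = (\<lambda>x. hermitian_adjoint (Q x))"

text \<open>
  For \<open>y\<close> in \<^const>\<open>AC_loc\<close> the derivative exists almost everywhere; the value of
  \<^const>\<open>vector_derivative\<close> on the remaining null set is irrelevant in \<^typ>\<open>'n L2\<close>.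
\<close>

definition dirac_expr ::
    "complex^'n^'n \<Rightarrow> (real \<Rightarrow> complex^'n^'n) \<Rightarrow> (real \<Rightarrow> complex^'n) \<Rightarrow> real \<Rightarrow> complex^'n" where
  "dirac_expr J Q y = (\<lambda>x. J *v vector_derivative y (at x within {0..}) + Q x *v y x)"

text \<open>
  The domain of the maximal operator consists of the classes of the functions in \<open>max_funs\<close>.
  A class contains, up to values on the negative half-line, at most one such function
  (two continuous functions equal almost everywhere on \<open>[0, \<infinity>)\<close> coincide there), so that
  \<open>y(0)\<close> and the support are well defined for elements of the domain.
\<close>

definition max_funs ::
    "complex^'n^'n \<Rightarrow> (real \<Rightarrow> complex^'n^'n) \<Rightarrow> (real \<Rightarrow> complex^'n) set" where
  "max_funs J Q = {y. y \<in> AC_loc \<and> sq_integrable y \<and> sq_integrable (dirac_expr J Q y)}"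

definition compact_support :: "(real \<Rightarrow> complex^'n) \<Rightarrow> bool" where
  "compact_support y \<longleftrightarrow> compact (closure {x\<in>{0..}. y x \<noteq> 0})"

definition dirac_graph ::
    "complex^'n^'n \<Rightarrow> (real \<Rightarrow> complex^'n^'n) \<Rightarrow> (real \<Rightarrow> complex^'n) set \<Rightarrow> 'n operator" where
  "dirac_graph J Q Y = (\<lambda>y. (abs_L2 y, abs_L2 (dirac_expr J Q y))) ` Y"

definition D_max :: "complex^'n^'n \<Rightarrow> (real \<Rightarrow> complex^'n^'n) \<Rightarrow> 'n operator" where
  "D_max J Q = dirac_graph J Q (max_funs J Q)"

definition D_min :: "complex^'n^'n \<Rightarrow> (real \<Rightarrow> complex^'n^'n) \<Rightarrow> 'n operator" where
  "D_min J Q = closure (dirac_graph J Q {y \<in> max_funs J Q. compact_support y \<and> y 0 = 0})"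

definition D_theta ::
    "complex^'n^'n \<Rightarrow> (real \<Rightarrow> complex^'n^'n) \<Rightarrow> (complex^'n) set \<Rightarrow> 'n operator" where
  "D_theta J Q \<theta> = dirac_graph J Q {y \<in> max_funs J Q. y 0 \<in> \<theta>}"

definition D_theta0 ::
    "complex^'n^'n \<Rightarrow> (real \<Rightarrow> complex^'n^'n) \<Rightarrow> (complex^'n) set \<Rightarrow> 'n operator" where
  "D_theta0 J Q \<theta> = closure (dirac_graph J Q {y \<in> max_funs J Q. y 0 \<in> \<theta> \<and> compact_support y})"

end

theory Submission
  imports Defs
begin

text \<open>
  Two facts carry the theorem.

  The first is Green's formula.  For \<open>y\<close> in the maximal domain of \<open>Q\<close> and \<open>z\<close> in that of \<open>Q\<^sup>*\<close>, the
  derivative of the boundary form \<open>\<langle>J y, z\<rangle>\<close> is \<open>\<langle>D(Q) y, z\<rangle> - \<langle>y, D(Q\<^sup>*) z\<rangle>\<close>: the potentials cancel and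
  \<open>J\<close> is skew-Hermitian.  This derivative is integrable on the half-line, so the boundary form has a
  limit at infinity; being a product of two square integrable functions it is integrable itself, so
  that the limit is zero.  For every \<open>Q\<close> only the term at the origin survives:
  \<open>(D(Q) y, z) - (y, D(Q\<^sup>*) z) = - \<langle>J y(0), z(0)\<rangle>\<close> (lemma \<open>green_formula\<close>).

  The second fact is that the adjoint of the operator on compactly supported functions vanishing at
  the origin is a maximal operator (lemma \<open>adjoint_of_compactly_supported\<close>).  As \<open>Q\<close> is merely locally
  integrable, smooth functions need not lie in the domain, and test functions come from a gauge
  transformation: if \<open>J \<Psi>' + Q \<Psi> = 0\<close> and \<open>\<Psi>(0) = 1\<close>, then \<open>D(Q)(\<Psi> \<phi>) = J \<Psi> \<phi>'\<close>.  For \<open>(g, h)\<close> in the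
  adjoint, testing with \<open>\<Psi> \<phi>\<close> says that \<open>\<Psi>\<^sup>* J\<^sup>* g + \<integral> \<Psi>\<^sup>* h\<close> is orthogonal to all functions of mean zero
  on \<open>[0, b]\<close>, hence constant.  The Wronskian identity \<open>\<Phi>\<^sup>* J \<Psi> = J\<close>, with \<open>\<Phi>\<close> the corresponding solution for
  \<open>Q\<^sup>*\<close>, inverts \<open>\<Psi>\<^sup>* J\<^sup>*\<close>, so that \<open>g\<close> is locally absolutely continuous and \<open>D(Q\<^sup>*) g = h\<close>.  Cutting \<open>\<Psi> v\<close>
  off linearly also gives an element of the domain with compact support and initial value \<open>v\<close>.

  Together these give \<open>(D\<^sub>\<theta>(Q))\<^sup>* = D\<^sub>\<eta>(Q\<^sup>*)\<close> with \<open>\<eta> = \<theta>\<^sup>\<times>\<close>, and the same adjoint for the restriction of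
  \<open>D\<^sub>\<theta>(Q)\<close> to functions of compact support.  Since \<open>\<theta>\<^sup>\<times>\<^sup>\<times> = \<theta>\<close>, the operator \<open>D\<^sub>\<theta>(Q)\<close> is an adjoint and so
  is closed; since its graph and that of the restriction have the same orthogonal complement, it is
  the closure of the restriction.  This is (i), and for \<open>\<theta> = {0}\<close> it describes the minimal operator.
  A proper extension lies between \<open>D\<^sub>\<theta>(Q)\<close> for \<open>\<theta> = {0}\<close> and for \<open>\<theta> = \<complex>\<^sup>n\<close>, so it is determined by
  the subspace of its initial values, which is (ii).  Finally \<open>y \<mapsto> y(0)\<close> identifies the quotient of the
  domains of \<open>D\<^sub>\<theta>(Q)\<close> and \<open>D\<^sub>m\<^sub>i\<^sub>n(Q)\<close> with \<open>\<theta>\<close>, so quasi-selfadjointness says that \<open>\<theta>\<close> and \<open>\<theta>\<^sup>\<times>\<close> have the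
  same dimension, that is \<open>dim \<theta> = n - dim \<theta>\<close>; this is (iii).

  Three pieces of analysis support this.  Absolutely continuous functions are exactly the indefinite
  integrals: for a real function \<open>f\<close> with variation \<open>V\<close>, one direction is the Radon--Nikodym theorem
  applied to the Stieltjes measures of \<open>V\<close> and of \<open>V + f\<close>, and indefinite integrals are differentiable almost everywhere by
  Henstock's lemma combined with Vitali's covering theorem.  The matrix \<open>\<Psi>\<close> is obtained by Picard
  iteration.  Completeness of the space of square integrable functions (Riesz--Fischer) makes
  separation by orthogonal vectors available.
\<close>

section \<open>Absolutely continuous functions and their variation\<close>

text \<open>
  Arbitrary index sets allow families indexed by pairs (a partition of each of several intervals)
  and by the cells of a division.
\<close>
definition nonoverlapping :: "real \<Rightarrow> real \<Rightarrow> 'i set \<Rightarrow> ('i \<Rightarrow> real) \<Rightarrow> ('i \<Rightarrow> real) \<Rightarrow> bool" where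
  "nonoverlapping a b I s t \<longleftrightarrow> (\<forall>i\<in>I. a \<le> s i \<and> s i \<le> t i \<and> t i \<le> b) \<and>
     (\<forall>i\<in>I. \<forall>j\<in>I. i \<noteq> j \<longrightarrow> {s i<..<t i} \<inter> {s j<..<t j} = {})"

lemma nonoverlappingD:
  assumes "nonoverlapping a b I s t" "i \<in> I"
  shows "a \<le> s i" "s i \<le> t i" "t i \<le> b"
  using assms by (auto simp: nonoverlapping_def)

lemma AC_intervalI:
  assumes "\<And>\<epsilon>. 0 < \<epsilon> \<Longrightarrow> \<exists>\<delta>>0. \<forall>(m::nat) s t. nonoverlapping a b {..<m} s t \<longrightarrow>
      (\<Sum>i<m. t i - s i) < \<delta> \<longrightarrow> (\<Sum>i<m. norm (f (t i) - f (s i))) < \<epsilon>"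
  shows "absolutely_continuous_on_interval a b f"
  unfolding absolutely_continuous_on_interval_def
proof (intro allI impI)
  fix \<epsilon> :: real assume "0 < \<epsilon>"
  then obtain \<delta> where \<delta>: "\<delta> > 0" "\<forall>(m::nat) s t. nonoverlapping a b {..<m} s t \<longrightarrow>
      (\<Sum>i<m. t i - s i) < \<delta> \<longrightarrow> (\<Sum>i<m. norm (f (t i) - f (s i))) < \<epsilon>"
    using assms by blast
  show "\<exists>\<delta>>0. \<forall>(m::nat) s t.
        (\<forall>i<m. a \<le> s i \<and> s i \<le> t i \<and> t i \<le> b) \<longrightarrow>
        (\<forall>i<m. \<forall>j<m. i \<noteq> j \<longrightarrow> {s i<..<t i} \<inter> {s j<..<t j} = {}) \<longrightarrow>
        (\<Sum>i<m. t i - s i) < \<delta> \<longrightarrow> (\<Sum>i<m. norm (f (t i) - f (s i))) < \<epsilon>"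
    using \<delta> by (intro exI[of _ \<delta>]) (simp add: nonoverlapping_def)
qed

text \<open>
  A bijection onto an initial segment of the natural numbers carries the defining condition over to
  any finite index set.
\<close>
lemma AC_intervalE:
  assumes "absolutely_continuous_on_interval a b f" "0 < \<epsilon>"
  obtains \<delta> where "\<delta> > 0" "\<And>(I::'i set) s t. finite I \<Longrightarrow> nonoverlapping a b I s t \<Longrightarrow>
      (\<Sum>i\<in>I. t i - s i) < \<delta> \<Longrightarrow> (\<Sum>i\<in>I. norm (f (t i) - f (s i))) < \<epsilon>"
proof -
  from assms(1)[unfolded absolutely_continuous_on_interval_def, THEN spec, THEN mp, OF assms(2)]
  obtain \<delta> where "\<delta> > 0" and \<delta>: "\<forall>(m::nat) s t.
        (\<forall>i<m. a \<le> s i \<and> s i \<le> t i \<and> t i \<le> b) \<longrightarrow>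
        (\<forall>i<m. \<forall>j<m. i \<noteq> j \<longrightarrow> {s i<..<t i} \<inter> {s j<..<t j} = {}) \<longrightarrow>
        (\<Sum>i<m. t i - s i) < \<delta> \<longrightarrow> (\<Sum>i<m. norm (f (t i) - f (s i))) < \<epsilon>"
    by (elim exE conjE)
  have "(\<Sum>i\<in>I. norm (f (t i) - f (s i))) < \<epsilon>"
    if "finite I" and no: "nonoverlapping a b I s t" and le: "(\<Sum>i\<in>I. t i - s i) < \<delta>" for I :: "'i set" and s t
  proof -
    obtain e where e: "bij_betw e {..<card I} I"
      using \<open>finite I\<close> ex_bij_betw_nat_finite atLeast0LessThan by metis
    have inj: "e i = e j \<longleftrightarrow> i = j" if "i < card I" "j < card I" for i j
      using e that by (auto simp: bij_betw_def inj_on_def)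
    have mem: "e i \<in> I" if "i < card I" for i
      using e that by (auto simp: bij_betw_def)
    have eq: "(\<Sum>i\<in>I. h i) = (\<Sum>i<card I. h (e i))" for h :: "'i \<Rightarrow> real"
      using sum.reindex_bij_betw[OF e] by metis
    show ?thesis
      using \<delta>[THEN spec[of _ "card I"], THEN spec[of _ "s \<circ> e"], THEN spec[of _ "t \<circ> e"]] no le mem
      by (simp add: eq inj nonoverlapping_def)
  qed
  then show thesis using that \<open>\<delta> > 0\<close> by blast
qed

lemma AC_imp_continuous_on:
  assumes "absolutely_continuous_on_interval a b f"
  shows "continuous_on {a..b} f"
proof (rule continuous_onI)
  fix x e :: real
  assume x: "x \<in> {a..b}" and "e > 0"
  obtain d where "d > 0" and fam: "\<And>(I::nat set) s t. finite I \<Longrightarrow> nonoverlapping a b I s t \<Longrightarrow>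
      (\<Sum>i\<in>I. t i - s i) < d \<Longrightarrow> (\<Sum>i\<in>I. norm (f (t i) - f (s i))) < e"
    using AC_intervalE[OF assms \<open>e > 0\<close>] by blast
  have d: "norm (f t - f s) < e" if "a \<le> s" "s \<le> t" "t \<le> b" "t - s < d" for s t
    using fam[of "{0}" "\<lambda>_. s" "\<lambda>_. t"] that by (simp add: nonoverlapping_def)
  have "dist (f y) (f x) \<le> e" if "y \<in> {a..b}" "dist y x < d" for y
    using d[of x y] d[of y x] x that
    by (cases "x \<le> y") (auto simp: dist_norm norm_minus_commute less_imp_le)
  then show "\<exists>d>0. \<forall>x'\<in>{a..b}. dist x' x < d \<longrightarrow> dist (f x') (f x) \<le> e"
    using \<open>d > 0\<close> by blast
qed

definition vsum :: "(real \<Rightarrow> 'a::real_normed_vector) \<Rightarrow> nat \<Rightarrow> (nat \<Rightarrow> real) \<Rightarrow> real" where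
  "vsum f m p = (\<Sum>i<m. norm (f (p (Suc i)) - f (p i)))"

text \<open>
  Only the first \<open>m + 1\<close> points of the sequence \<open>p\<close> enter, and the end points \<open>x\<close> and \<open>y\<close> need not be among
  them; therefore clamping \<open>p\<close> to a subinterval gives an admissible sequence again.
\<close>
definition variation_sums :: "(real \<Rightarrow> 'a::real_normed_vector) \<Rightarrow> real \<Rightarrow> real \<Rightarrow> real set" where
  "variation_sums f x y = {vsum f m p |m p. incseq p \<and> (\<forall>i. p i \<in> {x..y})}"

definition variation :: "(real \<Rightarrow> 'a::real_normed_vector) \<Rightarrow> real \<Rightarrow> real \<Rightarrow> real" where
  "variation f x y = Sup (variation_sums f x y)"

lemma variation_sumsE:
  assumes "v \<in> variation_sums f x y"
  obtains m p where "v = vsum f m p" "incseq p" "\<And>i. p i \<in> {x..y}"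
proof -
  from assms obtain m p where "v = vsum f m p \<and> incseq p \<and> (\<forall>i. p i \<in> {x..y})"
    unfolding variation_sums_def by blast
  then show thesis by (intro that[of m p]) (elim conjE, blast)+
qed

lemma incseq_disjoint:
  fixes p :: "nat \<Rightarrow> real"
  assumes "incseq p" "i \<noteq> j"
  shows "{p i<..<p (Suc i)} \<inter> {p j<..<p (Suc j)} = {}"
proof -
  have "p (Suc i) \<le> p j \<or> p (Suc j) \<le> p i"
    using assms by (cases "i < j") (auto simp: incseq_def Suc_leI)
  then show ?thesis by auto
qed

text \<open>
  Cut the interval into \<open>N\<close> pieces shorter than the \<open>\<delta>\<close> that belongs to \<open>\<epsilon> = 1\<close>.  Clamping a partition to
  each piece splits every increment into its parts in the pieces, and the parts in one piece add up
  to less than 1, so that \<open>N\<close> is a bound.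
\<close>
lemma AC_vsum_bounded:
  fixes f :: "real \<Rightarrow> 'a::real_normed_vector"
  assumes ac: "absolutely_continuous_on_interval a b f" and "a \<le> b"
  obtains B where "\<And>m p. incseq p \<Longrightarrow> (\<And>i. p i \<in> {a..b}) \<Longrightarrow> vsum f m p \<le> B"
proof -
  obtain \<delta> where "\<delta> > 0" and \<delta>: "\<And>(I::nat set) s t. finite I \<Longrightarrow> nonoverlapping a b I s t \<Longrightarrow>
      (\<Sum>i\<in>I. t i - s i) < \<delta> \<Longrightarrow> (\<Sum>i\<in>I. norm (f (t i) - f (s i))) < 1"
    using AC_intervalE[OF ac zero_less_one] by blast
  obtain N :: nat where N: "(b - a) / \<delta> < real N"
    using reals_Archimedean2 by blast
  have "N > 0" using N \<open>a \<le> b\<close> \<open>\<delta> > 0\<close>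
    by (metis diff_ge_0_iff_ge divide_nonneg_pos gr0I not_le of_nat_0)
  define h where "h = (b - a) / N"
  have h: "h < \<delta>" "h \<ge> 0" "a + real N * h = b"
    using N \<open>N > 0\<close> \<open>\<delta> > 0\<close> \<open>a \<le> b\<close> by (auto simp: h_def field_simps)
  define g where "g j = a + real j * h" for j
  \<comment> \<open>The pieces are \<open>[g j, g (Suc j)]\<close>, and \<open>cl j\<close> clamps to the \<open>j\<close>-th one.\<close>
  define cl where "cl j x = max (g j) (min (g (Suc j)) x)" for j x
  have gSuc: "g (Suc j) = g j + h" for j by (simp add: g_def algebra_simps)
  have gj: "a \<le> g j" "j \<le> N \<Longrightarrow> g j \<le> b" for j
    using h mult_right_mono[of "real j" "real N" h] by (auto simp: g_def)
  have tele: "(\<Sum>j<n. f (cl j x) - f (g j)) = f (min (g n) x) - f a" if "a \<le> x" for n x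
  proof (induction n)
    case 0 then show ?case using that by (simp add: g_def)
  next
    case (Suc n)
    have "f (cl n x) - f (g n) + f (min (g n) x) = f (min (g (Suc n)) x)"
      using h(2) by (auto simp: cl_def gSuc max_def min_def)
    then show ?case unfolding sum.lessThan_Suc Suc.IH
      by (metis (no_types, opaque_lifting) add.commute add_diff_eq)
  qed
  have "vsum f m p \<le> real N" if p: "incseq p" "\<And>i. p i \<in> {a..b}" for m p
  proof -
    have split: "norm (f (p (Suc i)) - f (p i)) \<le> (\<Sum>j<N. norm (f (cl j (p (Suc i))) - f (cl j (p i))))" for i
    proof -
      have "f (p (Suc i)) - f (p i) = (\<Sum>j<N. f (cl j (p (Suc i))) - f (g j)) - (\<Sum>j<N. f (cl j (p i)) - f (g j))"
        using p(2)[of i] p(2)[of "Suc i"] by (subst (1 2) tele) (auto simp: g_def h(3))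
      also have "\<dots> = (\<Sum>j<N. f (cl j (p (Suc i))) - f (cl j (p i)))"
        by (simp add: sum_subtractf)
      finally show ?thesis by (simp add: norm_sum)
    qed
    have "vsum f m p \<le> (\<Sum>i<m. \<Sum>j<N. norm (f (cl j (p (Suc i))) - f (cl j (p i))))"
      unfolding vsum_def by (intro sum_mono split)
    also have "\<dots> = (\<Sum>j<N. \<Sum>i<m. norm (f (cl j (p (Suc i))) - f (cl j (p i))))"
      by (rule sum.swap)
    also have "\<dots> \<le> (\<Sum>j<N. 1)"
    proof (rule sum_mono)
      fix j assume j: "j \<in> {..<N}"
      have inc: "incseq (\<lambda>i. cl j (p i))"
        unfolding incseq_def cl_def using p(1) by (meson incseqD max.mono min.mono order_refl)
      have rng: "g j \<le> cl j x" "cl j x \<le> g (Suc j)" for x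
        using h(2) by (auto simp: cl_def gSuc)
      have "(\<Sum>i<m. cl j (p (Suc i)) - cl j (p i)) = cl j (p m) - cl j (p 0)"
        by (rule sum_lessThan_telescope)
      also have "\<dots> < \<delta>" using rng[of "p m"] rng[of "p 0"] h(1) gSuc[of j] by linarith
      finally have len: "(\<Sum>i<m. cl j (p (Suc i)) - cl j (p i)) < \<delta>" .
      have "(\<Sum>i<m. norm (f (cl j (p (Suc i))) - f (cl j (p i)))) < 1"
      proof (rule \<delta>[OF _ _ len])
        have "a \<le> cl j (p i) \<and> cl j (p i) \<le> cl j (p (Suc i)) \<and> cl j (p (Suc i)) \<le> b" for i
          using rng order_trans[OF gj(1)[of j]] order_trans[OF _ gj(2)[of "Suc j"]] j incseq_SucD[OF inc]
          by auto
        then show "nonoverlapping a b {..<m} (\<lambda>i. cl j (p i)) (\<lambda>i. cl j (p (Suc i)))"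
          using incseq_disjoint[OF inc] by (simp add: nonoverlapping_def)
      qed simp
      then show "(\<Sum>i<m. norm (f (cl j (p (Suc i))) - f (cl j (p i)))) \<le> 1" by simp
    qed
    finally show ?thesis by simp
  qed
  then show ?thesis using that by blast
qed

lemma variation_sums_bdd:
  assumes "absolutely_continuous_on_interval a b f" "a \<le> x" "x \<le> y" "y \<le> b"
  shows "bdd_above (variation_sums f x y)" "variation_sums f x y \<noteq> {}"
proof -
  have "a \<le> b" using assms by linarith
  obtain B where B: "\<And>m p. incseq p \<Longrightarrow> (\<And>i. p i \<in> {a..b}) \<Longrightarrow> vsum f m p \<le> B"
    by (rule AC_vsum_bounded[OF assms(1) \<open>a \<le> b\<close>]) blast
  have "v \<le> B" if v_mem: "v \<in> variation_sums f x y" for v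
  proof -
    obtain m p where v: "v = vsum f m p" and p: "incseq p" "\<And>i. p i \<in> {x..y}"
      using variation_sumsE[OF v_mem] by blast
    have "p i \<in> {a..b}" for i using p(2)[of i] assms by auto
    then show ?thesis unfolding v by (rule B[OF p(1)])
  qed
  then show "bdd_above (variation_sums f x y)" by (rule bdd_aboveI)
  have "vsum f 0 (\<lambda>_. x) \<in> variation_sums f x y"
    using assms unfolding variation_sums_def by (fastforce intro: incseq_const)
  then show "variation_sums f x y \<noteq> {}" by blast
qed

text \<open>
  A partition of \<open>[a, x]\<close>, continued by the points \<open>x\<close> and \<open>y\<close>, is a partition of \<open>[a, y]\<close>.  It follows that
  the variation is increasing, and so is its sum with \<open>f\<close> if \<open>f\<close> is real valued.
\<close>
lemma variation_dominates:
  assumes ac: "absolutely_continuous_on_interval a b f" and xy: "a \<le> x" "x \<le> y" "y \<le> b"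
  shows "norm (f y - f x) \<le> variation f a y - variation f a x"
proof -
  have "v \<le> variation f a y - norm (f y - f x)" if v_mem: "v \<in> variation_sums f a x" for v
  proof -
    obtain m p where v: "v = vsum f m p" and p: "incseq p" "\<And>i. p i \<in> {a..x}"
      using variation_sumsE[OF v_mem] by blast
    define q where "q i = (if i \<le> m then p i else if i = Suc m then x else y)" for i
    have "incseq q"
    proof (rule incseq_SucI)
      fix i
      show "q i \<le> q (Suc i)"
        using p(1) p(2)[of i] xy by (auto simp: q_def incseq_SucD)
    qed
    moreover have "q i \<in> {a..y}" for i
      using p(2)[of i] xy by (auto simp: q_def)
    ultimately have "vsum f (Suc (Suc m)) q \<le> variation f a y"
      unfolding variation_def
      by (intro cSup_upper variation_sums_bdd[OF ac]) (use xy in \<open>auto simp: variation_sums_def\<close>)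
    moreover have "v + norm (f y - f x) \<le> vsum f (Suc (Suc m)) q"
    proof -
      have "vsum f (Suc (Suc m)) q = (\<Sum>i<m. norm (f (q (Suc i)) - f (q i))) + norm (f x - f (p m)) + norm (f y - f x)"
        by (simp add: vsum_def q_def)
      also have "(\<Sum>i<m. norm (f (q (Suc i)) - f (q i))) = v"
        unfolding v vsum_def by (rule sum.cong) (auto simp: q_def)
      finally show ?thesis by simp
    qed
    ultimately show ?thesis by linarith
  qed
  then have "variation f a x \<le> variation f a y - norm (f y - f x)"
    unfolding variation_def[of f a x]
    by (intro cSup_least variation_sums_bdd[OF ac]) (use xy in auto)
  then show ?thesis by simp
qed

text \<open>
  Clamping a partition of \<open>[a, y]\<close> to \<open>[a, x]\<close> and to \<open>[x, y]\<close> splits its sum into two.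
\<close>
lemma variation_increment_le:
  assumes ac: "absolutely_continuous_on_interval a b f" and xy: "a \<le> x" "x \<le> y" "y \<le> b"
  shows "variation f a y - variation f a x \<le> variation f x y"
proof -
  have "v \<le> variation f a x + variation f x y" if v_mem: "v \<in> variation_sums f a y" for v
  proof -
    obtain m p where v: "v = vsum f m p" and p: "incseq p" "\<And>i. p i \<in> {a..y}"
      using variation_sumsE[OF v_mem] by blast
    \<comment> \<open>Of the two summands \<open>f (min u x)\<close> and \<open>f (max u x)\<close> one is \<open>f u\<close> and the other \<open>f x\<close>.\<close>
    have *: "norm (f u - f w) \<le> norm (f (min u x) - f (min w x)) + norm (f (max u x) - f (max w x))" for u w
    proof -
      have "f u - f w = (f (min u x) - f (min w x)) + (f (max u x) - f (max w x))"
        by (auto simp: min_def max_def)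
      then show ?thesis by (metis norm_triangle_ineq)
    qed
    have "v \<le> vsum f m (\<lambda>i. min (p i) x) + vsum f m (\<lambda>i. max (p i) x)"
      unfolding v vsum_def sum.distrib[symmetric] by (intro sum_mono *)
    moreover have "vsum f m (\<lambda>i. min (p i) x) \<le> variation f a x"
      unfolding variation_def
    proof (intro cSup_upper variation_sums_bdd[OF ac])
      have "incseq (\<lambda>i. min (p i) x)" using p(1) unfolding incseq_def by (meson min.mono order_refl)
      then show "vsum f m (\<lambda>i. min (p i) x) \<in> variation_sums f a x"
        unfolding variation_sums_def using p(2) xy by fastforce
    qed (use xy in auto)
    moreover have "vsum f m (\<lambda>i. max (p i) x) \<le> variation f x y"
      unfolding variation_def
    proof (intro cSup_upper variation_sums_bdd[OF ac])
      have "incseq (\<lambda>i. max (p i) x)" using p(1) unfolding incseq_def by (meson max.mono order_refl)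
      then show "vsum f m (\<lambda>i. max (p i) x) \<in> variation_sums f x y"
        unfolding variation_sums_def using p(2) xy by fastforce
    qed (use xy in auto)
    ultimately show ?thesis by linarith
  qed
  then have "variation f a y \<le> variation f a x + variation f x y"
    unfolding variation_def[of f a y]
    by (intro cSup_least variation_sums_bdd[OF ac]) (use xy in auto)
  then show ?thesis by simp
qed

text \<open>
  Nearly optimal partitions of the given intervals form together one nonoverlapping family of the
  same total length, indexed by pairs, to which the absolute continuity of \<open>f\<close> applies.
\<close>
lemma AC_variation:
  fixes f :: "real \<Rightarrow> 'a::real_normed_vector"
  assumes ac: "absolutely_continuous_on_interval a b f"
  shows "absolutely_continuous_on_interval a b (variation f a)"
proof (rule AC_intervalI)
  fix \<epsilon> :: real assume "\<epsilon> > 0"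
  then have "\<epsilon>/2 > 0" by simp
  then obtain \<delta> where "\<delta> > 0" and \<delta>: "\<And>(I::(nat\<times>nat) set) s t. finite I \<Longrightarrow> nonoverlapping a b I s t \<Longrightarrow>
      (\<Sum>i\<in>I. t i - s i) < \<delta> \<Longrightarrow> (\<Sum>i\<in>I. norm (f (t i) - f (s i))) < \<epsilon>/2"
    using AC_intervalE[OF ac] by blast
  have "(\<Sum>i<m. norm (variation f a (t i) - variation f a (s i))) < \<epsilon>"
    if no: "nonoverlapping a b {..<m} s t" and le: "(\<Sum>i<m. t i - s i) < \<delta>" for m :: nat and s t
  proof -
    have st: "a \<le> s i" "s i \<le> t i" "t i \<le> b" if "i < m" for i
      using nonoverlappingD[OF no, of i] that by auto
    have dj: "{s i<..<t i} \<inter> {s j<..<t j} = {}" if "i < m" "j < m" "i \<noteq> j" for i j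
      using no that by (auto simp: nonoverlapping_def)
    define \<eta> where "\<eta> = \<epsilon> / (2 * (real m + 1))"
    have "\<eta> > 0" using \<open>\<epsilon> > 0\<close> by (simp add: \<eta>_def)
    have "\<forall>i<m. \<exists>k p. incseq p \<and> (\<forall>j. p j \<in> {s i..t i}) \<and> variation f (s i) (t i) < vsum f k p + \<eta>"
    proof (intro allI impI)
      fix i assume "i < m"
      note bd = variation_sums_bdd[OF ac st[OF this]]
      have "variation f (s i) (t i) - \<eta> < Sup (variation_sums f (s i) (t i))"
        using \<open>\<eta> > 0\<close> by (simp add: variation_def)
      then obtain v where "v \<in> variation_sums f (s i) (t i)" "variation f (s i) (t i) - \<eta> < v"
        using less_cSup_iff[OF bd(2,1)] by blast
      then show "\<exists>k p. incseq p \<and> (\<forall>j. p j \<in> {s i..t i}) \<and> variation f (s i) (t i) < vsum f k p + \<eta>"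
        unfolding variation_sums_def by (smt (verit) mem_Collect_eq)
    qed
    then obtain k p where p: "\<And>i. i < m \<Longrightarrow> incseq (p i)" "\<And>i j. i < m \<Longrightarrow> p i j \<in> {s i..t i}"
      "\<And>i. i < m \<Longrightarrow> variation f (s i) (t i) < vsum f (k i) (p i) + \<eta>" by metis
    define I where "I = Sigma {..<m} (\<lambda>i. {..<k i})"
    define S where "S = (\<lambda>(i, j). p i j)"
    define T where "T = (\<lambda>(i, j). p i (Suc j))"
    have "(\<Sum>ij\<in>I. norm (f (T ij) - f (S ij))) < \<epsilon>/2"
    proof (rule \<delta>)
      show "finite I" by (simp add: I_def)
      show "nonoverlapping a b I S T"
        unfolding nonoverlapping_def
      proof (intro conjI ballI impI)
        fix u assume "u \<in> I"
        then obtain i j where u: "u = (i, j)" "i < m" by (auto simp: I_def)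
        show "a \<le> S u" "S u \<le> T u" "T u \<le> b"
          using st[OF u(2)] p(2)[OF u(2), of j] p(2)[OF u(2), of "Suc j"] incseq_SucD[OF p(1)[OF u(2)]]
          by (auto simp: u S_def T_def)
      next
        fix u v assume uv: "u \<in> I" "v \<in> I" "u \<noteq> v"
        show "{S u<..<T u} \<inter> {S v<..<T v} = {}"
        proof (cases "fst u = fst v")
          case True
          then have ne: "snd u \<noteq> snd v" using uv(3) by (simp add: prod_eq_iff)
          have "fst u < m" using uv(1) by (auto simp: I_def)
          from incseq_disjoint[OF p(1)[OF this] ne] True show ?thesis
            by (simp add: S_def T_def case_prod_unfold)
        next
          case False
          have "{S u<..<T u} \<subseteq> {s (fst u)<..<t (fst u)}" "{S v<..<T v} \<subseteq> {s (fst v)<..<t (fst v)}"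
            using p(2)[of "fst u" "snd u"] p(2)[of "fst u" "Suc (snd u)"]
              p(2)[of "fst v" "snd v"] p(2)[of "fst v" "Suc (snd v)"] uv
            by (auto simp: I_def S_def T_def split: prod.splits)
          moreover have "{s (fst u)<..<t (fst u)} \<inter> {s (fst v)<..<t (fst v)} = {}"
            using dj False uv(1,2) by (auto simp: I_def)
          ultimately show ?thesis by blast
        qed
      qed
      have "(\<Sum>ij\<in>I. T ij - S ij) = (\<Sum>i<m. \<Sum>j<k i. p i (Suc j) - p i j)"
        unfolding I_def S_def T_def by (subst sum.Sigma) (auto intro!: sum.cong)
      also have "\<dots> = (\<Sum>i<m. p i (k i) - p i 0)"
        by (simp add: sum_lessThan_telescope)
      also have "\<dots> \<le> (\<Sum>i<m. t i - s i)"
        proof (rule sum_mono)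
        fix i assume "i \<in> {..<m}"
        then show "p i (k i) - p i 0 \<le> t i - s i" using p(2)[of i "k i"] p(2)[of i 0] by auto
      qed
      finally show "(\<Sum>ij\<in>I. T ij - S ij) < \<delta>" using le by simp
    qed
    moreover have "(\<Sum>ij\<in>I. norm (f (T ij) - f (S ij))) = (\<Sum>i<m. vsum f (k i) (p i))"
      unfolding I_def S_def T_def vsum_def by (subst sum.Sigma) (auto intro!: sum.cong)
    moreover have "(\<Sum>i<m. norm (variation f a (t i) - variation f a (s i))) \<le> (\<Sum>i<m. vsum f (k i) (p i) + \<eta>)"
    proof (rule sum_mono)
      fix i assume "i \<in> {..<m}"
      then have i: "i < m" "a \<le> s i" "s i \<le> t i" "t i \<le> b" using st by auto
      have "0 \<le> norm (f (t i) - f (s i))" by simp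
      also note variation_dominates[OF ac i(2-4)]
      finally show "norm (variation f a (t i) - variation f a (s i)) \<le> vsum f (k i) (p i) + \<eta>"
        using variation_increment_le[OF ac i(2-4)] p(3)[OF i(1)] by simp
    qed
    moreover have "(\<Sum>i<m. \<eta>) < \<epsilon>/2"
      using \<open>\<epsilon> > 0\<close> by (simp add: \<eta>_def field_simps)
    ultimately show ?thesis by (simp add: sum.distrib)
  qed
  then show "\<exists>\<delta>>0. \<forall>(m::nat) s t. nonoverlapping a b {..<m} s t \<longrightarrow> (\<Sum>i<m. t i - s i) < \<delta> \<longrightarrow>
      (\<Sum>i<m. norm (variation f a (t i) - variation f a (s i))) < \<epsilon>"
    using \<open>\<delta> > 0\<close> by blast
qed

section \<open>Absolutely continuous functions are indefinite integrals\<close>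

text \<open>
  Linear images, bilinear combinations and sums of absolutely continuous functions are all covered by
  this comparison of increments.
\<close>
lemma AC_dominated:
  fixes f :: "real \<Rightarrow> 'a::real_normed_vector" and g :: "real \<Rightarrow> 'b::real_normed_vector"
    and h :: "real \<Rightarrow> 'c::real_normed_vector"
  assumes g: "absolutely_continuous_on_interval a b g" and h: "absolutely_continuous_on_interval a b h"
    and "0 < C"
    and le: "\<And>x y. a \<le> x \<Longrightarrow> x \<le> y \<Longrightarrow> y \<le> b \<Longrightarrow> norm (f y - f x) \<le> C * (norm (g y - g x) + norm (h y - h x))"
  shows "absolutely_continuous_on_interval a b f"
proof (rule AC_intervalI)
  fix \<epsilon> :: real assume "\<epsilon> > 0"
  then have e: "\<epsilon> / (2 * C) > 0" using \<open>0 < C\<close> by simp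
  obtain \<delta>1 where d1: "\<delta>1 > 0" and \<delta>1: "\<And>(I::nat set) s t. finite I \<Longrightarrow> nonoverlapping a b I s t \<Longrightarrow>
      (\<Sum>i\<in>I. t i - s i) < \<delta>1 \<Longrightarrow> (\<Sum>i\<in>I. norm (g (t i) - g (s i))) < \<epsilon> / (2 * C)"
    using AC_intervalE[OF g e] by blast
  obtain \<delta>2 where d2: "\<delta>2 > 0" and \<delta>2: "\<And>(I::nat set) s t. finite I \<Longrightarrow> nonoverlapping a b I s t \<Longrightarrow>
      (\<Sum>i\<in>I. t i - s i) < \<delta>2 \<Longrightarrow> (\<Sum>i\<in>I. norm (h (t i) - h (s i))) < \<epsilon> / (2 * C)"
    using AC_intervalE[OF h e] by blast
  have "(\<Sum>i<m. norm (f (t i) - f (s i))) < \<epsilon>"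
    if no: "nonoverlapping a b {..<m} s t" and len: "(\<Sum>i<m. t i - s i) < min \<delta>1 \<delta>2" for m :: nat and s t
  proof -
    have "(\<Sum>i<m. norm (f (t i) - f (s i))) \<le> (\<Sum>i<m. C * (norm (g (t i) - g (s i)) + norm (h (t i) - h (s i))))"
      by (intro sum_mono le nonoverlappingD[OF no]) simp_all
    also have "\<dots> = C * ((\<Sum>i<m. norm (g (t i) - g (s i))) + (\<Sum>i<m. norm (h (t i) - h (s i))))"
      by (simp add: sum_distrib_left sum.distrib distrib_left)
    also have "\<dots> < C * (\<epsilon> / (2 * C) + \<epsilon> / (2 * C))"
      using \<delta>1[OF _ no] \<delta>2[OF _ no] len \<open>0 < C\<close> by (intro mult_strict_left_mono add_strict_mono) simp_all
    also have "\<dots> = \<epsilon>" using \<open>0 < C\<close> by (simp add: field_simps)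
    finally show ?thesis .
  qed
  moreover have "min \<delta>1 \<delta>2 > 0" using d1 d2 by simp
  ultimately show "\<exists>\<delta>>0. \<forall>(m::nat) s t. nonoverlapping a b {..<m} s t \<longrightarrow> (\<Sum>i<m. t i - s i) < \<delta> \<longrightarrow>
      (\<Sum>i<m. norm (f (t i) - f (s i))) < \<epsilon>"
    by blast
qed

lemma AC_bounded_linear:
  assumes ac: "absolutely_continuous_on_interval a b g" and h: "bounded_linear h"
  shows "absolutely_continuous_on_interval a b (\<lambda>x. h (g x))"
proof -
  obtain K where K: "\<And>x. norm (h x) \<le> norm x * K" "K > 0" using bounded_linear.pos_bounded[OF h] by blast
  show ?thesis
  proof (rule AC_dominated[OF ac ac K(2)])
    fix x y
    have "norm (h (g y) - h (g x)) \<le> K * norm (g y - g x)"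
      using K(1)[of "g y - g x"] by (simp add: linear_diff[OF bounded_linear.linear[OF h]] mult.commute)
    also have "\<dots> \<le> K * (norm (g y - g x) + norm (g y - g x))" using K(2) by (intro mult_left_mono) auto
    finally show "norm (h (g y) - h (g x)) \<le> K * (norm (g y - g x) + norm (g y - g x))" .
  qed
qed

lemma AC_bilinear:
  assumes B: "bounded_bilinear B"
    and f: "absolutely_continuous_on_interval a b f" and g: "absolutely_continuous_on_interval a b g"
  shows "absolutely_continuous_on_interval a b (\<lambda>x. B (f x) (g x))"
proof -
  interpret bounded_bilinear B by (rule B)
  obtain K where K: "K > 0" "\<And>u v. norm (B u v) \<le> norm u * norm v * K" using pos_bounded by blast
  have "bounded (f ` {a..b})" "bounded (g ` {a..b})"
    by (rule compact_imp_bounded, rule compact_continuous_image[OF AC_imp_continuous_on], fact, simp)+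
  then obtain Mf Mg where M: "Mf > 0" "\<And>x. x \<in> {a..b} \<Longrightarrow> norm (f x) \<le> Mf"
     "Mg > 0" "\<And>x. x \<in> {a..b} \<Longrightarrow> norm (g x) \<le> Mg"
    unfolding bounded_pos by blast
  define C where "C = max Mf Mg * K"
  have "C > 0" using K(1) M(1) by (simp add: C_def)
  show ?thesis
  proof (rule AC_dominated[OF f g \<open>C > 0\<close>])
    fix x y assume xy: "a \<le> x" "x \<le> y" "y \<le> b"
    have "B (f y) (g y) - B (f x) (g x) = B (f y - f x) (g y) + B (f x) (g y - g x)"
      by (simp add: diff_left diff_right)
    then have "norm (B (f y) (g y) - B (f x) (g x)) \<le> norm (B (f y - f x) (g y)) + norm (B (f x) (g y - g x))"
      by (metis norm_triangle_ineq)
    also have "norm (B (f y - f x) (g y)) \<le> norm (f y - f x) * norm (g y) * K" by (rule K)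
    also have "\<dots> \<le> norm (f y - f x) * max Mf Mg * K"
      using K(1) M(4)[of y] xy by (intro mult_right_mono mult_left_mono) auto
    also have "norm (B (f x) (g y - g x)) \<le> norm (f x) * norm (g y - g x) * K" by (rule K)
    also have "\<dots> \<le> max Mf Mg * norm (g y - g x) * K"
      using K(1) M(2)[of x] xy by (intro mult_right_mono) auto
    finally show "norm (B (f y) (g y) - B (f x) (g x)) \<le> C * (norm (f y - f x) + norm (g y - g x))"
      by (simp add: C_def algebra_simps)
  qed
qed

text \<open>
  Here \<open>M\<close> is the Stieltjes measure of \<open>G\<close>, extended to the line by clamping the argument to \<open>[a, b]\<close>.
  Cover a null set by an open set of small Lebesgue measure and exhaust this by finite unions of
  closed intervals; a division of such a union is a nonoverlapping family of small total length, so
  its \<open>M\<close>-measure is controlled by absolute continuity.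
\<close>
lemma mono_AC_null_sets:
  fixes G :: "real \<Rightarrow> real"
  assumes ac: "absolutely_continuous_on_interval a b G" and "a \<le> b"
    and mono: "\<And>x y. a \<le> x \<Longrightarrow> x \<le> y \<Longrightarrow> y \<le> b \<Longrightarrow> G x \<le> G y"
    and cl_def: "\<And>x. cl x = max a (min b x)"
    and M: "sets M = sets borel" "\<And>x y. x \<le> y \<Longrightarrow> emeasure M {x..y} = ennreal (G (cl y) - G (cl x))"
  shows "null_sets lborel \<subseteq> null_sets M"
proof
  fix N :: "real set" assume N: "N \<in> null_sets lborel"
  have clm: "cl x \<le> cl y" "a \<le> cl x" "cl y \<le> b" "cl y - cl x \<le> y - x" if "x \<le> y" for x y
    using that \<open>a \<le> b\<close> by (auto simp: cl_def)
  have small: "emeasure M N \<le> 0 + ennreal \<epsilon>" if "\<epsilon> > 0" for \<epsilon>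
  proof -
    obtain \<delta> where "\<delta> > 0" and \<delta>: "\<And>(I::real set set) s t. finite I \<Longrightarrow> nonoverlapping a b I s t \<Longrightarrow>
        (\<Sum>i\<in>I. t i - s i) < \<delta> \<Longrightarrow> (\<Sum>i\<in>I. norm (G (t i) - G (s i))) < \<epsilon>"
      using AC_intervalE[OF ac \<open>\<epsilon> > 0\<close>] by blast
    have NL: "N \<in> sets lebesgue" "emeasure lebesgue N = 0"
      using N by (auto simp: null_sets_def emeasure_completion)
    obtain U where U: "open U" "N \<subseteq> U" "emeasure lebesgue (U - N) < ennreal \<delta>"
      using sets_lebesgue_outer_open[OF NL(1) \<open>\<delta> > 0\<close>] by metis
    have Ub: "U \<in> sets borel" using U(1) by simp
    have "emeasure lebesgue U \<le> emeasure lebesgue (U - N) + emeasure lebesgue N"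
      using U(2) by (metis NL(1) Un_Diff_cancel2 Un_absorb2 Ub emeasure_subadditive sets.Diff sets_completionI_sets sets_lborel)
    then have Ud: "emeasure lebesgue U < ennreal \<delta>" using U(3) NL(2) by simp
    obtain \<D> where D: "countable \<D>" "\<D> \<subseteq> Pow U" "\<And>X. X \<in> \<D> \<Longrightarrow> \<exists>c d. X = cbox c d" "\<Union>\<D> = U"
      by (rule open_countable_Union_open_cbox[OF U(1)]) blast
    have fin: "emeasure M (\<Union>\<F>) \<le> ennreal \<epsilon>" if F: "finite \<F>" "\<F> \<subseteq> \<D>" for \<F>
    proof -
      obtain p where p: "p division_of (\<Union>\<F>)"
        using elementary_unions_intervals[OF F(1)] D(3) F(2) by blast
      note pD = division_ofD[OF p]
      define s where "s K = (Inf K :: real)" for K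
      define t where "t K = (Sup K :: real)" for K
      have K: "K = {s K..t K}" "s K \<le> t K" if "K \<in> p" for K
      proof -
        have "\<exists>c d. K = cbox c d" using pD(4)[OF that] .
        then obtain c d where "K = cbox c d" by blast
        moreover have "K \<noteq> {}" using pD(3)[OF that] .
        ultimately show "K = {s K..t K}" "s K \<le> t K" by (auto simp: s_def t_def)
      qed
      have intK: "interior K = {s K<..<t K}" if "K \<in> p" for K
        using arg_cong[OF K(1)[OF that], of interior] by simp
      have convK: "convex K" if "K \<in> p" for K
        by (subst K(1)[OF that]) simp
      have bK: "K \<in> sets borel" if "K \<in> p" for K
        by (subst K(1)[OF that]) simp
      have pw: "interior K \<inter> interior L = {}" if "K \<in> p" "L \<in> p" "K \<noteq> L" for K L
        using pD(5) that by blast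
      have "(\<Sum>K\<in>p. norm (G (cl (t K)) - G (cl (s K)))) < \<epsilon>"
      proof (rule \<delta>)
        show "finite p" by (rule pD(1))
        show "nonoverlapping a b p (\<lambda>K. cl (s K)) (\<lambda>K. cl (t K))"
          unfolding nonoverlapping_def
        proof (intro conjI ballI impI)
          fix K assume "K \<in> p"
          from clm[OF K(2)[OF this]] show "a \<le> cl (s K)" "cl (s K) \<le> cl (t K)" "cl (t K) \<le> b" by auto
        next
          fix i j assume ij: "i \<in> p" "j \<in> p" "i \<noteq> j"
          have "{cl (s i)<..<cl (t i)} \<subseteq> {s i<..<t i}" "{cl (s j)<..<cl (t j)} \<subseteq> {s j<..<t j}"
            by (auto simp: cl_def)
          moreover have "{s i<..<t i} \<inter> {s j<..<t j} = {}"
            using pw[OF ij] intK ij by simp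
          ultimately show "{cl (s i)<..<cl (t i)} \<inter> {cl (s j)<..<cl (t j)} = {}" by blast
        qed
        have "(\<Sum>K\<in>p. cl (t K) - cl (s K)) \<le> (\<Sum>K\<in>p. t K - s K)"
          by (intro sum_mono clm K(2))
        also have "\<dots> = (\<Sum>K\<in>p. measure lebesgue K)"
        proof (rule sum.cong)
          fix K assume "K \<in> p"
          then show "t K - s K = measure lebesgue K"
            using arg_cong[OF K(1), of K "measure lebesgue"] K(2) by simp
        qed simp
        also have "\<dots> = measure lebesgue (\<Union>p)"
        proof (rule measure_negligible_finite_Union[symmetric, OF pD(1)])
          show "S \<in> lmeasurable" if "S \<in> p" for S
            using pD(4)[OF that] by (metis lmeasurable_cbox)
          show "pairwise (\<lambda>S T. negligible (S \<inter> T)) p"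
          proof (rule pairwiseI)
            fix S T assume ST: "S \<in> p" "T \<in> p" "S \<noteq> T"
            have "convex (S \<inter> T)" by (intro convex_Int convK ST)
            moreover have "interior (S \<inter> T) = {}" using pw[OF ST] by simp
            ultimately show "negligible (S \<inter> T)" using negligible_convex_interior by blast
          qed
        qed
        also have "\<dots> = measure lebesgue (\<Union>\<F>)" using pD(6) by simp
        also have "\<dots> < \<delta>"
        proof -
          have "emeasure lebesgue (\<Union>\<F>) \<le> emeasure lebesgue U"
            by (rule emeasure_mono) (use F(2) D(2) Ub in auto)
          then have "emeasure lebesgue (\<Union>\<F>) < ennreal \<delta>" using Ud by simp
          moreover from this have "emeasure lebesgue (\<Union>\<F>) \<noteq> top" by auto
          ultimately have "ennreal (measure lebesgue (\<Union>\<F>)) < ennreal \<delta>"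
            using emeasure_eq_ennreal_measure by metis
          then show ?thesis by (simp add: ennreal_less_iff)
        qed
        finally show "(\<Sum>i\<in>p. cl (t i) - cl (s i)) < \<delta>" .
      qed
      moreover have "emeasure M (\<Union>\<F>) \<le> (\<Sum>K\<in>p. emeasure M K)"
      proof -
        have "p \<subseteq> sets M" using bK M(1) by blast
        then have "emeasure M (\<Union>K\<in>p. K) \<le> (\<Sum>K\<in>p. emeasure M K)"
          by (intro emeasure_subadditive_finite pD(1)) simp
        then show ?thesis using pD(6) by simp
      qed
      moreover have "(\<Sum>K\<in>p. emeasure M K) = (\<Sum>K\<in>p. ennreal (norm (G (cl (t K)) - G (cl (s K)))))"
      proof (rule sum.cong)
        fix KK assume KK: "KK \<in> p"
        have "G (cl (s KK)) \<le> G (cl (t KK))" by (rule mono) (use clm[OF K(2)[OF KK]] in auto)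
        then show "emeasure M KK = ennreal (norm (G (cl (t KK)) - G (cl (s KK))))"
          using M(2)[OF K(2)[OF KK]] arg_cong[OF K(1)[OF KK], of "emeasure M"] by simp
      qed simp
      ultimately have "emeasure M (\<Union>\<F>) \<le> ennreal (\<Sum>K\<in>p. norm (G (cl (t K)) - G (cl (s K))))"
        by (simp add: sum_ennreal)
      also have "\<dots> \<le> ennreal \<epsilon>"
        using \<open>(\<Sum>K\<in>p. norm (G (cl (t K)) - G (cl (s K)))) < \<epsilon>\<close> by (intro ennreal_leI) simp
      finally show ?thesis .
    qed
    have "emeasure M N \<le> emeasure M U"
      using U(2) Ub M(1) by (intro emeasure_mono) auto
    also have "emeasure M U \<le> ennreal \<epsilon>"
    proof (cases "\<D> = {}")
      case True then show ?thesis using D(4) by auto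
    next
      case False
      define A where "A n = (\<Union>i\<le>n. from_nat_into \<D> i)" for n
      have rng: "from_nat_into \<D> i \<in> \<D>" for i using False by (rule from_nat_into)
      have setsD: "X \<in> sets M" if X: "X \<in> \<D>" for X
      proof -
        have "\<exists>c d. X = cbox c d" by (rule D(3)[OF X])
        then obtain c d where "X = cbox c d" by (elim exE)
        then show ?thesis by (simp only: M(1)) simp
      qed
      have "(\<Union>n. A n) = U"
      proof -
        have "(\<Union>n. A n) = \<Union>(range (from_nat_into \<D>))" unfolding A_def by auto
        then show ?thesis using range_from_nat_into[OF False D(1)] D(4) by simp
      qed
      moreover have "(SUP n. emeasure M (A n)) = emeasure M (\<Union>n. A n)"
      proof (rule SUP_emeasure_incseq)
        show "range A \<subseteq> sets M" unfolding A_def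
          by (intro image_subsetI sets.finite_UN setsD rng) simp
        show "incseq A" unfolding A_def by (intro incseq_SucI UN_mono) auto
      qed
      moreover have "emeasure M (A n) \<le> ennreal \<epsilon>" for n
        unfolding A_def by (rule fin) (use rng in auto)
      then have "(SUP n. emeasure M (A n)) \<le> ennreal \<epsilon>" by (rule SUP_least)
      ultimately show ?thesis by simp
    qed
    finally show ?thesis by simp
  qed
  have "emeasure M N \<le> 0"
    by (rule ennreal_le_epsilon) (rule small)
  then have "emeasure M N = 0" by simp
  moreover have "N \<in> sets M" using N by (simp only: M(1)) auto
  ultimately show "N \<in> null_sets M" by (rule null_setsI)
qed

text \<open>
  The integrand is the Radon--Nikodym density of the Stieltjes measure of \<open>G\<close>.
\<close>
lemma mono_AC_imp_integral:
  fixes G :: "real \<Rightarrow> real"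
  assumes ac: "absolutely_continuous_on_interval a b G" and "a \<le> b"
    and mono: "\<And>x y. a \<le> x \<Longrightarrow> x \<le> y \<Longrightarrow> y \<le> b \<Longrightarrow> G x \<le> G y"
  obtains k where "k absolutely_integrable_on {a..b}" "\<And>x. x \<in> {a..b} \<Longrightarrow> integral {a..x} k = G x - G a"
proof -
  define cl where "cl x = max a (min b x)" for x
  define M where "M = interval_measure (\<lambda>x. G (cl x))"
  have clr: "cl x \<in> {a..b}" "x \<in> {a..b} \<Longrightarrow> cl x = x" for x using \<open>a \<le> b\<close> by (auto simp: cl_def)
  have monoF: "G (cl x) \<le> G (cl y)" if "x \<le> y" for x y
    by (rule mono) (use that \<open>a \<le> b\<close> in \<open>auto simp: cl_def\<close>)
  have "continuous_on UNIV cl" unfolding cl_def by (intro continuous_intros)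
  then have contF: "continuous_on UNIV (\<lambda>x. G (cl x))"
    by (rule continuous_on_compose2[OF AC_imp_continuous_on[OF ac]]) (rule image_subsetI, rule clr(1))
  have eM: "emeasure M {x..y} = ennreal (G (cl y) - G (cl x))" if "x \<le> y" for x y
    unfolding M_def by (rule emeasure_interval_measure_Icc[OF that monoF contF])
  have sM: "sets M = sets borel" by (simp add: M_def)
  have "null_sets lborel \<subseteq> null_sets M"
    by (rule mono_AC_null_sets[OF ac \<open>a \<le> b\<close> mono cl_def sM eM])
  then obtain r where r: "r \<in> borel_measurable lborel" "density lborel r = M"
    using sigma_finite_measure.Radon_Nikodym[OF sigma_finite_lborel, of M] sM unfolding absolutely_continuous_def by auto
  have nn: "(\<integral>\<^sup>+t. r t * indicator {a..x} t \<partial>lborel) = ennreal (G x - G a)" if "x \<in> {a..b}" for x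
    using eM[of a x] that \<open>a \<le> b\<close> r emeasure_density[OF r(1), of "{a..x}"] clr(2) by simp
  have fin: "AE t in lborel. r t * indicator {a..b} t \<noteq> \<infinity>"
    by (rule nn_integral_PInf_AE) (use r nn[of b] \<open>a \<le> b\<close> in auto)
  define k where "k t = enn2real (r t)" for t
  have hi: "(k has_integral (G x - G a)) {a..x}" if x: "x \<in> {a..b}" for x
  proof -
    have "(\<integral>\<^sup>+t. ennreal (k t * indicator {a..x} t) \<partial>lborel) = (\<integral>\<^sup>+t. r t * indicator {a..x} t \<partial>lborel)"
      by (rule nn_integral_cong_AE, rule AE_mp[OF fin], rule AE_I2)
        (use x in \<open>auto simp: k_def indicator_def ennreal_enn2real_if\<close>)
    then have "((\<lambda>t. k t * indicator {a..x} t) has_integral (G x - G a)) UNIV"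
      using r(1) mono[of a x] x by (intro nn_integral_has_integral) (auto simp: k_def nn)
    moreover have "(\<lambda>t. k t * indicator {a..x} t) = (\<lambda>t. if t \<in> {a..x} then k t else 0)"
      by (auto simp: fun_eq_iff)
    ultimately have "((\<lambda>t. if t \<in> {a..x} then k t else 0) has_integral (G x - G a)) UNIV" by (simp only:)
    then show ?thesis by (simp only: has_integral_restrict_UNIV)
  qed
  show thesis
  proof (rule that)
    show "k absolutely_integrable_on {a..b}"
      using hi[of b] \<open>a \<le> b\<close> by (intro nonnegative_absolutely_integrable_1) (auto simp: k_def)
    show "integral {a..x} k = G x - G a" if "x \<in> {a..b}" for x
      using hi[OF that] by (rule integral_unique)
  qed
qed

text \<open>
  Jordan decomposition: \<open>f = (V + f) - V\<close> with the variation \<open>V\<close> of \<open>f\<close>.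
\<close>
lemma AC_real_imp_integral:
  fixes f :: "real \<Rightarrow> real"
  assumes ac: "absolutely_continuous_on_interval a b f" and "a \<le> b"
  obtains k where "k absolutely_integrable_on {a..b}" "\<And>x. x \<in> {a..b} \<Longrightarrow> integral {a..x} k = f x - f a"
proof -
  define V where "V = variation f a"
  have dom: "\<bar>f y - f x\<bar> \<le> V y - V x" if "a \<le> x" "x \<le> y" "y \<le> b" for x y
    using variation_dominates[OF ac that] by (simp add: V_def)
  have acV: "absolutely_continuous_on_interval a b V"
    unfolding V_def by (rule AC_variation[OF ac])
  have acVf: "absolutely_continuous_on_interval a b (\<lambda>x. V x + f x)"
  proof (rule AC_dominated[OF acV acV zero_less_one])
    fix x y assume "a \<le> x" "x \<le> y" "y \<le> b"
    from dom[OF this] show "norm (V y + f y - (V x + f x)) \<le> 1 * (norm (V y - V x) + norm (V y - V x))"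
      by (simp add: abs_le_iff abs_if split: if_splits)
  qed
  have monoV: "V x \<le> V y" "V x + f x \<le> V y + f y" if "a \<le> x" "x \<le> y" "y \<le> b" for x y
    using dom[OF that] by linarith+
  obtain k1 where k1: "k1 absolutely_integrable_on {a..b}" "\<And>x. x \<in> {a..b} \<Longrightarrow> integral {a..x} k1 = V x - V a"
    using mono_AC_imp_integral[OF acV \<open>a \<le> b\<close> monoV(1)] by blast
  obtain k2 where k2: "k2 absolutely_integrable_on {a..b}" "\<And>x. x \<in> {a..b} \<Longrightarrow> integral {a..x} k2 = (V x + f x) - (V a + f a)"
    using mono_AC_imp_integral[OF acVf \<open>a \<le> b\<close> monoV(2)] by blast
  show thesis
  proof (rule that)
    show "(\<lambda>x. k2 x - k1 x) absolutely_integrable_on {a..b}"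
      by (intro set_integral_diff(1) k1 k2)
    fix x assume x: "x \<in> {a..b}"
    have "k1 integrable_on {a..x}" "k2 integrable_on {a..x}"
      using x k1(1) k2(1) by (auto intro!: integrable_on_subinterval[of _ "{a..b}"] simp: absolutely_integrable_on_def)
    then have "integral {a..x} (\<lambda>x. k2 x - k1 x) = integral {a..x} k2 - integral {a..x} k1"
      by (intro integral_diff)
    then show "integral {a..x} (\<lambda>x. k2 x - k1 x) = f x - f a"
      using k1(2)[OF x] k2(2)[OF x] by simp
  qed
qed

lemma AC_imp_integral:
  fixes f :: "real \<Rightarrow> 'a::euclidean_space"
  assumes ac: "absolutely_continuous_on_interval a b f" and "a \<le> b"
  obtains k where "k absolutely_integrable_on {a..b}" "\<And>x. x \<in> {a..b} \<Longrightarrow> integral {a..x} k = f x - f a"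
proof -
  have "\<exists>k. k absolutely_integrable_on {a..b} \<and> (\<forall>x\<in>{a..b}. integral {a..x} k = f x \<bullet> i - f a \<bullet> i)" for i :: 'a
    by (rule AC_real_imp_integral[OF AC_bounded_linear[OF ac bounded_linear_inner_left[of i]] \<open>a \<le> b\<close>]) blast
  then obtain k where k: "\<And>i::'a. k i absolutely_integrable_on {a..b}"
    "\<And>i x. x \<in> {a..b} \<Longrightarrow> integral {a..x} (k i) = f x \<bullet> i - f a \<bullet> i" by metis
  show thesis
  proof (rule that)
    show "(\<lambda>t. \<Sum>i\<in>Basis. k i t *\<^sub>R i) absolutely_integrable_on {a..b}"
      by (intro absolutely_integrable_sum finite_Basis absolutely_integrable_linear[OF k(1) bounded_linear_scaleR_left, unfolded o_def])
    fix x assume x: "x \<in> {a..b}"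
    have "(k i has_integral (f x \<bullet> i - f a \<bullet> i)) {a..x}" for i
    proof -
      have "k i integrable_on {a..x}"
        by (rule integrable_on_subinterval[OF set_lebesgue_integral_eq_integral(1)[OF k(1)]]) (use x in auto)
      then show ?thesis unfolding k(2)[OF x, symmetric] by (rule integrable_integral)
    qed
    then have "((\<lambda>t. \<Sum>i\<in>Basis. k i t *\<^sub>R i) has_integral (\<Sum>i\<in>Basis. (f x \<bullet> i - f a \<bullet> i) *\<^sub>R i)) {a..x}"
      by (intro has_integral_sum has_integral_scaleR_left finite_Basis)
    moreover have "(\<Sum>i\<in>Basis. (f x \<bullet> i - f a \<bullet> i) *\<^sub>R i) = f x - f a"
      by (simp add: inner_diff_left[symmetric] euclidean_representation)
    ultimately show "integral {a..x} (\<lambda>t. \<Sum>i\<in>Basis. k i t *\<^sub>R i) = f x - f a"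
      by (simp add: integral_unique)
  qed
qed

section \<open>Indefinite integrals are absolutely continuous and differentiable almost everywhere\<close>

lemma sum_integral_disjoint_le:
  fixes g :: "real \<Rightarrow> real"
  assumes g: "g integrable_on {a..b}" and g0: "\<And>x. x \<in> {a..b} \<Longrightarrow> 0 \<le> g x"
    and no: "nonoverlapping a b {..<m::nat} s t"
  shows "(\<Sum>i<m. integral {s i..t i} g) \<le> integral {a..b} g"
proof -
  have h: "((\<lambda>x. if x \<in> {s i<..<t i} then g x else 0) has_integral integral {s i..t i} g) {a..b}" if "i < m" for i
  proof -
    have i: "a \<le> s i" "s i \<le> t i" "t i \<le> b" using nonoverlappingD[OF no] that by auto
    have "g integrable_on {s i..t i}"
      by (rule integrable_on_subinterval[OF g]) (use i in auto)
    then have "(g has_integral integral {s i..t i} g) {s i<..<t i}"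
      unfolding has_integral_Icc_iff_Ioo[symmetric] by (rule integrable_integral)
    then show ?thesis
      by (subst has_integral_restrict) (use i in auto)
  qed
  have "((\<lambda>x. \<Sum>i<m. if x \<in> {s i<..<t i} then g x else 0) has_integral (\<Sum>i<m. integral {s i..t i} g)) {a..b}"
    by (intro has_integral_sum finite_lessThan h) simp
  moreover have "(\<Sum>i<m. if x \<in> {s i<..<t i} then g x else 0) \<le> g x" if x: "x \<in> {a..b}" for x
  proof (cases "\<exists>i<m. x \<in> {s i<..<t i}")
    case True
    then obtain i where i: "i < m" "x \<in> {s i<..<t i}" by blast
    have "x \<notin> {s j<..<t j}" if "j \<in> {..<m} - {i}" for j
      using no i that unfolding nonoverlapping_def by blast
    then have "(\<Sum>j\<in>{..<m} - {i}. if x \<in> {s j<..<t j} then g x else 0) = 0"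
      by (intro sum.neutral) auto
    then have "(\<Sum>i<m. if x \<in> {s i<..<t i} then g x else 0) = g x"
      using i by (subst sum.remove[of _ i]) auto
    then show ?thesis by simp
  next
    case False
    then have "(\<Sum>i<m. if x \<in> {s i<..<t i} then g x else 0) = 0"
      by (intro sum.neutral) auto
    then show ?thesis using g0[OF x] by simp
  qed
  ultimately show ?thesis
    using has_integral_le[OF _ integrable_integral[OF g]] by blast
qed

text \<open>
  Up to an error of small integral the norm of the integrand is bounded by a constant \<open>N\<close>, and a
  bounded integrand has small integral over sets of small measure.
\<close>
lemma AC_indefinite_integral:
  fixes k :: "real \<Rightarrow> 'a::euclidean_space"
  assumes k: "k absolutely_integrable_on {a..b}"
  shows "absolutely_continuous_on_interval a b (\<lambda>x. integral {a..x} k)"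
proof (rule AC_intervalI)
  fix \<epsilon> :: real assume e: "\<epsilon> > 0"
  \<comment> \<open>The part of the norm above the level \<open>N\<close>.\<close>
  define r where "r N x = max 0 (norm (k x) - real N)" for N x
  have nk: "(\<lambda>x. norm (k x)) absolutely_integrable_on {a..b}"
    by (rule absolutely_integrable_norm[OF k, unfolded o_def])
  have ri: "r N absolutely_integrable_on {a..b}" for N
    unfolding r_def
    by (intro absolutely_integrable_max_1 set_integral_diff(1) nk absolutely_integrable_continuous_real continuous_intros)
  have "(\<lambda>N. integral {a..b} (r N)) \<longlonglongrightarrow> integral {a..b} (\<lambda>x. 0)"
  proof (rule dominated_convergence(2))
    show "r N integrable_on {a..b}" for N by (rule set_lebesgue_integral_eq_integral(1)[OF ri])
    show "(\<lambda>x. norm (k x)) integrable_on {a..b}" by (rule set_lebesgue_integral_eq_integral(1)[OF nk])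
    show "norm (r N x) \<le> norm (k x)" for N x by (auto simp: r_def)
    show "(\<lambda>N. r N x) \<longlonglongrightarrow> 0" for x
    proof (rule tendsto_eventually)
      obtain M :: nat where "norm (k x) < real M" using reals_Archimedean2 by blast
      then have "r N x = 0" if "N \<ge> M" for N using that by (auto simp: r_def)
      then show "eventually (\<lambda>N. r N x = 0) sequentially"
        unfolding eventually_sequentially by blast
    qed
  qed
  then have "eventually (\<lambda>N. integral {a..b} (r N) < \<epsilon> / 2) sequentially"
    using e by (intro order_tendstoD(2)[where y=0]) auto
  then obtain N where N: "integral {a..b} (r N) < \<epsilon> / 2"
    unfolding eventually_sequentially by blast
  define \<delta> where "\<delta> = \<epsilon> / (2 * (real N + 1))"
  have "\<delta> > 0" using e by (simp add: \<delta>_def)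
  have "(\<Sum>i<m. norm (integral {a..t i} k - integral {a..s i} k)) < \<epsilon>"
    if no: "nonoverlapping a b {..<m} s t" and len: "(\<Sum>i<m. t i - s i) < \<delta>" for m :: nat and s t
  proof -
    have "norm (integral {a..t i} k - integral {a..s i} k) \<le> real N * (t i - s i) + integral {s i..t i} (r N)" if "i < m" for i
    proof -
      have i: "a \<le> s i" "s i \<le> t i" "t i \<le> b" using nonoverlappingD[OF no] that by auto
      have sub: "f integrable_on {c..d}" if "f absolutely_integrable_on {a..b}" "a \<le> c" "d \<le> b" for c d and f :: "real \<Rightarrow> 'c::euclidean_space"
        by (rule integrable_on_subinterval[OF set_lebesgue_integral_eq_integral(1)[OF that(1)]]) (use that in auto)
      have "integral {a..s i} k + integral {s i..t i} k = integral {a..t i} k"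
        by (rule Henstock_Kurzweil_Integration.integral_combine) (use i sub[OF k] in auto)
      then have "norm (integral {a..t i} k - integral {a..s i} k) = norm (integral {s i..t i} k)"
        by (metis add_diff_cancel_left')
      also have "\<dots> \<le> integral {s i..t i} (\<lambda>x. real N + r N x)"
        by (rule integral_norm_bound_integral)
          (auto simp: r_def[abs_def] intro!: sub k i integrable_add sub[OF ri, unfolded r_def[abs_def]])
      also have "\<dots> = integral {s i..t i} (\<lambda>x. real N) + integral {s i..t i} (r N)"
        by (rule Henstock_Kurzweil_Integration.integral_add) (auto intro!: sub ri i)
      also have "integral {s i..t i} (\<lambda>x. real N) = real N * (t i - s i)"
        using i by simp
      finally show ?thesis .
    qed
    then have "(\<Sum>i<m. norm (integral {a..t i} k - integral {a..s i} k))
        \<le> (\<Sum>i<m. real N * (t i - s i) + integral {s i..t i} (r N))"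
      by (intro sum_mono) simp
    also have "\<dots> = real N * (\<Sum>i<m. t i - s i) + (\<Sum>i<m. integral {s i..t i} (r N))"
      by (simp add: sum.distrib sum_distrib_left)
    also have "(\<Sum>i<m. integral {s i..t i} (r N)) \<le> integral {a..b} (r N)"
      by (rule sum_integral_disjoint_le[OF set_lebesgue_integral_eq_integral(1)[OF ri] _ no]) (simp add: r_def)
    also have "real N * (\<Sum>i<m. t i - s i) \<le> real N * \<delta>"
      using len by (intro mult_left_mono) auto
    also have "real N * \<delta> \<le> \<epsilon> / 2"
      using e by (simp add: \<delta>_def field_simps)
    finally show ?thesis using N by simp
  qed
  then show "\<exists>\<delta>>0. \<forall>(m::nat) s t. nonoverlapping a b {..<m} s t \<longrightarrow> (\<Sum>i<m. t i - s i) < \<delta> \<longrightarrow>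
      (\<Sum>i<m. norm (integral {a..t i} k - integral {a..s i} k)) < \<epsilon>"
    using \<open>\<delta> > 0\<close> by blast
qed

lemma closed_segment_eq_cball_real: "{min x y..max x y} = cball ((x + y) / 2) (\<bar>y - x\<bar> / (2::real))"
  by (auto simp: cball_eq_atLeastAtMost min_def max_def abs_if field_simps)

text \<open>
  The intervals on which the slope of \<open>F\<close> is off from \<open>k x\<close> by more than \<open>r\<close> at an end point \<open>x\<close> form a Vitali
  cover of the exceptional set, even if only intervals inside the gauge are admitted.  Any finite
  disjoint selection is then a fine tagged partial division, and Henstock's lemma bounds the sum of its
  errors by \<open>r * e\<close>, hence its total length by \<open>e\<close>.
\<close>
lemma bad_slope_negligible:
  fixes k :: "real \<Rightarrow> 'a::euclidean_space"
  assumes k: "k integrable_on {a..b}" and "r > 0"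
    and F: "\<And>x y. x \<in> {a..b} \<Longrightarrow> y \<in> {a..b} \<Longrightarrow> x \<le> y \<Longrightarrow> F y - F x = integral {x..y} k"
  shows "negligible {x \<in> {a..b}. \<forall>d>0. \<exists>y\<in>{a..b}. \<bar>y - x\<bar> < d \<and> r * \<bar>y - x\<bar> < norm (F y - F x - (y - x) *\<^sub>R k x)}"
    (is "negligible ?E")
  unfolding negligible_outer_le
proof (intro allI impI)
  fix e :: real assume "e > 0"
  then have "r * e > 0" using \<open>r > 0\<close> by simp
  have k': "k integrable_on cbox a b" using k by simp
  obtain \<gamma> where \<gamma>: "gauge \<gamma>" and H: "\<And>p. p tagged_partial_division_of (cbox a b) \<Longrightarrow> \<gamma> fine p \<Longrightarrow>
      (\<Sum>(x,K)\<in>p. norm (measure lborel K *\<^sub>R k x - integral K k)) < r * e"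
    using Henstock_lemma[OF k' \<open>r * e > 0\<close>] by blast
  define seg where "seg = (\<lambda>(x, y). {min x y..max x y} :: real set)"
  define P where "P = {(x, y). x \<in> {a..b} \<and> y \<in> {a..b} \<and> y \<noteq> x \<and> seg (x, y) \<subseteq> \<gamma> x
      \<and> r * \<bar>y - x\<bar> < norm (F y - F x - (y - x) *\<^sub>R k x)}"
  define cen rad where "cen = (\<lambda>(x, y). (x + y) / 2 :: real)" and "rad = (\<lambda>(x, y). \<bar>y - x\<bar> / 2 :: real)"
  have seg_cball: "cball (cen i) (rad i) = seg i" for i
    by (cases i) (simp add: seg_def cen_def rad_def closed_segment_eq_cball_real)
  have cover: "\<exists>i. i \<in> P \<and> x \<in> cball (cen i) (rad i) \<and> rad i < d" if x: "x \<in> ?E" and "d > 0" for x d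
  proof -
    have "open (\<gamma> x)" "x \<in> \<gamma> x" using gaugeD[OF \<gamma>, of x] by auto
    then obtain \<eta> where \<eta>: "\<eta> > 0" "ball x \<eta> \<subseteq> \<gamma> x" using openE by blast
    define d' where "d' = min d \<eta>"
    have "d' > 0" using \<eta>(1) \<open>d > 0\<close> by (simp add: d'_def)
    then obtain y where y: "y \<in> {a..b}" "\<bar>y - x\<bar> < d'" "r * \<bar>y - x\<bar> < norm (F y - F x - (y - x) *\<^sub>R k x)"
      using x by blast
    have "y \<noteq> x" using y(3) by auto
    moreover have "seg (x, y) \<subseteq> ball x \<eta>"
      using y(2) by (auto simp: seg_def d'_def dist_real_def)
    ultimately have "(x, y) \<in> P" using x y \<eta> by (auto simp: P_def)
    moreover have "x \<in> cball (cen (x, y)) (rad (x, y))"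
      unfolding seg_cball by (simp add: seg_def)
    moreover have "rad (x, y) < d" using y(2) \<open>d > 0\<close> by (simp add: rad_def d'_def)
    ultimately show ?thesis by blast
  qed
  have radpos: "0 < rad i" if "i \<in> P" for i
    using that by (auto simp: P_def rad_def)
  obtain C where C: "countable C" "C \<subseteq> P" "pairwise (\<lambda>i j. disjnt (cball (cen i) (rad i)) (cball (cen j) (rad j))) C"
    "negligible (?E - (\<Union>i\<in>C. cball (cen i) (rad i)))"
    using Vitali_covering_theorem_cballs[of P rad ?E cen, OF radpos cover] by blast
  have lm: "seg i \<in> lmeasurable" for i
    by (cases i) (simp add: seg_def)
  have bound: "measure lebesgue (\<Union>i\<in>I. seg i) \<le> e" if I: "I \<subseteq> C" "finite I" for I
  proof -
    define p where "p = (\<lambda>i. (fst i, seg i)) ` I"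
    have dj: "seg i \<inter> seg j = {}" if "i \<in> I" "j \<in> I" "i \<noteq> j" for i j
      using C(3) I(1) that unfolding pairwise_def seg_cball disjnt_def by blast
    have mem: "fst i \<in> seg i" for i by (cases i) (simp add: seg_def)
    have inj: "inj_on (\<lambda>i. (fst i, seg i)) I"
      using dj mem by (intro inj_onI) blast
    have IP: "i \<in> P" if "i \<in> I" for i using that I(1) C(2) by blast
    have "p tagged_partial_division_of cbox a b"
      unfolding tagged_partial_division_of_def
    proof (intro conjI allI impI)
      show "finite p" using I(2) by (simp add: p_def)
      show "x \<in> K" if "(x, K) \<in> p" for x K using that mem by (auto simp: p_def)
      show "K \<subseteq> cbox a b" if "(x, K) \<in> p" for x K
        using that IP by (fastforce simp: p_def P_def seg_def)
      show "\<exists>c d. K = cbox c d" if "(x, K) \<in> p" for x K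
        using that by (auto simp: p_def seg_def box_real(2)[symmetric] simp del: box_real)
      show "interior K1 \<inter> interior K2 = {}" if "(x1, K1) \<in> p \<and> (x2, K2) \<in> p \<and> (x1, K1) \<noteq> (x2, K2)" for x1 K1 x2 K2
      proof -
        have "K1 \<inter> K2 = {}" using that dj unfolding p_def by blast
        then show ?thesis using interior_subset by blast
      qed
    qed
    moreover have "\<gamma> fine p"
      using IP by (fastforce simp: fine_def p_def P_def)
    ultimately have "(\<Sum>(x,K)\<in>p. norm (measure lborel K *\<^sub>R k x - integral K k)) < r * e"
      by (rule H)
    also have "(\<Sum>(x,K)\<in>p. norm (measure lborel K *\<^sub>R k x - integral K k)) = (\<Sum>i\<in>I. norm (measure lborel (seg i) *\<^sub>R k (fst i) - integral (seg i) k))"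
      unfolding p_def by (subst sum.reindex[OF inj]) (simp add: o_def)
    finally have S: "(\<Sum>i\<in>I. norm (measure lborel (seg i) *\<^sub>R k (fst i) - integral (seg i) k)) < r * e" .
    have "measure lebesgue (\<Union>i\<in>I. seg i) \<le> (\<Sum>i\<in>I. measure lebesgue (seg i))"
      by (rule measure_UNION_le) (use I(2) lm in \<open>auto dest: fmeasurableD\<close>)
    also have "r * \<dots> \<le> (\<Sum>i\<in>I. norm (measure lborel (seg i) *\<^sub>R k (fst i) - integral (seg i) k))"
      unfolding sum_distrib_left
    proof (rule sum_mono)
      fix i assume "i \<in> I"
      obtain x y where i: "i = (x, y)" by (cases i)
      have xy: "x \<in> {a..b}" "y \<in> {a..b}" "r * \<bar>y - x\<bar> < norm (F y - F x - (y - x) *\<^sub>R k x)"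
        using IP[OF \<open>i \<in> I\<close>] by (auto simp: i P_def)
      have m: "measure lebesgue (seg i) = \<bar>y - x\<bar>" "measure lborel (seg i) = \<bar>y - x\<bar>" by (auto simp: i seg_def)
      have "norm (F y - F x - (y - x) *\<^sub>R k x) = norm (\<bar>y - x\<bar> *\<^sub>R k x - integral (seg i) k)"
      proof (cases "x \<le> y")
        case True
        then show ?thesis using F[OF xy(1,2)] by (simp add: i seg_def norm_minus_commute)
      next
        case False
        then have "F x - F y = integral (seg i) k" using F[OF xy(2,1)] by (simp add: i seg_def)
        then show ?thesis using False by (simp add: algebra_simps)
      qed
      then show "r * measure lebesgue (seg i) \<le> norm (measure lborel (seg i) *\<^sub>R k (fst i) - integral (seg i) k)"
        using xy(3) unfolding m by (simp add: i)
    qed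
    finally have "r * measure lebesgue (\<Union>i\<in>I. seg i) < r * e"
      using S mult_left_mono[OF _ less_imp_le[OF \<open>r > 0\<close>]] by (meson le_less_trans order_refl)
    then show ?thesis using \<open>r > 0\<close> by simp
  qed
  define T where "T = (\<Union>i\<in>C. seg i) \<union> (?E - (\<Union>i\<in>C. seg i))"
  have neg: "negligible (?E - (\<Union>i\<in>C. seg i))" using C(4) unfolding seg_cball .
  have Ub: "(\<Union>i\<in>C. seg i) \<in> lmeasurable" "measure lebesgue (\<Union>i\<in>C. seg i) \<le> e"
    by (rule fmeasurable_UN_bound[OF C(1) lm bound], assumption+, rule measure_UN_bound[OF C(1) lm bound], assumption+)
  show "\<exists>T. ?E \<subseteq> T \<and> T \<in> lmeasurable \<and> measure lebesgue T \<le> e"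
  proof (intro exI[of _ T] conjI)
    show "?E \<subseteq> T" by (auto simp: T_def)
    show "T \<in> lmeasurable" unfolding T_def by (intro fmeasurable.Un Ub(1) negligible_imp_measurable neg)
    have "measure lebesgue T \<le> measure lebesgue (\<Union>i\<in>C. seg i) + measure lebesgue (?E - (\<Union>i\<in>C. seg i))"
      unfolding T_def by (intro measure_Un_le fmeasurableD Ub(1) negligible_imp_measurable neg)
    then show "measure lebesgue T \<le> e"
      using Ub(2) negligible_imp_measure0[OF neg] by simp
  qed
qed

lemma indefinite_integral_has_derivative_ae:
  fixes k :: "real \<Rightarrow> 'a::euclidean_space"
  assumes k: "k integrable_on {a..b}"
    and F: "\<And>x y. x \<in> {a..b} \<Longrightarrow> y \<in> {a..b} \<Longrightarrow> x \<le> y \<Longrightarrow> F y - F x = integral {x..y} k"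
  shows "negligible {x \<in> {a..b}. \<not> (F has_vector_derivative k x) (at x within {a..b})}"
proof -
  let ?E = "\<lambda>r. {x \<in> {a..b}. \<forall>d>0. \<exists>y\<in>{a..b}. \<bar>y - x\<bar> < d \<and> r * \<bar>y - x\<bar> < norm (F y - F x - (y - x) *\<^sub>R k x)}"
  have "{x \<in> {a..b}. \<not> (F has_vector_derivative k x) (at x within {a..b})} \<subseteq> (\<Union>n. ?E (inverse (real (Suc n))))"
  proof
    fix x assume x: "x \<in> {x \<in> {a..b}. \<not> (F has_vector_derivative k x) (at x within {a..b})}"
    then have "\<not> (F has_derivative (\<lambda>h. h *\<^sub>R k x)) (at x within {a..b})"
      by (simp add: has_vector_derivative_def)
    then obtain e where "e > 0" and e: "\<And>d. d > 0 \<Longrightarrow> \<exists>y\<in>{a..b}. norm (y - x) < d \<and> \<not> norm (F y - F x - (y - x) *\<^sub>R k x) \<le> e * norm (y - x)"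
      unfolding has_derivative_within_alt using bounded_linear_scaleR_left[of "k x"] by blast
    obtain n where n: "inverse (real (Suc n)) < e" using reals_Archimedean[OF \<open>e > 0\<close>] by blast
    have "x \<in> ?E (inverse (real (Suc n)))"
    proof (intro CollectI conjI allI impI)
      show "x \<in> {a..b}" using x by simp
      fix d :: real assume "d > 0"
      from e[OF this] obtain y where y: "y \<in> {a..b}" "\<bar>y - x\<bar> < d" "e * \<bar>y - x\<bar> < norm (F y - F x - (y - x) *\<^sub>R k x)"
        by (auto simp: not_le)
      have "inverse (real (Suc n)) * \<bar>y - x\<bar> \<le> e * \<bar>y - x\<bar>" using n by (intro mult_right_mono) auto
      then show "\<exists>y\<in>{a..b}. \<bar>y - x\<bar> < d \<and> inverse (real (Suc n)) * \<bar>y - x\<bar> < norm (F y - F x - (y - x) *\<^sub>R k x)"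
        using y by (intro bexI[of _ y]) auto
    qed
    then show "x \<in> (\<Union>n. ?E (inverse (real (Suc n))))" by blast
  qed
  moreover have "negligible (\<Union>n. ?E (inverse (real (Suc n))))"
    by (intro negligible_Union_nat bad_slope_negligible[OF k] F) auto
  ultimately show ?thesis by (rule negligible_subset[rotated])
qed

section \<open>Primitives on the half-line\<close>

definition locally_AC :: "(real \<Rightarrow> 'a::real_normed_vector) \<Rightarrow> bool" where
  "locally_AC f \<longleftrightarrow> (\<forall>b\<ge>0. absolutely_continuous_on_interval 0 b f)"

definition locally_integrable :: "(real \<Rightarrow> 'a::euclidean_space) \<Rightarrow> bool" where
  "locally_integrable k \<longleftrightarrow> (\<forall>b\<ge>0. k absolutely_integrable_on {0..b})"

text \<open>
  The integrand \<open>k\<close> is determined by \<open>f\<close> up to a null set of the half-line; nothing is said about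
  negative arguments.
\<close>
definition primitive :: "(real \<Rightarrow> 'a::euclidean_space) \<Rightarrow> (real \<Rightarrow> 'a) \<Rightarrow> bool" where
  "primitive f k \<longleftrightarrow> locally_integrable k \<and> (\<forall>x\<ge>0. f x - f 0 = integral {0..x} k)"

lemma AE_halfline_iff_negligible:
  "(AE x in lebesgue_on {0::real..}. P x) \<longleftrightarrow> negligible {x. 0 \<le> x \<and> \<not> P x}"
  by (subst AE_restrict_space_iff) (auto simp: completion.AE_iff_null_sets negligible_iff_null_sets)

lemma AE_halflineI:
  assumes "\<And>b. 0 < b \<Longrightarrow> negligible {x \<in> {0..<b}. \<not> P x}"
  shows "AE x in lebesgue_on {0::real..}. P x"
  unfolding AE_halfline_iff_negligible
proof (rule negligible_subset)
  show "negligible (\<Union>n. {x \<in> {0..<real (Suc n)}. \<not> P x})"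
    by (intro negligible_Union_nat assms) simp
  show "{x. 0 \<le> x \<and> \<not> P x} \<subseteq> (\<Union>n. {x \<in> {0..<real (Suc n)}. \<not> P x})"
  proof
    fix x assume "x \<in> {x. 0 \<le> x \<and> \<not> P x}"
    moreover obtain n where "x < real n" using reals_Archimedean2 by blast
    ultimately have "x \<in> {x \<in> {0..<real (Suc n)}. \<not> P x}" by auto
    then show "x \<in> (\<Union>n. {x \<in> {0..<real (Suc n)}. \<not> P x})" by blast
  qed
qed

lemma locally_integrableD:
  assumes "locally_integrable k" "0 \<le> a"
  shows "k absolutely_integrable_on {a..b}" "k integrable_on {a..b}"
proof -
  show "k absolutely_integrable_on {a..b}"
  proof (cases "a \<le> b")
    case True
    then have "b \<ge> 0" using \<open>0 \<le> a\<close> by simp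
    then have "k absolutely_integrable_on {0..b}" using assms(1) by (simp add: locally_integrable_def)
    then show ?thesis by (rule absolutely_integrable_on_subinterval) (use \<open>0 \<le> a\<close> in simp)
  next
    case False
    then have "{a..b} = {}" by simp
    then show ?thesis by (simp add: set_integrable_def)
  qed
  then show "k integrable_on {a..b}" by (rule set_lebesgue_integral_eq_integral(1))
qed

lemma primitiveD:
  assumes "primitive f k" "0 \<le> x" "x \<le> y"
  shows "f y - f x = integral {x..y} k"
proof -
  have k: "locally_integrable k" and f: "\<And>x. x \<ge> 0 \<Longrightarrow> f x - f 0 = integral {0..x} k"
    using assms(1) by (auto simp: primitive_def)
  have "integral {0..x} k + integral {x..y} k = integral {0..y} k"
    by (rule Henstock_Kurzweil_Integration.integral_combine) (use assms locally_integrableD[OF k] in auto)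
  then show ?thesis using f[of x] f[of y] assms by (simp add: algebra_simps)
qed

lemma primitive_integral:
  assumes "locally_integrable k"
  shows "primitive (\<lambda>x. c + integral {0..x} k) k"
  using assms by (simp add: primitive_def)

lemma primitive_imp_locally_AC:
  assumes "primitive f k"
  shows "locally_AC f"
  unfolding locally_AC_def
proof (intro allI impI)
  fix b :: real assume "b \<ge> 0"
  have k: "locally_integrable k" using assms by (simp add: primitive_def)
  show "absolutely_continuous_on_interval 0 b f"
  proof (rule AC_dominated[OF _ _ zero_less_one])
    fix x y :: real assume xy: "0 \<le> x" "x \<le> y" "y \<le> b"
    have "f y - f x = integral {0..y} k - integral {0..x} k"
      unfolding primitiveD[OF assms order_refl xy(1), symmetric]
        primitiveD[OF assms order_refl order_trans[OF xy(1,2)], symmetric] by simp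
    then show "norm (f y - f x) \<le> 1 * (norm (integral {0..y} k - integral {0..x} k) + norm (integral {0..y} k - integral {0..x} k))"
      by simp
  qed (rule AC_indefinite_integral[OF locally_integrableD(1)[OF k order_refl]])+
qed

lemma locally_AC_imp_continuous:
  assumes "locally_AC f" shows "continuous_on {0..} f"
proof -
  have "continuous_on {0..} f \<longleftrightarrow> (\<forall>x\<in>{0..}. continuous (at x within {0..}) f)"
    by (rule continuous_on_eq_continuous_within)
  moreover have "continuous (at x within {0..}) f" if x: "x \<in> {0..}" for x
  proof -
    have "continuous_on {0..x+1} f"
      using assms x by (intro AC_imp_continuous_on) (simp add: locally_AC_def)
    then have "continuous (at x within {0..x+1}) f"
      using x by (simp add: continuous_on_eq_continuous_within)
    moreover have "at x within {0..x+1} = at x within {0..}"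
      by (rule at_within_nhd[of _ "{..<x+1}"]) auto
    ultimately show ?thesis by simp
  qed
  ultimately show ?thesis by blast
qed

lemma primitive_imp_continuous: "primitive f k \<Longrightarrow> continuous_on {0..} f"
  by (intro locally_AC_imp_continuous primitive_imp_locally_AC)

lemma primitive_has_derivative:
  assumes "primitive f k"
  shows "AE x in lebesgue_on {0..}. (f has_vector_derivative k x) (at x within {0..})"
proof (rule AE_halflineI)
  fix b :: real assume "b > 0"
  have k: "locally_integrable k" using assms by (simp add: primitive_def)
  have "negligible {x \<in> {0..b}. \<not> (f has_vector_derivative k x) (at x within {0..b})}"
    by (rule indefinite_integral_has_derivative_ae[OF locally_integrableD(2)[OF k]])
      (auto intro!: primitiveD[OF assms])
  moreover have "at x within {0..b} = at x within {0..}" if "x \<in> {0..<b}" for x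
    by (rule at_within_nhd[of _ "{..<b}"]) (use that in auto)
  then have "{x \<in> {0..<b}. \<not> (f has_vector_derivative k x) (at x within {0..})}
      \<subseteq> {x \<in> {0..b}. \<not> (f has_vector_derivative k x) (at x within {0..b})}"
    by auto
  ultimately show "negligible {x \<in> {0..<b}. \<not> (f has_vector_derivative k x) (at x within {0..})}"
    by (rule negligible_subset)
qed

lemma nontrivial_at_within_halfline: "0 \<le> x \<Longrightarrow> at x within {0::real..} \<noteq> bot"
proof -
  assume "0 \<le> x"
  then have "at_right x \<le> at x within {0..}" by (intro at_le) auto
  then show ?thesis using trivial_limit_at_right_real[of x] by (metis bot.extremum_uniqueI)
qed

lemma AE_halfline_nonneg: "AE x in lebesgue_on {0::real..}. 0 \<le> x"
  by (auto simp: AE_halfline_iff_negligible)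

lemma primitive_vector_derivative:
  assumes "primitive f k"
  shows "AE x in lebesgue_on {0..}. vector_derivative f (at x within {0..}) = k x"
  using primitive_has_derivative[OF assms] AE_halfline_nonneg
  by eventually_elim (intro vector_derivative_within nontrivial_at_within_halfline)

lemma locally_integrable_cong_AE:
  assumes "locally_integrable k" and ae: "AE x in lebesgue_on {0..}. k x = l x"
  shows "locally_integrable l"
  unfolding locally_integrable_def
proof (intro allI impI)
  fix b :: real
  show "l absolutely_integrable_on {0..b}"
    by (rule absolutely_integrable_spike[OF locally_integrableD(1)[OF assms(1) order_refl] ae[unfolded AE_halfline_iff_negligible]]) auto
qed

lemma integral_cong_AE_halfline:
  assumes ae: "AE x in lebesgue_on {0::real..}. k x = l x" and "0 \<le> a"
  shows "integral {a..b} k = integral {a..b} l"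
  by (rule integral_spike[OF ae[unfolded AE_halfline_iff_negligible]]) (use assms in auto)

lemma primitive_cong_AE:
  assumes p: "primitive f k" and ae: "AE x in lebesgue_on {0..}. k x = l x"
  shows "primitive f l"
  using p locally_integrable_cong_AE[OF _ ae] integral_cong_AE_halfline[OF ae order_refl]
  by (simp add: primitive_def)

text \<open>
  The densities obtained on the intervals \<open>[0, b]\<close> agree almost everywhere with the derivative, which
  does not depend on \<open>b\<close>.
\<close>
lemma locally_AC_imp_primitive:
  fixes f :: "real \<Rightarrow> 'a::euclidean_space"
  assumes "locally_AC f"
  shows "primitive f (\<lambda>x. vector_derivative f (at x within {0..}))"
proof -
  define v where "v x = vector_derivative f (at x within {0..})" for x
  have *: "v absolutely_integrable_on {0..b} \<and> f b - f 0 = integral {0..b} v" if b0: "0 \<le> b" for b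
  proof (cases "b = 0")
    case True
    have "v absolutely_integrable_on cbox 0 0" by (rule absolutely_integrable_on_null) simp
    then show ?thesis using True by simp
  next
    case False
    then have "b > 0" using that by simp
    have ac: "absolutely_continuous_on_interval 0 b f"
      using assms that by (simp add: locally_AC_def)
    obtain k where k: "k absolutely_integrable_on {0..b}" "\<And>x. x \<in> {0..b} \<Longrightarrow> integral {0..x} k = f x - f 0"
      using AC_imp_integral[OF ac b0] by blast
    have ki: "k integrable_on {0..b}" by (rule set_lebesgue_integral_eq_integral(1)[OF k(1)])
    have "f y - f x = integral {x..y} k" if "x \<in> {0..b}" "y \<in> {0..b}" "x \<le> y" for x y
    proof -
      have "integral {0..x} k + integral {x..y} k = integral {0..y} k"
        by (rule Henstock_Kurzweil_Integration.integral_combine)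
          (use that in \<open>simp, simp, intro integrable_on_subinterval[OF ki], simp\<close>)
      then show ?thesis using k(2)[OF that(1)] k(2)[OF that(2)] by (simp add: algebra_simps)
    qed
    then have "negligible {x \<in> {0..b}. \<not> (f has_vector_derivative k x) (at x within {0..b})}" (is "negligible ?N")
      by (intro indefinite_integral_has_derivative_ae[OF ki])
    then have neg: "negligible (insert b ?N)" by (simp add: negligible_insert)
    have eq: "v x = k x" if "x \<in> {0..b} - insert b ?N" for x
    proof -
      have "(f has_vector_derivative k x) (at x within {0..b})" using that by blast
      moreover have "at x within {0..b} = at x within {0..}"
        by (rule at_within_nhd[of _ "{..<b}"]) (use that in auto)
      ultimately show ?thesis unfolding v_def
        using that by (intro vector_derivative_within nontrivial_at_within_halfline) auto
    qed
    have "v absolutely_integrable_on {0..b}"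
      by (rule absolutely_integrable_spike[OF k(1) neg eq])
    moreover have "integral {0..b} k = integral {0..b} v"
      by (rule integral_spike[OF neg eq])
    ultimately show ?thesis using k(2)[of b] b0 by simp
  qed
  then show ?thesis unfolding v_def[symmetric] by (simp add: primitive_def locally_integrable_def)
qed

text \<open>
  Integration by parts: the product is locally absolutely continuous, so it is a primitive of its
  derivative, and the product rule computes this almost everywhere.
\<close>
lemma primitive_bilinear:
  fixes B :: "'a::euclidean_space \<Rightarrow> 'b::euclidean_space \<Rightarrow> 'c::euclidean_space"
  assumes B: "bounded_bilinear B" and f: "primitive f k" and g: "primitive g l"
  shows "primitive (\<lambda>x. B (f x) (g x)) (\<lambda>x. B (f x) (l x) + B (k x) (g x))"
proof (rule primitive_cong_AE[OF locally_AC_imp_primitive])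
  show "locally_AC (\<lambda>x. B (f x) (g x))"
    using primitive_imp_locally_AC[OF f] primitive_imp_locally_AC[OF g]
    unfolding locally_AC_def by (auto intro: AC_bilinear[OF B])
  show "AE x in lebesgue_on {0..}. vector_derivative (\<lambda>x. B (f x) (g x)) (at x within {0..}) = B (f x) (l x) + B (k x) (g x)"
    using primitive_has_derivative[OF f] primitive_has_derivative[OF g] AE_halfline_nonneg
    by eventually_elim
      (intro vector_derivative_within nontrivial_at_within_halfline bounded_bilinear.has_vector_derivative[OF B])
qed

lemma primitive_bounded_linear:
  fixes h :: "'a::euclidean_space \<Rightarrow> 'b::euclidean_space"
  assumes h: "bounded_linear h" and f: "primitive f k"
  shows "primitive (\<lambda>x. h (f x)) (\<lambda>x. h (k x))"
proof (rule primitive_cong_AE[OF locally_AC_imp_primitive])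
  show "locally_AC (\<lambda>x. h (f x))"
    using primitive_imp_locally_AC[OF f] unfolding locally_AC_def by (auto intro: AC_bounded_linear[OF _ h])
  show "AE x in lebesgue_on {0..}. vector_derivative (\<lambda>x. h (f x)) (at x within {0..}) = h (k x)"
    using primitive_has_derivative[OF f] AE_halfline_nonneg
    by eventually_elim
      (intro vector_derivative_within nontrivial_at_within_halfline bounded_linear.has_vector_derivative[OF h])
qed

lemma primitive_zero_const:
  assumes "primitive f k" "AE x in lebesgue_on {0..}. k x = 0" "0 \<le> x"
  shows "f x = f 0"
proof -
  have "integral {0..x} k = integral {0..x} (\<lambda>x. 0)"
    by (rule integral_cong_AE_halfline) (use assms in auto)
  moreover have "f x - f 0 = integral {0..x} k" using assms by (simp add: primitive_def)
  ultimately show ?thesis by simp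
qed

lemma locally_integrable_bilinear:
  fixes B :: "'a::euclidean_space \<Rightarrow> 'b::euclidean_space \<Rightarrow> 'c::euclidean_space"
  assumes B: "bounded_bilinear B" and f: "continuous_on {0..} f" and g: "locally_integrable g"
  shows "locally_integrable (\<lambda>x. B (f x) (g x))"
  unfolding locally_integrable_def
proof (intro allI impI)
  fix b :: real
  have c: "continuous_on {0..b} f" by (rule continuous_on_subset[OF f]) auto
  show "(\<lambda>x. B (f x) (g x)) absolutely_integrable_on {0..b}"
  proof (rule absolutely_integrable_bounded_measurable_product[where h = B and f = f and g = g])
    show "bilinear B" using B by (simp add: bilinear_conv_bounded_bilinear)
    show "f \<in> borel_measurable (lebesgue_on {0..b})"
      by (rule continuous_imp_measurable_on_sets_lebesgue[OF c]) simp
    show "bounded (f ` {0..b})"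
      by (rule compact_imp_bounded[OF compact_continuous_image[OF c]]) simp
  qed (use locally_integrableD(1)[OF g] in auto)
qed

lemma locally_integrable_add:
  "locally_integrable k \<Longrightarrow> locally_integrable l \<Longrightarrow> locally_integrable (\<lambda>x. k x + l x)"
  by (auto simp: locally_integrable_def intro: set_integral_add(1))

lemma locally_integrable_bounded_linear:
  fixes h :: "'a::euclidean_space \<Rightarrow> 'b::euclidean_space"
  assumes "bounded_linear h" "locally_integrable k"
  shows "locally_integrable (\<lambda>x. h (k x))"
  using assms absolutely_integrable_linear[where f = k and h = h] by (simp add: locally_integrable_def o_def)

lemma locally_integrable_norm:
  "locally_integrable k \<Longrightarrow> locally_integrable (\<lambda>x. norm (k x))"
  using absolutely_integrable_norm[where f = k] by (simp add: locally_integrable_def o_def)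

section \<open>Completeness of the space of square integrable functions\<close>

lemma L2_rel_self: "L2_rel f f \<longleftrightarrow> sq_integrable f"
  by (simp add: L2_rel_def)

lemma L2_obtain_function:
  fixes x :: "('n::finite) L2"
  obtains f where "sq_integrable f" "x = abs_L2 f"
  using Quotient3_rep_reflp[OF Quotient3_L2, of x] Quotient3_abs_rep[OF Quotient3_L2, of x]
  by (metis L2_rel_self)

lemma abs_L2_eq_iff:
  "sq_integrable f \<Longrightarrow> sq_integrable g \<Longrightarrow> abs_L2 f = abs_L2 g \<longleftrightarrow> (AE x in lebesgue_on {0..}. f x = g x)"
  using Quotient3_rel[OF Quotient3_L2, of f g] by (auto simp: L2_rel_def)

lemma abs_L2_add: "sq_integrable f \<Longrightarrow> sq_integrable g \<Longrightarrow> abs_L2 f + abs_L2 g = abs_L2 (\<lambda>x. f x + g x)"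
  by (rule plus_L2.abs_eq) (auto simp: L2_rel_self)

lemma abs_L2_scale: "sq_integrable f \<Longrightarrow> scaleL2 c (abs_L2 f) = abs_L2 (\<lambda>x. c *s f x)"
  by (rule scaleL2.abs_eq) (auto simp: L2_rel_self)

lemma abs_L2_uminus: "sq_integrable f \<Longrightarrow> - abs_L2 f = abs_L2 (\<lambda>x. - f x)"
  by (rule uminus_L2.abs_eq) (auto simp: L2_rel_self)

lemma sq_integrable_diff: "sq_integrable f \<Longrightarrow> sq_integrable g \<Longrightarrow> sq_integrable (\<lambda>x. f x - g x)"
  using sq_integrable_add[of f "\<lambda>x. - g x"] sq_integrable_minus[of g] by simp

lemma abs_L2_diff: "sq_integrable f \<Longrightarrow> sq_integrable g \<Longrightarrow> abs_L2 f - abs_L2 g = abs_L2 (\<lambda>x. f x - g x)"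
  by (simp add: minus_L2_def abs_L2_uminus abs_L2_add sq_integrable_minus)

lemma cinner_abs_L2:
  "sq_integrable f \<Longrightarrow> sq_integrable g \<Longrightarrow>
    cinner (abs_L2 f) (abs_L2 g) = integral\<^sup>L (lebesgue_on {0..}) (\<lambda>x. cdot (f x) (g x))"
  by (rule cinner.abs_eq) (auto simp: L2_rel_self)

lemma norm_abs_L2:
  assumes "sq_integrable f"
  shows "(norm (abs_L2 f))\<^sup>2 = integral\<^sup>L (lebesgue_on {0..}) (\<lambda>x. (norm (f x))\<^sup>2)"
proof -
  have "integral\<^sup>L (lebesgue_on {0..}) (\<lambda>x. cdot (f x) (f x)) = of_real (integral\<^sup>L (lebesgue_on {0..}) (\<lambda>x. (norm (f x))\<^sup>2))"
    unfolding cdot_self by (rule integral_of_real) (use assms in \<open>simp add: sq_integrable_def\<close>)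
  then show ?thesis
    by (simp add: power2_norm_eq_inner inner_L2_def cinner_abs_L2 assms)
qed

lemma nn_integral_norm_abs_L2:
  assumes "sq_integrable f"
  shows "(\<integral>\<^sup>+x. ennreal ((norm (f x))\<^sup>2) \<partial>lebesgue_on {0..}) = ennreal ((norm (abs_L2 f))\<^sup>2)"
  unfolding norm_abs_L2[OF assms]
  by (rule nn_integral_eq_integral) (use assms in \<open>auto simp: sq_integrable_def\<close>)

lemma sq_integrableI_nn:
  assumes "f \<in> borel_measurable (lebesgue_on {0..})"
    and "(\<integral>\<^sup>+x. ennreal ((norm (f x))\<^sup>2) \<partial>lebesgue_on {0..}) < \<infinity>"
  shows "sq_integrable f"
proof -
  have "integrable (lebesgue_on {0..}) (\<lambda>x. (norm (f x))\<^sup>2)"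
  proof (rule integrableI_bounded)
    show "(\<lambda>x. (norm (f x))\<^sup>2) \<in> borel_measurable (lebesgue_on {0..})" using assms(1) by measurable
  qed (use assms(2) in simp)
  then show ?thesis using assms(1) by (simp add: sq_integrable_def)
qed

text \<open>
  Each term is at most the total sum \<open>B\<close>, so the increments are bounded by \<open>sqrt B / 2 ^ k\<close> and are
  summable.
\<close>
lemma convergent_if_geometric_square_sums:
  fixes f :: "nat \<Rightarrow> 'a::banach"
  assumes "(\<Sum>k. ennreal (4 ^ k * (norm (f (Suc k) - f k))\<^sup>2)) < \<infinity>"
  shows "convergent f"
proof -
  define S where "S = (\<Sum>k. ennreal (4 ^ k * (norm (f (Suc k) - f k))\<^sup>2))"
  define B where "B = enn2real S"
  have B: "S = ennreal B" "B \<ge> 0"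
    using assms unfolding S_def[symmetric] by (simp_all add: B_def)
  have le: "norm (f (Suc k) - f k) \<le> sqrt B * (1/2) ^ k" for k
  proof -
    have "ennreal (4 ^ k * (norm (f (Suc k) - f k))\<^sup>2) \<le> S"
    proof -
      have le: "c k \<le> (\<Sum>i. c i)" for c :: "nat \<Rightarrow> ennreal"
        using sum_le_suminf[of c "{k}", OF summableI] by simp
      show ?thesis unfolding S_def by (rule le)
    qed
    then have "4 ^ k * (norm (f (Suc k) - f k))\<^sup>2 \<le> B"
      unfolding B(1) using B(2) ennreal_le_iff by blast
    then have "(2 ^ k * norm (f (Suc k) - f k))\<^sup>2 \<le> B"
      using power_mult[of "2::real" 2 k] power_mult[of "2::real" k 2]
      by (simp only: power_mult_distrib) (simp add: mult.commute)
    then have "2 ^ k * norm (f (Suc k) - f k) \<le> sqrt B" by (rule real_le_rsqrt)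
    then show ?thesis by (simp add: field_simps)
  qed
  have "summable (\<lambda>k. f (Suc k) - f k)"
    by (rule summable_comparison_test'[where g = "\<lambda>k. sqrt B * (1/2) ^ k" and N = 0])
      (auto intro!: le summable_mult summable_geometric)
  then have "convergent (\<lambda>n. f 0 + (\<Sum>k<n. f (Suc k) - f k))"
    using summable_iff_convergent convergent_const convergent_add by blast
  then show ?thesis by (simp add: sum_lessThan_telescope)
qed

text \<open>
  The Riesz--Fischer argument.  Integrating the weighted sum of the squared increments term by term
  shows that it is finite almost everywhere, so the functions converge pointwise almost everywhere;
  Fatou's lemma turns the bounds on \<open>X m - X k\<close> into bounds on the distance to the pointwise limit.
\<close>
lemma L2_rapid_Cauchy_converges:
  fixes X :: "nat \<Rightarrow> ('n::finite) L2"
  assumes X: "\<And>k m. k \<le> m \<Longrightarrow> norm (X m - X k) \<le> (1/8) ^ k"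
  shows "convergent X"
proof -
  let ?M = "lebesgue_on {0::real..}"
  have "\<forall>k. \<exists>f. sq_integrable f \<and> X k = abs_L2 f" using L2_obtain_function by metis
  then obtain f where f: "\<And>k. sq_integrable (f k)" "\<And>k. X k = abs_L2 (f k)" by metis
  have meas: "f k \<in> borel_measurable ?M" for k using f(1) by (simp add: sq_integrable_def)
  have nn: "(\<integral>\<^sup>+x. ennreal ((norm (f m x - f k x))\<^sup>2) \<partial>?M) \<le> ennreal (((1/8) ^ k)\<^sup>2)" if "k \<le> m" for k m
    using nn_integral_norm_abs_L2[OF sq_integrable_diff[OF f(1) f(1)], of m k] X[OF that]
    by (simp add: f(2) abs_L2_diff f(1) ennreal_leI power_mono)
  have "(\<integral>\<^sup>+x. (\<Sum>k. ennreal (4 ^ k * (norm (f (Suc k) x - f k x))\<^sup>2)) \<partial>?M)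
      = (\<Sum>k. \<integral>\<^sup>+x. ennreal (4 ^ k * (norm (f (Suc k) x - f k x))\<^sup>2) \<partial>?M)"
    by (rule nn_integral_suminf) (use meas in measurable)
  also have "\<dots> \<le> (\<Sum>k. ennreal ((1/2) ^ k))"
  proof (rule suminf_le)
    fix k
    have "(\<integral>\<^sup>+x. ennreal (4 ^ k * (norm (f (Suc k) x - f k x))\<^sup>2) \<partial>?M)
        = ennreal (4 ^ k) * (\<integral>\<^sup>+x. ennreal ((norm (f (Suc k) x - f k x))\<^sup>2) \<partial>?M)"
      unfolding ennreal_mult'[OF zero_le_power[OF zero_le_numeral]]
      by (rule nn_integral_cmult) (use meas in measurable)
    also have "\<dots> \<le> ennreal (4 ^ k) * ennreal (((1/8) ^ k)\<^sup>2)"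
      by (intro mult_left_mono nn) auto
    also have "\<dots> = ennreal (4 ^ k * ((1/8) ^ k)\<^sup>2)" by (simp add: ennreal_mult)
    also have "\<dots> \<le> ennreal ((1/2) ^ k)"
    proof (rule ennreal_leI)
      have "4 ^ k * ((1/8::real) ^ k)\<^sup>2 = (1/16) ^ k"
        by (simp add: power2_eq_square flip: power_mult_distrib)
      also have "\<dots> \<le> (1/2) ^ k" by (rule power_mono) auto
      finally show "4 ^ k * ((1/8::real) ^ k)\<^sup>2 \<le> (1/2) ^ k" .
    qed
    finally show "(\<integral>\<^sup>+x. ennreal (4 ^ k * (norm (f (Suc k) x - f k x))\<^sup>2) \<partial>?M) \<le> ennreal ((1/2) ^ k)" .
  qed auto
  also have "\<dots> = ennreal (\<Sum>k. (1/2) ^ k)" by (rule suminf_ennreal2) (auto intro: summable_geometric)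
  also have "\<dots> < \<infinity>" by simp
  finally have fin: "(\<integral>\<^sup>+x. (\<Sum>k. ennreal (4 ^ k * (norm (f (Suc k) x - f k x))\<^sup>2)) \<partial>?M) < \<infinity>" .
  have "AE x in ?M. (\<Sum>k. ennreal (4 ^ k * (norm (f (Suc k) x - f k x))\<^sup>2)) \<noteq> \<infinity>"
    by (rule nn_integral_PInf_AE) (use fin meas in \<open>measurable, auto\<close>)
  then have conv: "AE x in ?M. convergent (\<lambda>k. f k x)"
    by eventually_elim (rule convergent_if_geometric_square_sums, simp add: top.not_eq_extremum)
  define g where "g x = lim (\<lambda>k. f k x)" for x
  have gm: "g \<in> borel_measurable ?M"
    unfolding g_def by (rule borel_measurable_lim_metric) (rule meas)
  have fatou: "(\<integral>\<^sup>+x. ennreal ((norm (g x - f k x))\<^sup>2) \<partial>?M) \<le> ennreal (((1/8) ^ k)\<^sup>2)" for k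
  proof -
    have "(\<integral>\<^sup>+x. ennreal ((norm (g x - f k x))\<^sup>2) \<partial>?M) = (\<integral>\<^sup>+x. liminf (\<lambda>m. ennreal ((norm (f m x - f k x))\<^sup>2)) \<partial>?M)"
    proof (rule nn_integral_cong_AE)
      show "AE x in ?M. ennreal ((norm (g x - f k x))\<^sup>2) = liminf (\<lambda>m. ennreal ((norm (f m x - f k x))\<^sup>2))"
        using conv
      proof eventually_elim
        case (elim x)
        then have "(\<lambda>m. f m x) \<longlonglongrightarrow> g x" by (simp add: g_def convergent_LIMSEQ_iff)
        then have "(\<lambda>m. ennreal ((norm (f m x - f k x))\<^sup>2)) \<longlonglongrightarrow> ennreal ((norm (g x - f k x))\<^sup>2)"
          by (intro tendsto_intros)
        then show ?case by (metis lim_imp_Liminf sequentially_bot)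
      qed
    qed
    also have "\<dots> \<le> liminf (\<lambda>m. \<integral>\<^sup>+x. ennreal ((norm (f m x - f k x))\<^sup>2) \<partial>?M)"
      by (rule nn_integral_liminf) (use meas in measurable)
    also have "\<dots> \<le> limsup (\<lambda>m. \<integral>\<^sup>+x. ennreal ((norm (f m x - f k x))\<^sup>2) \<partial>?M)"
      by (rule Liminf_le_Limsup) simp
    also have "\<dots> \<le> ennreal (((1/8) ^ k)\<^sup>2)"
      by (rule Limsup_bounded) (use nn in \<open>auto simp: eventually_sequentially\<close>)
    finally show ?thesis .
  qed
  have dsq: "sq_integrable (\<lambda>x. g x - f k x)" for k
    by (rule sq_integrableI_nn) (use gm meas fatou[of k] in \<open>auto intro: le_less_trans\<close>)
  have gsq: "sq_integrable g"
    using sq_integrable_add[OF dsq[of 0] f(1)[of 0]] by simp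
  have bound: "norm (X k - abs_L2 g) \<le> (1/8) ^ k" for k
  proof -
    have "ennreal ((norm (abs_L2 g - X k))\<^sup>2) \<le> ennreal (((1/8) ^ k)\<^sup>2)"
      using fatou[of k] unfolding nn_integral_norm_abs_L2[OF dsq] f(2) abs_L2_diff[OF gsq f(1)] .
    then have "(norm (abs_L2 g - X k))\<^sup>2 \<le> ((1/8) ^ k)\<^sup>2" by simp
    then have "norm (abs_L2 g - X k) \<le> (1/8) ^ k" by (rule power2_le_imp_le) simp
    then show ?thesis by (simp add: norm_minus_commute)
  qed
  have "(\<lambda>k. X k - abs_L2 g) \<longlonglongrightarrow> 0"
    by (rule Lim_null_comparison[where g = "\<lambda>k. (1/8) ^ k"])
      (use bound in \<open>auto intro!: LIMSEQ_power_zero\<close>)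
  then have "X \<longlonglongrightarrow> abs_L2 g" by (simp add: LIM_zero_iff)
  then show ?thesis by (rule convergentI)
qed

instance L2 :: (finite) complete_space
proof
  fix X :: "nat \<Rightarrow> 'a L2" assume C: "Cauchy X"
  have "\<forall>k. \<exists>M. \<forall>m\<ge>M. \<forall>n\<ge>M. norm (X m - X n) < (1/8) ^ k"
    using CauchyD[OF C] by simp
  then obtain M where M: "\<And>k m n. M k \<le> m \<Longrightarrow> M k \<le> n \<Longrightarrow> norm (X m - X n) < (1/8) ^ k"
    by metis
  \<comment> \<open>The sum makes \<open>s m\<close> at least \<open>M k\<close> for all \<open>k \<le> m\<close>, and the summand \<open>k\<close> makes \<open>s\<close> strictly increasing.\<close>
  define s where "s k = (\<Sum>i\<le>k. M i) + k" for k
  have s: "strict_mono s" by (intro strict_monoI_Suc) (simp add: s_def)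
  have Ms: "M k \<le> s m" if "k \<le> m" for k m
    using member_le_sum[of k "{..m}" M] that by (simp add: s_def)
  have "convergent (\<lambda>k. X (s k))"
  proof (rule L2_rapid_Cauchy_converges)
    fix k m :: nat assume "k \<le> m"
    then show "norm (X (s m) - X (s k)) \<le> (1/8) ^ k"
      using M[of k "s m" "s k"] Ms by (simp add: less_imp_le)
  qed
  then obtain l where "(X \<circ> s) \<longlonglongrightarrow> l" by (auto simp: convergent_def o_def)
  then have "X \<longlonglongrightarrow> l" by (rule Cauchy_converges_subseq[OF C s])
  then show "convergent X" by (rule convergentI)
qed

text \<open>
  By the parallelogram law a minimizing sequence for the distance from \<open>x\<close> is a Cauchy sequence; its
  limit is the nearest point, and minimality gives orthogonality.
\<close>
lemma closed_subspace_projection: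
  fixes C :: "'a::{real_inner, complete_space} set"
  assumes sub: "subspace C" and cl: "closed C"
  obtains p where "p \<in> C" "\<And>m. m \<in> C \<Longrightarrow> inner m (x - p) = 0"
proof -
  have ne: "C \<noteq> {}" using subspace_0[OF sub] by blast
  define d where "d = infdist x C"
  have d: "d \<le> norm (x - m)" if "m \<in> C" for m
    using infdist_le[OF that, of x] by (simp add: d_def dist_norm)
  have d0: "d \<ge> 0" by (simp add: d_def infdist_nonneg)
  have "\<exists>m\<in>C. norm (x - m) < d + inverse (real (Suc k))" for k
  proof -
    have "(INF m\<in>C. dist x m) < d + inverse (real (Suc k))"
      using ne by (simp add: d_def infdist_def)
    then show ?thesis using cInf_lessD[of "dist x ` C"] ne by (auto simp: dist_norm)
  qed
  then obtain m where m: "\<And>k. m k \<in> C" "\<And>k. norm (x - m k) < d + inverse (real (Suc k))" by metis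
  have par: "(norm (m j - m k))\<^sup>2 \<le> 2 * (norm (x - m j))\<^sup>2 + 2 * (norm (x - m k))\<^sup>2 - 4 * d\<^sup>2" for j k
  proof -
    have "(1/2) *\<^sub>R (m j + m k) \<in> C" using m(1) sub by (intro subspace_scale subspace_add)
    then have "d\<^sup>2 \<le> (norm (x - (1/2) *\<^sub>R (m j + m k)))\<^sup>2" using d d0 by (intro power_mono)
    moreover have "(norm (m j - m k))\<^sup>2 = 2 * (norm (x - m j))\<^sup>2 + 2 * (norm (x - m k))\<^sup>2 - 4 * (norm (x - (1/2) *\<^sub>R (m j + m k)))\<^sup>2"
      unfolding power2_norm_eq_inner by (simp add: inner_diff_left inner_diff_right inner_add_left inner_add_right inner_commute algebra_simps)
    ultimately show ?thesis by simp
  qed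
  have "Cauchy m"
  proof (rule metric_CauchyI)
    fix e :: real assume "e > 0"
    \<comment> \<open>Chosen such that \<open>4 * ((d + \<eta>)\<^sup>2 - d\<^sup>2) < e\<^sup>2\<close>.\<close>
    define \<eta> where "\<eta> = min 1 (e\<^sup>2 / (8 * d + 8))"
    have D: "8 * d + 8 > 0" using d0 by simp
    have "\<eta> \<le> e\<^sup>2 / (8 * d + 8)" by (simp add: \<eta>_def)
    then have "\<eta> * (8 * d + 8) \<le> e\<^sup>2" using D by (simp only: pos_le_divide_eq)
    moreover have "0 < \<eta>" "\<eta> \<le> 1" using \<open>e > 0\<close> D by (auto simp: \<eta>_def)
    ultimately have \<eta>: "0 < \<eta>" "\<eta> \<le> 1" "\<eta> * (8 * d + 8) \<le> e\<^sup>2" by auto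
    obtain N where N: "inverse (real (Suc N)) < \<eta>" using reals_Archimedean[OF \<eta>(1)] by blast
    have small: "(norm (x - m k))\<^sup>2 < d\<^sup>2 + \<eta> * (2 * d + 1)" if "k \<ge> N" for k
    proof -
      have "inverse (real (Suc k)) \<le> inverse (real (Suc N))" using that by (intro le_imp_inverse_le) auto
      then have "norm (x - m k) < d + \<eta>" using m(2)[of k] N by linarith
      then have "(norm (x - m k))\<^sup>2 < (d + \<eta>)\<^sup>2" by (intro power_strict_mono) auto
      also have "\<dots> = d\<^sup>2 + \<eta> * (2 * d + \<eta>)" by (simp add: power2_eq_square algebra_simps)
      also have "\<dots> \<le> d\<^sup>2 + \<eta> * (2 * d + 1)" using \<eta> by (intro add_left_mono mult_left_mono) auto
      finally show ?thesis .
    qed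
    have "dist (m j) (m k) < e" if "j \<ge> N" "k \<ge> N" for j k
    proof -
      have "(norm (m j - m k))\<^sup>2 < \<eta> * (8 * d + 4)"
        using par[of j k] small[OF that(1)] small[OF that(2)] by (simp add: algebra_simps)
      also have "\<dots> \<le> \<eta> * (8 * d + 8)" using \<eta> by (intro mult_left_mono) auto
      also have "\<dots> \<le> e\<^sup>2" by (rule \<eta>)
      finally show ?thesis using \<open>e > 0\<close> by (simp add: dist_norm power_less_imp_less_base)
    qed
    then show "\<exists>N. \<forall>j\<ge>N. \<forall>k\<ge>N. dist (m j) (m k) < e" by blast
  qed
  then obtain p where p: "m \<longlonglongrightarrow> p" using Cauchy_convergent convergent_def by blast
  have pC: "p \<in> C" using closed_sequentially[OF cl m(1) p] .
  have "norm (x - p) \<le> d"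
  proof (rule LIMSEQ_le)
    show "(\<lambda>k. norm (x - m k)) \<longlonglongrightarrow> norm (x - p)" by (intro tendsto_intros p)
    show "(\<lambda>k. d + inverse (real (Suc k))) \<longlonglongrightarrow> d"
      using tendsto_add[OF tendsto_const[of d] LIMSEQ_inverse_real_of_nat] by simp
    show "\<exists>N. \<forall>n\<ge>N. norm (x - m n) \<le> d + inverse (real (Suc n))" using m(2) less_imp_le by blast
  qed
  then have min: "norm (x - p) \<le> norm (x - q)" if "q \<in> C" for q using d[OF that] by linarith
  have "inner q (x - p) = 0" if q: "q \<in> C" for q
  proof (cases "q = 0")
    case False
    define t where "t = inner q (x - p) / inner q q"
    have qq: "inner q q > 0" using False by simp
    have "p + t *\<^sub>R q \<in> C" using pC q sub by (intro subspace_add subspace_scale)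
    then have "(norm (x - p))\<^sup>2 \<le> (norm (x - (p + t *\<^sub>R q)))\<^sup>2" using min by (intro power_mono) auto
    also have "\<dots> = (norm (x - p))\<^sup>2 - 2 * t * inner q (x - p) + t\<^sup>2 * inner q q"
      unfolding power2_norm_eq_inner
      by (simp add: power2_eq_square inner_diff_left inner_diff_right inner_add_left inner_add_right inner_commute algebra_simps)
    also have "\<dots> = (norm (x - p))\<^sup>2 - (inner q (x - p))\<^sup>2 / inner q q"
      using qq by (simp add: t_def power2_eq_square field_simps)
    finally have "(inner q (x - p))\<^sup>2 / inner q q \<le> 0" by simp
    then have "(inner q (x - p))\<^sup>2 \<le> 0" using qq by (simp add: divide_le_0_iff)
    then show ?thesis by simp
  qed simp
  then show thesis using that pC by blast
qed

text \<open>
  The separating vector is the component of \<open>x\<close> orthogonal to the closure of \<open>M\<close>.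
\<close>
lemma orthogonal_separation:
  fixes M :: "'a::{real_inner, complete_space} set"
  assumes "subspace M" "x \<notin> closure M"
  obtains z where "\<And>m. m \<in> M \<Longrightarrow> inner m z = 0" "inner x z \<noteq> 0"
proof -
  have sub: "subspace (closure M)"
  proof (rule subspaceI)
    show "0 \<in> closure M" using subspace_0[OF assms(1)] closure_subset by blast
    fix u v assume "u \<in> closure M" "v \<in> closure M"
    then obtain U V where U: "\<forall>n. U n \<in> M" "U \<longlonglongrightarrow> u" and V: "\<forall>n. V n \<in> M" "V \<longlonglongrightarrow> v"
      unfolding closure_sequential by blast
    show "u + v \<in> closure M"
      unfolding closure_sequential
      by (rule exI[of _ "\<lambda>n. U n + V n"]) (use U V subspace_add[OF assms(1)] in \<open>auto intro: tendsto_add\<close>)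
  next
    fix c u assume "u \<in> closure M"
    then obtain U where U: "\<forall>n. U n \<in> M" "U \<longlonglongrightarrow> u"
      unfolding closure_sequential by blast
    show "c *\<^sub>R u \<in> closure M"
      unfolding closure_sequential
      by (rule exI[of _ "\<lambda>n. c *\<^sub>R U n"]) (use U subspace_scale[OF assms(1)] in \<open>auto intro: tendsto_scaleR\<close>)
  qed
  obtain p where p: "p \<in> closure M" "\<And>m. m \<in> closure M \<Longrightarrow> inner m (x - p) = 0"
    using closed_subspace_projection[OF sub closed_closure] by blast
  show thesis
  proof (rule that[of "x - p"])
    show "inner m (x - p) = 0" if "m \<in> M" for m using p(2) closure_subset that by blast
    have "x - p \<noteq> 0" using p(1) assms(2) by auto
    moreover have "inner x (x - p) = inner (x - p) (x - p)"
      using p(2)[OF p(1)] by (simp add: inner_diff_left)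
    ultimately show "inner x (x - p) \<noteq> 0" by simp
  qed
qed

section \<open>Linear differential equations with locally integrable coefficients\<close>

lemma primitive_power:
  fixes \<alpha> :: "real \<Rightarrow> real"
  assumes "primitive \<alpha> a"
  shows "primitive (\<lambda>x. \<alpha> x ^ Suc k) (\<lambda>x. real (Suc k) * \<alpha> x ^ k * a x)"
proof (induction k)
  case 0
  then show ?case using assms by simp
next
  case (Suc k)
  have "primitive (\<lambda>x. \<alpha> x * \<alpha> x ^ Suc k) (\<lambda>x. \<alpha> x * (real (Suc k) * \<alpha> x ^ k * a x) + a x * \<alpha> x ^ Suc k)"
    by (rule primitive_bilinear[OF bounded_bilinear_mult assms Suc])
  moreover have "(\<lambda>x. \<alpha> x * (real (Suc k) * \<alpha> x ^ k * a x) + a x * \<alpha> x ^ Suc k) = (\<lambda>x. real (Suc (Suc k)) * \<alpha> x ^ Suc k * a x)"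
    by (rule ext) (simp add: algebra_simps)
  ultimately show ?case by simp
qed

text \<open>
  Picard iteration.  With \<open>\<alpha>\<close> the integral of the norm of the coefficient, the \<open>k\<close>-th correction is
  bounded by \<open>norm c * \<alpha> ^ k / fact k\<close>, because \<open>\<alpha> ^ Suc k\<close> is a primitive of \<open>real (Suc k) * \<alpha> ^ k * a\<close>.  So
  the corrections are dominated by an exponential series, and dominated convergence carries the
  integral equation over to the limit.
\<close>
lemma linear_ODE_solution_exists:
  fixes A :: "real \<Rightarrow> 'a::euclidean_space" and B :: "'a \<Rightarrow> 'b::euclidean_space \<Rightarrow> 'b" and c :: 'b
  assumes B: "bounded_bilinear B" and A: "locally_integrable A"
  obtains y where "primitive y (\<lambda>x. B (A x) (y x))" "y 0 = c"
proof -
  interpret bounded_bilinear B by (rule B)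
  obtain K where K: "K > 0" "\<And>u v. norm (B u v) \<le> norm u * norm v * K" using pos_bounded by blast
  define a where "a x = K * norm (A x)" for x
  have a0: "a x \<ge> 0" for x using K(1) by (simp add: a_def)
  have aB: "norm (B (A x) v) \<le> a x * norm v" for x v
    using K(2)[of "A x" v] by (simp add: a_def mult_ac)
  have ai: "locally_integrable a"
    unfolding a_def by (rule locally_integrable_bounded_linear[OF bounded_linear_mult_right locally_integrable_norm[OF A]])
  define \<alpha> where "\<alpha> x = integral {0..x} a" for x
  have \<alpha>p: "primitive \<alpha> a" using primitive_integral[OF ai, of 0] by (simp add: \<alpha>_def[abs_def])
  have \<alpha>0: "\<alpha> 0 = 0" by (simp add: \<alpha>_def)
  have \<alpha>nn: "\<alpha> x \<ge> 0" for x unfolding \<alpha>_def by (rule integral_nonneg) (use a0 locally_integrableD(2)[OF ai] in auto)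
  have \<alpha>mono: "\<alpha> x \<le> \<alpha> y" if "0 \<le> x" "x \<le> y" for x y
  proof -
    have "0 \<le> integral {x..y} a" by (rule integral_nonneg) (use a0 locally_integrableD(2)[OF ai that(1)] in auto)
    then show ?thesis using primitiveD[OF \<alpha>p that] by simp
  qed
  define u where "u = rec_nat (\<lambda>x. c) (\<lambda>k v x. integral {0..x} (\<lambda>t. B (A t) (v t)))"
  have u0: "u 0 = (\<lambda>x. c)" and uS: "u (Suc k) = (\<lambda>x. integral {0..x} (\<lambda>t. B (A t) (u k t)))" for k
    by (simp_all add: u_def)
  have Bli: "locally_integrable (\<lambda>t. B (A t) (v t))" if "continuous_on {0..} v" for v
    by (rule locally_integrable_bilinear[OF flip that A])
  have uc: "continuous_on {0..} (u k)" for k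
  proof (induction k)
    case (Suc k)
    have "primitive (\<lambda>x. 0 + integral {0..x} (\<lambda>t. B (A t) (u k t))) (\<lambda>t. B (A t) (u k t))"
      by (rule primitive_integral[OF Bli[OF Suc]])
    then have "primitive (u (Suc k)) (\<lambda>t. B (A t) (u k t))" by (simp add: uS)
    then show ?case by (rule primitive_imp_continuous)
  qed (simp add: u0)
  have Bu: "(\<lambda>t. B (A t) (u k t)) integrable_on {0..x}" for k x
    by (rule locally_integrableD(2)[OF Bli[OF uc] order_refl])
  have ub: "norm (u k x) \<le> norm c * (\<alpha> x ^ k / fact k)" if "x \<ge> 0" for k x
    using that
  proof (induction k arbitrary: x)
    case 0
    then show ?case by (simp add: u0)
  next
    case (Suc k)
    have P: "primitive (\<lambda>x. norm c * (\<alpha> x ^ Suc k / fact (Suc k))) (\<lambda>t. a t * (norm c * (\<alpha> t ^ k / fact k)))"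
    proof -
      have "primitive (\<lambda>x. (norm c / fact (Suc k)) * \<alpha> x ^ Suc k) (\<lambda>x. (norm c / fact (Suc k)) * (real (Suc k) * \<alpha> x ^ k * a x))"
        by (rule primitive_bounded_linear[OF bounded_linear_mult_right primitive_power[OF \<alpha>p]])
      moreover have "(\<lambda>x. (norm c / fact (Suc k)) * (real (Suc k) * \<alpha> x ^ k * a x)) = (\<lambda>t. a t * (norm c * (\<alpha> t ^ k / fact k)))"
        by (rule ext) (simp add: field_simps del: of_nat_Suc)
      ultimately show ?thesis by (simp add: mult_ac)
    qed
    have "norm (u (Suc k) x) \<le> integral {0..x} (\<lambda>t. a t * (norm c * (\<alpha> t ^ k / fact k)))"
      unfolding uS
    proof (rule integral_norm_bound_integral[OF Bu])
      show "(\<lambda>t. a t * (norm c * (\<alpha> t ^ k / fact k))) integrable_on {0..x}"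
        by (rule locally_integrableD(2)[OF _ order_refl]) (rule P[unfolded primitive_def, THEN conjunct1])
      fix t assume t: "t \<in> {0..x}"
      have "norm (B (A t) (u k t)) \<le> a t * norm (u k t)" by (rule aB)
      also have "\<dots> \<le> a t * (norm c * (\<alpha> t ^ k / fact k))"
        using Suc.IH[of t] t a0 by (intro mult_left_mono) auto
      finally show "norm (B (A t) (u k t)) \<le> a t * (norm c * (\<alpha> t ^ k / fact k))" .
    qed
    also have "\<dots> = norm c * (\<alpha> x ^ Suc k / fact (Suc k))"
      using primitiveD[OF P order_refl Suc.prems] by (simp add: \<alpha>0)
    finally show ?case .
  qed
  have es: "summable (\<lambda>k. norm c * (s ^ k / fact k))" "(\<Sum>k. norm c * (s ^ k / fact k)) = norm c * exp s" for s :: real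
    using summable_exp_generic[of s] by (auto simp: exp_def divide_inverse_commute suminf_mult intro!: summable_mult)
  define S where "S n x = (\<Sum>k<n. u k x)" for n x
  define y where "y x = (\<Sum>k. u k x)" for x
  have Sb: "norm (S n x) \<le> norm c * exp (\<alpha> x)" if "x \<ge> 0" for n x
  proof -
    have "norm (S n x) \<le> (\<Sum>k<n. norm c * (\<alpha> x ^ k / fact k))"
      unfolding S_def by (rule sum_norm_le) (use ub[OF that] in auto)
    also have "\<dots> \<le> (\<Sum>k. norm c * (\<alpha> x ^ k / fact k))"
      by (rule sum_le_suminf[OF es(1)]) (use \<alpha>nn in auto)
    finally show ?thesis unfolding es(2) .
  qed
  have Sy: "(\<lambda>n. S n x) \<longlonglongrightarrow> y x" if "x \<ge> 0" for x
  proof -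
    have "summable (\<lambda>k. u k x)"
      by (rule summable_comparison_test'[OF es(1)[of "\<alpha> x"]]) (rule ub[OF that])
    then show ?thesis unfolding S_def y_def by (rule summable_LIMSEQ)
  qed
  have yb: "norm (y x) \<le> norm c * exp (\<alpha> x)" if "x \<ge> 0" for x
    using Lim_bounded[OF tendsto_norm[OF Sy[OF that]]] Sb[OF that] by blast
  have BS: "(\<lambda>t. B (A t) (S n t)) integrable_on {0..x}" for n x
    unfolding S_def sum_right by (intro integrable_sum Bu) simp
  have iS: "integral {0..x} (\<lambda>t. B (A t) (S n t)) = S (Suc n) x - c" for n x
    unfolding S_def sum_right
    by (subst Henstock_Kurzweil_Integration.integral_sum) (auto intro: Bu simp: sum.lessThan_Suc_shift uS u0 simp del: sum.lessThan_Suc)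
  have dom: "norm (B (A t) v) \<le> a t * (norm c * exp (\<alpha> x))" if "t \<in> {0..x}" "norm v \<le> norm c * exp (\<alpha> t)" for t x v
  proof -
    have "norm (B (A t) v) \<le> a t * norm v" by (rule aB)
    also have "norm v \<le> norm c * exp (\<alpha> t)" by (rule that)
    also have "\<dots> \<le> norm c * exp (\<alpha> x)" using \<alpha>mono that(1) by (intro mult_left_mono) auto
    finally show ?thesis using a0[of t] by (simp add: mult_left_mono)
  qed
  have di: "(\<lambda>t. a t * (norm c * exp (\<alpha> x))) integrable_on {0..x}" for x
    by (intro integrable_on_mult_left locally_integrableD(2)[OF ai order_refl])
  have lim: "(\<lambda>t. B (A t) (y t)) integrable_on {0..x}"
    "(\<lambda>n. integral {0..x} (\<lambda>t. B (A t) (S n t))) \<longlonglongrightarrow> integral {0..x} (\<lambda>t. B (A t) (y t))" for x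
  proof -
    have b: "norm (B (A t) (S n t)) \<le> a t * (norm c * exp (\<alpha> x))" if "t \<in> {0..x}" for n t
      by (rule dom[OF that Sb]) (use that in simp)
    have l: "(\<lambda>n. B (A t) (S n t)) \<longlonglongrightarrow> B (A t) (y t)" if "t \<in> {0..x}" for t
      by (intro tendsto tendsto_const Sy) (use that in simp)
    show "(\<lambda>t. B (A t) (y t)) integrable_on {0..x}"
      "(\<lambda>n. integral {0..x} (\<lambda>t. B (A t) (S n t))) \<longlonglongrightarrow> integral {0..x} (\<lambda>t. B (A t) (y t))"
      using dominated_convergence[where f = "\<lambda>n t. B (A t) (S n t)" and g = "\<lambda>t. B (A t) (y t)", OF BS di b l]
      by blast+
  qed
  have eq: "y x - c = integral {0..x} (\<lambda>t. B (A t) (y t))" if "x \<ge> 0" for x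
  proof (rule LIMSEQ_unique)
    show "(\<lambda>n. integral {0..x} (\<lambda>t. B (A t) (S n t))) \<longlonglongrightarrow> y x - c"
      unfolding iS by (intro tendsto_diff tendsto_const LIMSEQ_Suc Sy that)
  qed (rule lim)
  have "locally_integrable (\<lambda>t. B (A t) (y t))"
    unfolding locally_integrable_def
    by (intro allI impI absolutely_integrable_integrable_bound[OF _ lim(1) di] dom yb) auto
  moreover have "y 0 = c" using eq[of 0] by simp
  ultimately show thesis
    using eq by (intro that[of y]) (auto simp: primitive_def)
qed

section \<open>Integrable and square integrable functions on the half-line\<close>

lemma halfline_integrable_iff:
  fixes f :: "real \<Rightarrow> 'a::euclidean_space"
  shows "integrable (lebesgue_on {0..}) f \<longleftrightarrow> f absolutely_integrable_on {0..}"
  by (simp add: set_integrable_def integrable_restrict_space)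

lemma halfline_integrable_imp_locally_integrable:
  fixes f :: "real \<Rightarrow> 'a::euclidean_space"
  assumes "integrable (lebesgue_on {0..}) f"
  shows "locally_integrable f"
  unfolding locally_integrable_def
proof (intro allI impI)
  fix b :: real
  show "f absolutely_integrable_on {0..b}"
    using assms unfolding halfline_integrable_iff by (rule absolutely_integrable_on_subinterval) auto
qed

lemma integral_halfline_tendsto:
  fixes f :: "real \<Rightarrow> 'a::euclidean_space"
  assumes f: "integrable (lebesgue_on {0..}) f"
  shows "((\<lambda>b. integral {0..b} f) \<longlongrightarrow> integral\<^sup>L (lebesgue_on {0..}) f) at_top"
proof (rule tendsto_at_topI_sequentially)
  fix X :: "nat \<Rightarrow> real" assume X: "filterlim X at_top sequentially"
  have fm: "f \<in> borel_measurable (lebesgue_on {0..})" using f by (rule borel_measurable_integrable)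
  have im: "indicator {..c} \<in> borel_measurable (lebesgue_on {0::real..})" for c :: real
    by (intro measurable_restrict_space1 borel_measurable_indicator) simp
  have int: "integrable (lebesgue_on {0..}) (\<lambda>x. indicator {..c} x *\<^sub>R f x)" for c
  proof (rule Bochner_Integration.integrable_bound[OF f])
    show "(\<lambda>x. indicator {..c} x *\<^sub>R f x) \<in> borel_measurable (lebesgue_on {0..})"
      by (intro borel_measurable_scaleR im fm)
  qed (auto simp: indicator_def)
  have eq: "integral\<^sup>L (lebesgue_on {0..}) (\<lambda>x. indicator {..c} x *\<^sub>R f x) = integral {0..c} f" for c
  proof -
    have "integral\<^sup>L (lebesgue_on {0..}) (\<lambda>x. indicator {..c} x *\<^sub>R f x) = integral {0..} (\<lambda>x. indicator {..c} x *\<^sub>R f x)"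
      by (rule lebesgue_integral_eq_integral[OF int]) simp
    also have "\<dots> = integral {0..} (\<lambda>x. if x \<in> {..c} then f x else 0)"
      by (rule arg_cong[where f = "integral {0..}"]) (auto simp: fun_eq_iff indicator_def)
    also have "\<dots> = integral ({..c} \<inter> {0..}) f" by (rule Henstock_Kurzweil_Integration.integral_restrict_Int)
    also have "{..c} \<inter> {0..} = {0..c}" by auto
    finally show ?thesis .
  qed
  have "(\<lambda>n. integral\<^sup>L (lebesgue_on {0..}) (\<lambda>x. indicator {..X n} x *\<^sub>R f x)) \<longlonglongrightarrow> integral\<^sup>L (lebesgue_on {0..}) f"
  proof (rule integral_dominated_convergence[where w = "\<lambda>x. norm (f x)"])
    show "AE x in lebesgue_on {0..}. (\<lambda>n. indicator {..X n} x *\<^sub>R f x) \<longlonglongrightarrow> f x"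
    proof (rule AE_I2)
      fix x
      from X have "eventually (\<lambda>n. x \<le> X n) sequentially" by (simp add: filterlim_at_top)
      then show "(\<lambda>n. indicator {..X n} x *\<^sub>R f x) \<longlonglongrightarrow> f x"
        by (intro tendsto_eventually) (auto elim!: eventually_mono)
    qed
    show "(\<lambda>x. indicator {..X n} x *\<^sub>R f x) \<in> borel_measurable (lebesgue_on {0..})" for n
      by (rule borel_measurable_integrable[OF int])
    show "AE x in lebesgue_on {0..}. norm (indicator {..X n} x *\<^sub>R f x) \<le> norm (f x)" for n
      by (rule AE_I2) (simp add: indicator_def)
  qed (use f fm in auto)
  then show "(\<lambda>n. integral {0..X n} f) \<longlonglongrightarrow> integral\<^sup>L (lebesgue_on {0..}) f"
    unfolding eq .
qed

text \<open>
  Otherwise the integral of \<open>norm (f x)\<close> over \<open>[b, b + 1]\<close> would stay away from zero, but it is the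
  increment of a function of \<open>b\<close> that converges.
\<close>
lemma integrable_halfline_limit_zero:
  fixes f :: "real \<Rightarrow> 'a::euclidean_space"
  assumes f: "integrable (lebesgue_on {0..}) f" and lim: "(f \<longlongrightarrow> L) at_top"
  shows "L = 0"
proof (rule ccontr)
  assume "L \<noteq> 0"
  then have h: "norm L / 2 < norm L" by simp
  have nf: "integrable (lebesgue_on {0..}) (\<lambda>x. norm (f x))" using f by simp
  have nl: "locally_integrable (\<lambda>x. norm (f x))" by (rule halfline_integrable_imp_locally_integrable[OF nf])
  define V where "V b = integral {0..b} (\<lambda>x. norm (f x))" for b
  have V: "(V \<longlongrightarrow> integral\<^sup>L (lebesgue_on {0..}) (\<lambda>x. norm (f x))) at_top"
    unfolding V_def by (rule integral_halfline_tendsto[OF nf])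
  have "filterlim (\<lambda>x::real. x + 1) at_top at_top"
    by (rule filterlim_tendsto_add_at_top[OF tendsto_const[of 1] filterlim_ident, simplified add.commute])
  from tendsto_diff[OF filterlim_compose[OF V this] V]
  have "((\<lambda>b. V (b + 1) - V b) \<longlongrightarrow> 0) at_top" by simp
  moreover have "eventually (\<lambda>x. norm L / 2 < norm (f x)) at_top"
    using order_tendstoD(1)[OF tendsto_norm[OF lim] h] .
  then obtain b0 where b0: "\<And>x. x \<ge> b0 \<Longrightarrow> norm L / 2 < norm (f x)"
    unfolding eventually_at_top_linorder by blast
  have "eventually (\<lambda>b. norm L / 2 \<le> V (b + 1) - V b) at_top"
    using eventually_ge_at_top[of "max 0 b0"]
  proof eventually_elim
    case (elim b)
    have "integral {0..b} (\<lambda>x. norm (f x)) + integral {b..b+1} (\<lambda>x. norm (f x)) = integral {0..b+1} (\<lambda>x. norm (f x))"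
      by (rule Henstock_Kurzweil_Integration.integral_combine) (use elim locally_integrableD(2)[OF nl] in auto)
    then have "V (b + 1) - V b = integral {b..b+1} (\<lambda>x. norm (f x))" by (simp add: V_def)
    also have "\<dots> \<ge> integral {b..b+1} (\<lambda>x. norm L / 2)"
    proof (rule integral_le)
      show "(\<lambda>x. norm (f x)) integrable_on {b..b+1}" using elim by (intro locally_integrableD(2)[OF nl]) simp
      show "norm L / 2 \<le> norm (f x)" if "x \<in> {b..b+1}" for x using b0[of x] that elim by simp
    qed (rule integrable_const_ivl)
    finally show ?case by simp
  qed
  ultimately have "norm L / 2 \<le> 0"
    by (intro tendsto_lowerbound) auto
  then show False using \<open>L \<noteq> 0\<close> by simp
qed

lemma borel_measurable_halfline_cong_AE:
  fixes f g :: "real \<Rightarrow> 'a::euclidean_space"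
  assumes f: "f \<in> borel_measurable (lebesgue_on {0..})" and ae: "AE x in lebesgue_on {0..}. f x = g x"
  shows "g \<in> borel_measurable (lebesgue_on {0..})"
proof -
  have "(\<lambda>x. if x \<in> {0..} then f x else 0) \<in> borel_measurable lebesgue"
    using f by (subst borel_measurable_if) auto
  moreover have "AE x in lebesgue. (if x \<in> {0..} then f x else 0) = (if x \<in> {0..} then g x else 0)"
    using ae by (subst (asm) AE_restrict_space_iff) (auto elim: eventually_mono)
  ultimately have "(\<lambda>x. if x \<in> {0..} then g x else 0) \<in> borel_measurable lebesgue"
    by (rule borel_measurable_AE)
  then show ?thesis by (subst (asm) borel_measurable_if) auto
qed

lemma continuous_halfline_measurable:
  fixes f :: "real \<Rightarrow> 'a::euclidean_space"
  shows "continuous_on {0..} f \<Longrightarrow> f \<in> borel_measurable (lebesgue_on {0..})"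
  by (rule continuous_imp_measurable_on_sets_lebesgue) auto

lemma sq_integrable_bounded:
  assumes "f \<in> borel_measurable (lebesgue_on {0..})" "integrable (lebesgue_on {0..}) h"
    and "AE x in lebesgue_on {0..}. (norm (f x))\<^sup>2 \<le> h x"
  shows "sq_integrable f"
proof -
  have "integrable (lebesgue_on {0..}) (\<lambda>x. (norm (f x))\<^sup>2)"
  proof (rule Bochner_Integration.integrable_bound[OF assms(2)])
    show "(\<lambda>x. (norm (f x))\<^sup>2) \<in> borel_measurable (lebesgue_on {0..})" using assms(1) by measurable
    show "AE x in lebesgue_on {0..}. norm ((norm (f x))\<^sup>2) \<le> norm (h x)"
      using assms(3) by eventually_elim simp
  qed
  then show ?thesis using assms(1) by (simp add: sq_integrable_def)
qed

lemma sq_integrable_cong_AE: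
  assumes "sq_integrable f" and ae: "AE x in lebesgue_on {0..}. f x = g x"
  shows "sq_integrable g"
proof (rule sq_integrable_bounded)
  show "g \<in> borel_measurable (lebesgue_on {0..})"
    using assms(1) borel_measurable_halfline_cong_AE[OF _ ae] by (simp add: sq_integrable_def)
  show "integrable (lebesgue_on {0..}) (\<lambda>x. (norm (f x))\<^sup>2)" using assms(1) by (simp add: sq_integrable_def)
  show "AE x in lebesgue_on {0..}. (norm (g x))\<^sup>2 \<le> (norm (f x))\<^sup>2" using ae by eventually_elim simp
qed

lemma integrable_halfline_indicator_Icc: "integrable (lebesgue_on {0..}) (\<lambda>x. C * indicator {0..b::real} x :: real)"
proof -
  have "(\<lambda>x. C) absolutely_integrable_on {0..b}"
    by (intro absolutely_integrable_continuous_real continuous_intros)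
  then have "integrable lebesgue (\<lambda>x. indicator {0..b} x *\<^sub>R C)" by (simp add: set_integrable_def)
  also have "(\<lambda>x. indicator {0..b} x *\<^sub>R C) = (\<lambda>x. indicator {0..} x *\<^sub>R (C * indicator {0..b} x))"
    by (auto simp: fun_eq_iff indicator_def)
  finally show ?thesis by (subst integrable_restrict_space) simp_all
qed

lemma sq_integrable_imp_locally_integrable:
  assumes "sq_integrable f"
  shows "locally_integrable f"
  unfolding locally_integrable_def
proof (intro allI impI)
  fix b :: real
  have "integrable (lebesgue_on {0..}) (\<lambda>x. indicator {0..b} x *\<^sub>R f x)"
  proof (rule Bochner_Integration.integrable_bound)
    show "integrable (lebesgue_on {0..}) (\<lambda>x. 1 * indicator {0..b} x + (norm (f x))\<^sup>2)"
      by (rule Bochner_Integration.integrable_add[OF integrable_halfline_indicator_Icc]) (use assms in \<open>simp add: sq_integrable_def\<close>)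
    show "(\<lambda>x. indicator {0..b} x *\<^sub>R f x) \<in> borel_measurable (lebesgue_on {0..})"
    proof (rule borel_measurable_scaleR)
      show "indicator {0..b} \<in> borel_measurable (lebesgue_on {0..})"
        by (intro measurable_restrict_space1 borel_measurable_indicator) simp
    qed (use assms in \<open>simp add: sq_integrable_def\<close>)
    have "norm (f x) \<le> 1 + (norm (f x))\<^sup>2" for x
    proof -
      have "2 * norm (f x) \<le> 1 + (norm (f x))\<^sup>2" using sum_squares_bound[of 1 "norm (f x)"] by simp
      with norm_ge_zero[of "f x"] show ?thesis by linarith
    qed
    then show "AE x in lebesgue_on {0..}. norm (indicator {0..b} x *\<^sub>R f x) \<le> norm (1 * indicator {0..b} x + (norm (f x))\<^sup>2)"
      by (auto simp: indicator_def)
  qed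
  from halfline_integrable_imp_locally_integrable[OF this]
  have "(\<lambda>x. indicator {0..b} x *\<^sub>R f x) absolutely_integrable_on {0..b}" by (rule locally_integrableD) simp
  then show "f absolutely_integrable_on {0..b}"
    by (rule set_integrable_cong[THEN iffD1, rotated -1]) auto
qed

section \<open>The Lagrange identity and Green's formula\<close>

lemma cdot_add_right: "cdot u (v + w) = cdot u v + cdot u w"
  by (simp add: cdot_def distrib_left sum.distrib)

lemma cdot_scale_right: "cdot u (c *s v) = cnj c * cdot u v"
  by (simp add: cdot_def sum_distrib_left mult_ac)

lemma cdot_minus_right: "cdot u (- v) = - cdot u v"
  by (simp add: cdot_def sum_negf)

lemma cdot_zero_left [simp]: "cdot 0 v = 0"
  by (simp add: cdot_def)

lemma cdot_zero_right [simp]: "cdot u 0 = 0"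
  by (simp add: cdot_def)

lemma cdot_diff_right: "cdot u (v - w) = cdot u v - cdot u w"
  by (simp add: cdot_def right_diff_distrib sum_subtractf)

lemma cdot_self_eq_0: "cdot u u = 0 \<longleftrightarrow> u = 0"
  by (simp add: cdot_self)

lemma Re_cdot: "Re (cdot u v) = inner u v"
  by (simp add: cdot_def inner_vec_def inner_complex_def)

lemma bounded_bilinear_cdot: "bounded_bilinear (cdot :: complex^'n \<Rightarrow> _)"
  unfolding bilinear_conv_bounded_bilinear[symmetric] bilinear_def
  by (auto intro!: linearI simp: cdot_def scaleR_sum_right distrib_left distrib_right sum.distrib)

lemma bounded_bilinear_matrix_vector: "bounded_bilinear ((*v) :: complex^'n^'m \<Rightarrow> complex^'n \<Rightarrow> complex^'m)"
  unfolding bilinear_conv_bounded_bilinear[symmetric] bilinear_def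
  by (auto intro!: linearI simp: vec_eq_iff matrix_vector_mult_def scaleR_sum_right distrib_left distrib_right sum.distrib)

lemma bounded_bilinear_matrix_matrix: "bounded_bilinear ((**) :: complex^'n^'m \<Rightarrow> complex^'k^'n \<Rightarrow> complex^'k^'m)"
  unfolding bilinear_conv_bounded_bilinear[symmetric] bilinear_def
  by (auto intro!: linearI simp: vec_eq_iff matrix_matrix_mult_def scaleR_sum_right distrib_left distrib_right sum.distrib)

lemma bounded_linear_hermitian_adjoint: "bounded_linear (hermitian_adjoint :: complex^'n^'m \<Rightarrow> _)"
  unfolding linear_conv_bounded_linear[symmetric]
  by (auto intro!: linearI simp: vec_eq_iff hermitian_adjoint_def transpose_def map_matrix_def)

lemma hermitian_adjoint_nth: "hermitian_adjoint A $ i $ j = cnj (A $ j $ i)"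
  by (simp add: hermitian_adjoint_def transpose_def map_matrix_def)

lemma hermitian_adjoint_involutive [simp]: "hermitian_adjoint (hermitian_adjoint A) = A"
  by (simp add: vec_eq_iff hermitian_adjoint_nth)

lemma hermitian_adjoint_mul: "hermitian_adjoint (A ** B) = hermitian_adjoint B ** hermitian_adjoint A"
  by (simp add: vec_eq_iff hermitian_adjoint_nth matrix_matrix_mult_def mult.commute)

lemma hermitian_adjoint_one [simp]: "hermitian_adjoint (mat 1) = mat 1"
  by (simp add: vec_eq_iff hermitian_adjoint_nth mat_def)

lemma cdot_matrix_left: "cdot (A *v u) v = cdot u (hermitian_adjoint A *v v)"
proof -
  have "cdot (A *v u) v = (\<Sum>i\<in>UNIV. \<Sum>j\<in>UNIV. A $ i $ j * u $ j * cnj (v $ i))"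
    by (simp add: cdot_def matrix_vector_mult_def sum_distrib_right)
  also have "\<dots> = (\<Sum>j\<in>UNIV. \<Sum>i\<in>UNIV. A $ i $ j * u $ j * cnj (v $ i))" by (rule sum.swap)
  also have "\<dots> = cdot u (hermitian_adjoint A *v v)"
    by (simp add: cdot_def matrix_vector_mult_def hermitian_adjoint_nth sum_distrib_left mult_ac)
  finally show ?thesis .
qed

lemma matrix_neg_mul: "(- A) ** B = - (A ** (B :: complex^'k^'n))" "(A :: complex^'n^'m) ** (- B) = - (A ** B)"
  by (simp_all add: vec_eq_iff matrix_matrix_mult_def sum_negf)

lemma matrix_neg_vec: "(- A) *v x = - (A *v (x :: complex^'n))" "A *v (- x) = - (A *v x)"
  by (simp_all add: vec_eq_iff matrix_vector_mult_def sum_negf)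

lemma L1_loc_iff: "Q \<in> L1_loc \<longleftrightarrow> locally_integrable Q"
  by (simp add: L1_loc_def locally_integrable_def)

lemma AC_loc_iff: "y \<in> AC_loc \<longleftrightarrow> locally_AC y"
  by (simp add: AC_loc_def locally_AC_def)

lemma adjoint_potential_involutive [simp]: "adjoint_potential (adjoint_potential Q) = Q"
  by (simp add: adjoint_potential_def)

locale dirac_system =
  fixes J :: "complex^'n^'n" and Q :: "real \<Rightarrow> complex^'n^'n"
  assumes J_square: "J ** J = - mat 1"
    and J_adjoint: "hermitian_adjoint J = - J"
    and Q_L1: "Q \<in> L1_loc"
begin

abbreviation "Qs \<equiv> adjoint_potential Q"

text \<open>
  By this symmetry every result below also holds for the adjoint potential; statements about the pair
  \<open>Q\<close>, \<open>Q\<^sup>*\<close> are obtained by using a result for both.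
\<close>
lemma adjoint_system: "dirac_system J Qs"
proof
  show "Qs \<in> L1_loc"
    using locally_integrable_bounded_linear[OF bounded_linear_hermitian_adjoint] Q_L1
    by (simp add: L1_loc_iff adjoint_potential_def)
qed (rule J_square J_adjoint)+

lemma JJ_vec: "J *v (J *v x) = - x"
  by (simp add: matrix_vector_mul_assoc J_square matrix_neg_vec)

lemma cdot_J: "cdot (J *v u) v = - cdot u (J *v v)"
  by (simp add: cdot_matrix_left J_adjoint matrix_neg_vec cdot_minus_right)

lemma cdot_Q: "cdot (Q x *v u) v = cdot u (Qs x *v v)"
  by (simp add: cdot_matrix_left adjoint_potential_def)

lemma max_funs_primitive:
  assumes "y \<in> max_funs J Q"
  shows "primitive y (\<lambda>x. vector_derivative y (at x within {0..}))"
  using assms by (intro locally_AC_imp_primitive) (simp add: max_funs_def AC_loc_iff)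

lemma dirac_expr_AE:
  assumes "primitive y k"
  shows "AE x in lebesgue_on {0..}. dirac_expr J Q y x = J *v k x + Q x *v y x"
  using primitive_vector_derivative[OF assms] by eventually_elim (simp add: dirac_expr_def)

text \<open>
  Membership in the maximal domain and the value of the operator are read off from any density \<open>k\<close> of
  \<open>y\<close>, as both only matter up to null sets.
\<close>
lemma max_funsI:
  assumes y: "primitive y k" "sq_integrable y" and h: "sq_integrable h"
    and eq: "AE x in lebesgue_on {0..}. J *v k x + Q x *v y x = h x"
  shows "y \<in> max_funs J Q" "abs_L2 (dirac_expr J Q y) = abs_L2 h"
proof -
  have ae: "AE x in lebesgue_on {0..}. h x = dirac_expr J Q y x"
    using dirac_expr_AE[OF y(1)] eq by eventually_elim simp
  have sq: "sq_integrable (dirac_expr J Q y)" by (rule sq_integrable_cong_AE[OF h ae])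
  show "y \<in> max_funs J Q"
    using sq y primitive_imp_locally_AC[OF y(1)] by (simp add: max_funs_def AC_loc_iff)
  show "abs_L2 (dirac_expr J Q y) = abs_L2 h"
    using abs_L2_eq_iff[OF h sq] ae by simp
qed

text \<open>
  The Lagrange identity.  Moving \<open>J\<close> and \<open>Q\<close> to the other factor changes the sign of \<open>J\<close> and turns \<open>Q\<close> into \<open>Q\<^sup>*\<close>,
  so the two potential terms cancel and the rest is the product rule.
\<close>
lemma primitive_boundary_form:
  assumes y: "primitive y k" and z: "primitive z l"
  shows "primitive (\<lambda>x. cdot (J *v y x) (z x))
    (\<lambda>x. cdot (J *v k x + Q x *v y x) (z x) - cdot (y x) (J *v l x + Qs x *v z x))"
proof -
  have "primitive (\<lambda>x. J *v y x) (\<lambda>x. J *v k x)"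
    by (rule primitive_bounded_linear[OF bounded_bilinear.bounded_linear_right[OF bounded_bilinear_matrix_vector] y])
  then have "primitive (\<lambda>x. cdot (J *v y x) (z x)) (\<lambda>x. cdot (J *v y x) (l x) + cdot (J *v k x) (z x))"
    by (rule primitive_bilinear[OF bounded_bilinear_cdot _ z])
  moreover have "cdot (J *v y x) (l x) + cdot (J *v k x) (z x)
      = cdot (J *v k x + Q x *v y x) (z x) - cdot (y x) (J *v l x + Qs x *v z x)" for x
    by (simp add: cdot_add_left cdot_add_right cdot_Q cdot_J[of "y x"])
  ultimately show ?thesis by simp
qed

text \<open>
  The boundary form \<open>W\<close> converges at infinity because its derivative \<open>g\<close> is integrable.  It is also a product
  of two square integrable functions, hence integrable, and so its limit is zero.  For this reason no
  condition at infinity ever enters, whatever the potential is.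
\<close>
lemma green_formula:
  assumes y: "y \<in> max_funs J Q" and z: "z \<in> max_funs J Qs"
  shows "cinner (abs_L2 (dirac_expr J Q y)) (abs_L2 z) - cinner (abs_L2 y) (abs_L2 (dirac_expr J Qs z))
    = - cdot (J *v y 0) (z 0)"
proof -
  interpret adj: dirac_system J Qs by (rule adjoint_system)
  let ?M = "lebesgue_on {0::real..}"
  define W where "W x = cdot (J *v y x) (z x)" for x
  define g where "g x = cdot (dirac_expr J Q y x) (z x) - cdot (y x) (dirac_expr J Qs z x)" for x
  have sq: "sq_integrable y" "sq_integrable (dirac_expr J Q y)" "sq_integrable z" "sq_integrable (dirac_expr J Qs z)"
    using y z by (auto simp: max_funs_def)
  note i = integrable_cdot[OF sq(2,3)] integrable_cdot[OF sq(1,4)]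
  have gi: "integrable ?M g" unfolding g_def by (intro Bochner_Integration.integrable_diff i)
  have "primitive W g"
    unfolding W_def[abs_def] g_def[abs_def] dirac_expr_def
    by (rule primitive_boundary_form[OF max_funs_primitive[OF y] adj.max_funs_primitive[OF z]])
  then have Wb: "W 0 + integral {0..b} g = W b" if "0 \<le> b" for b
    using primitiveD[OF _ order_refl that, of W g] by (simp add: algebra_simps)
  have "eventually (\<lambda>b. W 0 + integral {0..b} g = W b) at_top"
    using eventually_ge_at_top[of 0] by (rule eventually_mono) (rule Wb)
  moreover have "((\<lambda>b. W 0 + integral {0..b} g) \<longlongrightarrow> W 0 + integral\<^sup>L ?M g) at_top"
    by (intro tendsto_add tendsto_const integral_halfline_tendsto gi)
  ultimately have lim: "(W \<longlongrightarrow> W 0 + integral\<^sup>L ?M g) at_top"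
    by (rule Lim_transform_eventually[rotated])
  have "sq_integrable (\<lambda>x. J *v y x)"
  proof -
    obtain K where K: "K > 0" "\<And>v. norm (J *v v) \<le> norm v * K"
      using bounded_linear.pos_bounded[OF bounded_bilinear.bounded_linear_right[OF bounded_bilinear_matrix_vector, of J]] by blast
    show ?thesis
    proof (rule sq_integrable_bounded)
      show "(\<lambda>x. J *v y x) \<in> borel_measurable ?M"
        by (rule borel_measurable_continuous_on[OF linear_continuous_on[OF bounded_bilinear.bounded_linear_right[OF bounded_bilinear_matrix_vector]]])
          (use sq(1) in \<open>simp add: sq_integrable_def\<close>)
      show "integrable ?M (\<lambda>x. (norm (y x))\<^sup>2 * K\<^sup>2)"
        using sq(1) by (simp add: sq_integrable_def)
      show "AE x in ?M. (norm (J *v y x))\<^sup>2 \<le> (norm (y x))\<^sup>2 * K\<^sup>2"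
        unfolding power_mult_distrib[symmetric] by (intro AE_I2 power_mono K(2)) auto
    qed
  qed
  then have "integrable ?M W" unfolding W_def by (intro integrable_cdot sq(3))
  from integrable_halfline_limit_zero[OF this lim] have "integral\<^sup>L ?M g = - W 0"
    by (metis add.commute add_eq_0_iff)
  moreover have "integral\<^sup>L ?M g = cinner (abs_L2 (dirac_expr J Q y)) (abs_L2 z) - cinner (abs_L2 y) (abs_L2 (dirac_expr J Qs z))"
    unfolding g_def by (simp add: cinner_abs_L2 sq i)
  ultimately show ?thesis by (simp add: W_def)
qed

text \<open>
  As the inverse of \<open>J\<close> is \<open>- J\<close>, the equation \<open>J \<Psi>' + Q \<Psi> = 0\<close> reads \<open>\<Psi>' = J Q \<Psi>\<close>.
\<close>
lemma fundamental_solution_exists: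
  obtains \<Psi> where "primitive \<Psi> (\<lambda>x. (J ** Q x) ** \<Psi> x)" "\<Psi> 0 = mat 1"
proof (rule linear_ODE_solution_exists[OF bounded_bilinear_matrix_matrix, where A = "\<lambda>x. J ** Q x" and c = "mat 1"])
  show "locally_integrable (\<lambda>x. J ** Q x)"
    using Q_L1 unfolding L1_loc_iff
    by (rule locally_integrable_bounded_linear[OF bounded_bilinear.bounded_linear_right[OF bounded_bilinear_matrix_matrix]])
qed (rule that)

end

lemma sq_integrable_times_continuous:
  fixes F :: "real \<Rightarrow> complex^'n^'m" and p :: "real \<Rightarrow> complex^'n"
  assumes F: "continuous_on {0..} F" and p: "sq_integrable p" and supp: "\<And>x. x > b \<Longrightarrow> p x = 0"
  shows "sq_integrable (\<lambda>x. F x *v p x)"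
proof -
  have "bounded (F ` {0..b})"
    by (intro compact_imp_bounded compact_continuous_image continuous_on_subset[OF F]) auto
  then obtain C where C: "C > 0" "\<And>x. x \<in> {0..b} \<Longrightarrow> norm (F x) \<le> C" unfolding bounded_pos by blast
  obtain K where K: "K > 0" "\<And>(A :: complex^'n^'m) v. norm (A *v v) \<le> norm A * norm v * K"
    using bounded_bilinear.pos_bounded[OF bounded_bilinear_matrix_vector] by blast
  show ?thesis
  proof (rule sq_integrable_bounded)
    show "(\<lambda>x. F x *v p x) \<in> borel_measurable (lebesgue_on {0..})"
    proof (rule borel_measurable_continuous_Pair[where f = F and g = p and H = "(*v)"])
      show "F \<in> borel_measurable (lebesgue_on {0..})" by (rule continuous_halfline_measurable[OF F])
      show "p \<in> borel_measurable (lebesgue_on {0..})" using p by (simp add: sq_integrable_def)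
      show "continuous_on UNIV (\<lambda>x :: (complex^'n^'m) \<times> (complex^'n). fst x *v snd x)"
        by (rule bounded_bilinear.continuous_on[OF bounded_bilinear_matrix_vector]) (intro continuous_intros)+
    qed
    show "integrable (lebesgue_on {0..}) (\<lambda>x. (C * K)\<^sup>2 * (norm (p x))\<^sup>2)"
      using p by (simp add: sq_integrable_def)
    show "AE x in lebesgue_on {0..}. (norm (F x *v p x))\<^sup>2 \<le> (C * K)\<^sup>2 * (norm (p x))\<^sup>2"
      using AE_halfline_nonneg
    proof eventually_elim
      case (elim x)
      have "norm (F x *v p x) \<le> C * K * norm (p x)"
      proof (cases "x \<le> b")
        case True
        have "norm (F x *v p x) \<le> norm (F x) * norm (p x) * K" by (rule K)
        also have "\<dots> \<le> C * norm (p x) * K"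
          using C(2)[of x] True elim K(1) by (intro mult_right_mono) auto
        finally show ?thesis by (simp add: mult_ac)
      next
        case False
        then show ?thesis using supp[of x] by simp
      qed
      then show ?case unfolding power_mult_distrib[symmetric] by (intro power_mono) auto
    qed
  qed
qed

lemma sq_integrable_continuous_compact:
  fixes f :: "real \<Rightarrow> complex^'n"
  assumes f: "continuous_on {0..} f" and supp: "\<And>x. x > b \<Longrightarrow> f x = 0"
  shows "sq_integrable f"
proof -
  have "bounded (f ` {0..b})"
    by (intro compact_imp_bounded compact_continuous_image continuous_on_subset[OF f]) auto
  then obtain C where C: "C > 0" "\<And>x. x \<in> {0..b} \<Longrightarrow> norm (f x) \<le> C" unfolding bounded_pos by blast
  show ?thesis
  proof (rule sq_integrable_bounded[OF continuous_halfline_measurable[OF f] integrable_halfline_indicator_Icc])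
    show "AE x in lebesgue_on {0..}. (norm (f x))\<^sup>2 \<le> C\<^sup>2 * indicator {0..b} x"
      using AE_halfline_nonneg
    proof eventually_elim
      case (elim x)
      show ?case
      proof (cases "x \<le> b")
        case True
        then show ?thesis using C(2)[of x] elim by (simp add: power_mono)
      next
        case False
        then show ?thesis using supp[of x] by simp
      qed
    qed
  qed
qed

section \<open>The gauge transformation and its test functions\<close>

context dirac_system begin

text \<open>
  By the Lagrange identity the boundary form of a solution for \<open>Q\<close> and a solution for \<open>Q\<^sup>*\<close> has
  derivative zero.
\<close>
lemma wronskian:
  assumes \<Psi>: "primitive \<Psi> (\<lambda>x. (J ** Q x) ** \<Psi> x)" "\<Psi> 0 = mat 1"
    and \<Phi>: "primitive \<Phi> (\<lambda>x. (J ** Qs x) ** \<Phi> x)" "\<Phi> 0 = mat 1"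
    and "0 \<le> x"
  shows "hermitian_adjoint (\<Phi> x) ** (J ** \<Psi> x) = J"
proof -
  let ?H = hermitian_adjoint
  have P1: "primitive (\<lambda>x. ?H (\<Phi> x)) (\<lambda>x. ?H ((J ** Qs x) ** \<Phi> x))"
    by (rule primitive_bounded_linear[OF bounded_linear_hermitian_adjoint \<Phi>(1)])
  have P2: "primitive (\<lambda>x. J ** \<Psi> x) (\<lambda>x. J ** ((J ** Q x) ** \<Psi> x))"
    by (rule primitive_bounded_linear[OF bounded_bilinear.bounded_linear_right[OF bounded_bilinear_matrix_matrix] \<Psi>(1)])
  have zero: "?H (\<Phi> x) ** (J ** ((J ** Q x) ** \<Psi> x)) + ?H ((J ** Qs x) ** \<Phi> x) ** (J ** \<Psi> x) = 0" for x
  proof -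
    have "J ** ((J ** Q x) ** \<Psi> x) = (J ** J) ** (Q x ** \<Psi> x)" by (simp add: matrix_mul_assoc)
    then have 1: "J ** ((J ** Q x) ** \<Psi> x) = - (Q x ** \<Psi> x)" by (simp add: J_square matrix_neg_mul)
    have "?H ((J ** Qs x) ** \<Phi> x) = - (?H (\<Phi> x) ** (Q x ** J))"
      by (simp add: hermitian_adjoint_mul adjoint_potential_def J_adjoint matrix_neg_mul)
    then have "?H ((J ** Qs x) ** \<Phi> x) ** (J ** \<Psi> x) = - (?H (\<Phi> x) ** (Q x ** ((J ** J) ** \<Psi> x)))"
      by (simp add: matrix_neg_mul matrix_mul_assoc)
    also have "\<dots> = ?H (\<Phi> x) ** (Q x ** \<Psi> x)" by (simp add: J_square matrix_neg_mul)
    finally show ?thesis by (simp add: 1 matrix_neg_mul)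
  qed
  have "?H (\<Phi> x) ** (J ** \<Psi> x) = ?H (\<Phi> 0) ** (J ** \<Psi> 0)"
    by (rule primitive_zero_const[OF primitive_bilinear[OF bounded_bilinear_matrix_matrix P1 P2]])
      (use zero \<open>0 \<le> x\<close> in auto)
  then show ?thesis by (simp add: \<Psi>(2) \<Phi>(2))
qed

text \<open>
  Write \<open>f = \<Psi> \<phi>\<close> where \<open>\<phi>' = p\<close>.  Since \<open>J \<Psi>' + Q \<Psi> = 0\<close>, the potential disappears from
  \<open>D(Q) f = J \<Psi> p\<close>, and \<open>f\<close> is in the maximal domain although \<open>Q\<close> is only locally integrable.  The condition on
  the integral of \<open>p\<close> makes \<open>\<phi>\<close> vanish beyond \<open>b\<close>.
\<close>
lemma gauge_test_function:
  assumes \<Psi>: "primitive \<Psi> (\<lambda>x. (J ** Q x) ** \<Psi> x)" "\<Psi> 0 = mat 1"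
    and p: "sq_integrable p" "\<And>x. x > b \<Longrightarrow> p x = 0" and "0 \<le> b"
    and end0: "v0 + integral {0..b} p = 0"
  defines "f \<equiv> \<lambda>x. \<Psi> x *v (v0 + integral {0..x} p)"
  shows "f \<in> max_funs J Q" "compact_support f" "f 0 = v0"
    "sq_integrable (\<lambda>x. (J ** \<Psi> x) *v p x)"
    "abs_L2 (dirac_expr J Q f) = abs_L2 (\<lambda>x. (J ** \<Psi> x) *v p x)"
    "\<And>x. x > b \<Longrightarrow> f x = 0"
proof -
  have pl: "locally_integrable p" by (rule sq_integrable_imp_locally_integrable[OF p(1)])
  define \<phi> where "\<phi> x = v0 + integral {0..x} p" for x
  have \<phi>: "primitive \<phi> p" unfolding \<phi>_def[abs_def] by (rule primitive_integral[OF pl])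
  have \<phi>0: "\<phi> x = 0" if "x > b" for x
  proof -
    have "integral {b..x} p = integral {b..x} (\<lambda>_. 0)"
      by (rule integral_spike[of "{b}"]) (use p(2) in auto)
    then show ?thesis
      using primitiveD[OF \<phi> \<open>0 \<le> b\<close>, of x] end0 that by (simp add: \<phi>_def)
  qed
  have feq: "f = (\<lambda>x. \<Psi> x *v \<phi> x)" by (simp add: f_def \<phi>_def)
  have fp: "primitive f (\<lambda>x. \<Psi> x *v p x + ((J ** Q x) ** \<Psi> x) *v \<phi> x)"
    unfolding feq by (rule primitive_bilinear[OF bounded_bilinear_matrix_vector \<Psi>(1) \<phi>])
  show f0: "f x = 0" if "x > b" for x using \<phi>0[OF that] by (simp add: feq)
  have "continuous_on {0..} (\<lambda>x. J ** \<Psi> x)"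
    by (intro bounded_linear.continuous_on[OF bounded_bilinear.bounded_linear_right[OF bounded_bilinear_matrix_matrix]]
        primitive_imp_continuous[OF \<Psi>(1)])
  from sq_integrable_times_continuous[OF this p]
  show sq: "sq_integrable (\<lambda>x. (J ** \<Psi> x) *v p x)" .
  have fsq: "sq_integrable f"
    by (rule sq_integrable_continuous_compact[OF primitive_imp_continuous[OF fp] f0])
  have eq: "AE x in lebesgue_on {0..}. J *v (\<Psi> x *v p x + ((J ** Q x) ** \<Psi> x) *v \<phi> x) + Q x *v f x = (J ** \<Psi> x) *v p x"
  proof (rule AE_I2)
    fix x
    have "J *v (((J ** Q x) ** \<Psi> x) *v \<phi> x) = - (Q x *v f x)"
      by (simp add: feq matrix_vector_mul_assoc[symmetric] JJ_vec)
    then show "J *v (\<Psi> x *v p x + ((J ** Q x) ** \<Psi> x) *v \<phi> x) + Q x *v f x = (J ** \<Psi> x) *v p x"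
      by (simp add: matrix_vector_right_distrib matrix_vector_mul_assoc)
  qed
  from max_funsI[OF fp fsq sq eq]
  show "f \<in> max_funs J Q" "abs_L2 (dirac_expr J Q f) = abs_L2 (\<lambda>x. (J ** \<Psi> x) *v p x)" by auto
  show "f 0 = v0" by (simp add: f_def \<Psi>(2))
  have "{x \<in> {0..}. f x \<noteq> 0} \<subseteq> {0..b}" using f0 by (auto simp: not_less[symmetric])
  then have "bounded {x \<in> {0..}. f x \<noteq> 0}" by (rule bounded_subset[rotated]) simp
  then show "compact_support f" by (simp add: compact_support_def compact_closure)
qed

text \<open>
  Take \<open>\<phi>(x) = (1 - x) v\<close> on \<open>[0, 1]\<close>, continued by zero, in the gauge transformation.
\<close>
lemma prescribed_initial_value:
  obtains y where "y \<in> max_funs J Q" "compact_support y" "y 0 = v"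
proof -
  obtain \<Psi> where \<Psi>: "primitive \<Psi> (\<lambda>x. (J ** Q x) ** \<Psi> x)" "\<Psi> 0 = mat 1"
    by (rule fundamental_solution_exists)
  define p where "p x = (if x \<le> 1 then - v else 0)" for x :: real
  have "sq_integrable p"
  proof (rule sq_integrable_bounded[OF _ integrable_halfline_indicator_Icc])
    show "p \<in> borel_measurable (lebesgue_on {0..})"
      unfolding p_def[abs_def] by (intro measurable_restrict_space1 measurable_completion) measurable
    show "AE x in lebesgue_on {0..}. (norm (p x))\<^sup>2 \<le> (norm v)\<^sup>2 * indicator {0..1} x"
      using AE_halfline_nonneg by eventually_elim (simp add: p_def)
  qed
  moreover have "v + integral {0..1} p = 0"
  proof -
    have "integral {0..1} p = integral {0..1} (\<lambda>x::real. - v)"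
      by (rule integral_cong) (simp add: p_def)
    then show ?thesis by simp
  qed
  moreover have "p x = 0" if "x > 1" for x using that by (simp add: p_def)
  ultimately show thesis
    using gauge_test_function[OF \<Psi>, of p 1 v] that by auto
qed

end

lemma integral_halfline_compact:
  fixes f :: "real \<Rightarrow> 'a::euclidean_space"
  assumes f: "integrable (lebesgue_on {0..}) f" and z: "\<And>x. x > b \<Longrightarrow> f x = 0"
  shows "integral\<^sup>L (lebesgue_on {0..}) f = integral {0..b} f"
proof (rule tendsto_unique[OF _ integral_halfline_tendsto[OF f]])
  have "integral {0..b} f = integral {0..c} f" if "c \<ge> max b 0" for c
  proof -
    have "integral ({0..b} \<inter> {0..c}) f = integral {0..c} (\<lambda>x. if x \<in> {0..b} then f x else 0)"
      by (rule Henstock_Kurzweil_Integration.integral_restrict_Int[symmetric])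
    also have "\<dots> = integral {0..c} f" by (rule integral_cong) (use z in auto)
    also have "{0..b} \<inter> {0..c} = {0..b}" using that by auto
    finally show ?thesis .
  qed
  then have "eventually (\<lambda>c. integral {0..b} f = integral {0..c} f) at_top"
    using eventually_ge_at_top[of "max b 0"] by (rule eventually_mono[rotated])
  then show "((\<lambda>c. integral {0..c} f) \<longlongrightarrow> integral {0..b} f) at_top"
    by (rule Lim_transform_eventually[OF tendsto_const])
qed simp

text \<open>
  On \<open>[0, b]\<close> the difference of \<open>s\<close> and its mean is itself a function of mean zero; it is orthogonal to \<open>s\<close>
  and to constants, hence to itself.
\<close>
lemma orthogonal_to_mean_zero_imp_constant:
  fixes s :: "real \<Rightarrow> complex^'n"
  assumes s: "sq_integrable (\<lambda>x. if x \<le> b then s x else 0)" and "0 < b"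
    and orth: "\<And>p. sq_integrable p \<Longrightarrow> (\<And>x. x > b \<Longrightarrow> p x = 0) \<Longrightarrow> integral {0..b} p = 0 \<Longrightarrow>
      integral {0..b} (\<lambda>x. cdot (p x) (s x)) = 0"
  shows "\<exists>m. AE x in lebesgue_on {0..}. x \<le> b \<longrightarrow> s x = m"
proof -
  let ?M = "lebesgue_on {0::real..}"
  define s' where "s' x = (if x \<le> b then s x else 0)" for x
  have s': "sq_integrable s'" using s by (simp add: s'_def[abs_def])
  define m where "m = (1 / b) *\<^sub>R integral {0..b} s'"
  define c where "c x = (if x \<le> b then m else 0)" for x
  have c: "sq_integrable c"
  proof (rule sq_integrable_bounded[OF _ integrable_halfline_indicator_Icc])
    show "c \<in> borel_measurable ?M"
      unfolding c_def[abs_def] by (intro measurable_restrict_space1 measurable_completion) measurable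
    show "AE x in ?M. (norm (c x))\<^sup>2 \<le> (norm m)\<^sup>2 * indicator {0..b} x"
      using AE_halfline_nonneg by eventually_elim (simp add: c_def)
  qed
  define p where "p x = s' x - c x" for x
  have p: "sq_integrable p" unfolding p_def[abs_def] by (rule sq_integrable_diff[OF s' c])
  have p0: "p x = 0" if "x > b" for x using that by (simp add: p_def s'_def c_def)
  note li = locally_integrableD(2)[OF sq_integrable_imp_locally_integrable order_refl]
  have "integral {0..b} c = integral {0..b} (\<lambda>x. m)" by (rule integral_cong) (simp add: c_def)
  then have "integral {0..b} c = integral {0..b} s'" using \<open>0 < b\<close> by (simp add: m_def)
  then have pm: "integral {0..b} p = 0"
    unfolding p_def[abs_def] by (subst Henstock_Kurzweil_Integration.integral_diff) (auto intro: li s' c)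
  have ip: "integrable ?M (\<lambda>x. cdot (p x) (s' x))" "integrable ?M (\<lambda>x. cdot (p x) (c x))" "integrable ?M (\<lambda>x. cdot (p x) (p x))"
    by (intro integrable_cdot p s' c)+
  have "integral\<^sup>L ?M (\<lambda>x. cdot (p x) (s' x)) = integral {0..b} (\<lambda>x. cdot (p x) (s' x))"
    by (rule integral_halfline_compact[OF ip(1)]) (simp add: p0)
  also have "\<dots> = integral {0..b} (\<lambda>x. cdot (p x) (s x))" by (rule integral_cong) (simp add: s'_def)
  also have "\<dots> = 0" by (rule orth[OF p p0 pm])
  finally have 1: "integral\<^sup>L ?M (\<lambda>x. cdot (p x) (s' x)) = 0" .
  have "integral\<^sup>L ?M (\<lambda>x. cdot (p x) (c x)) = integral {0..b} (\<lambda>x. cdot (p x) (c x))"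
    by (rule integral_halfline_compact[OF ip(2)]) (simp add: p0)
  also have "\<dots> = integral {0..b} (\<lambda>x. cdot (p x) m)" by (rule integral_cong) (simp add: c_def)
  also have "\<dots> = cdot (integral {0..b} p) m"
    using integral_linear[OF li[OF p] bounded_bilinear.bounded_linear_left[OF bounded_bilinear_cdot, of m]]
    by (simp add: o_def)
  finally have 2: "integral\<^sup>L ?M (\<lambda>x. cdot (p x) (c x)) = 0" using pm by simp
  have "cinner (abs_L2 p) (abs_L2 p) = integral\<^sup>L ?M (\<lambda>x. cdot (p x) (p x))" by (rule cinner_abs_L2[OF p p])
  also have "\<dots> = integral\<^sup>L ?M (\<lambda>x. cdot (p x) (s' x) - cdot (p x) (c x))"
    by (simp add: p_def cdot_diff_right)
  also have "\<dots> = 0" using ip 1 2 by simp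
  finally have "abs_L2 p = 0" using cinner_self[of "abs_L2 p"] by simp
  then have "abs_L2 p = abs_L2 (\<lambda>x. 0)" by (simp add: zero_L2_def)
  then have "AE x in ?M. p x = 0" using abs_L2_eq_iff[OF p sq_integrable_zero] by simp
  then have "AE x in ?M. x \<le> b \<longrightarrow> s x = m"
    by eventually_elim (auto simp: p_def s'_def c_def)
  then show ?thesis by blast
qed

text \<open>
  Any two of the constants agree on \<open>[0, 1]\<close>, which is not a null set.
\<close>
lemma constant_on_all_intervals:
  fixes s :: "real \<Rightarrow> 'a"
  assumes "\<And>b. 0 < b \<Longrightarrow> \<exists>m. AE x in lebesgue_on {0..}. x \<le> b \<longrightarrow> s x = m"
  shows "\<exists>m. AE x in lebesgue_on {0..}. s x = m"
proof -
  have "\<forall>n. \<exists>m. AE x in lebesgue_on {0..}. x \<le> real (Suc n) \<longrightarrow> s x = m"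
    using assms by simp
  then obtain m where m: "\<And>n. AE x in lebesgue_on {0..}. x \<le> real (Suc n) \<longrightarrow> s x = m n" by metis
  have m0: "m n = m 0" for n
  proof (rule ccontr)
    assume ne: "m n \<noteq> m 0"
    have "AE x in lebesgue_on {0..}. \<not> x \<le> (1::real)"
      using m[of n] m[of 0] 
    proof eventually_elim
      case (elim x)
      then show ?case using ne by auto
    qed
    then have "negligible {x. 0 \<le> x \<and> \<not> \<not> x \<le> (1::real)}" by (simp only: AE_halfline_iff_negligible)
    moreover have "{x. 0 \<le> x \<and> \<not> \<not> x \<le> (1::real)} = cbox 0 1" by auto
    ultimately have "negligible (cbox 0 (1::real))" by (simp only:)
    then show False by (simp only: negligible_interval) simp
  qed
  have "AE x in lebesgue_on {0..}. x \<le> real (Suc n) \<longrightarrow> s x = m 0" for n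
    using m[of n] unfolding m0[of n] .
  then have "AE x in lebesgue_on {0..}. \<forall>n. x \<le> real (Suc n) \<longrightarrow> s x = m 0"
    unfolding AE_all_countable by (rule allI)
  then have "AE x in lebesgue_on {0..}. s x = m 0"
  proof eventually_elim
    case (elim x)
    obtain n where "x \<le> real n" using real_arch_simple by blast
    then have "x \<le> real (Suc n)" by simp
    then show ?case using elim by blast
  qed
  then show ?thesis by blast
qed

section \<open>The adjoint of the compactly supported restriction\<close>

lemma cutoff_measurable:
  fixes f :: "real \<Rightarrow> 'a::euclidean_space"
  assumes "f \<in> borel_measurable (lebesgue_on {0..})"
  shows "(\<lambda>x. if x \<le> b then f x else 0) \<in> borel_measurable (lebesgue_on {0..})"
proof -
  have "(\<lambda>x. indicator {..b} x *\<^sub>R f x) \<in> borel_measurable (lebesgue_on {0..})"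
  proof (rule borel_measurable_scaleR)
    show "indicator {..b} \<in> borel_measurable (lebesgue_on {0..})"
      by (intro measurable_restrict_space1 borel_measurable_indicator) simp
  qed (rule assms)
  also have "(\<lambda>x. indicator {..b} x *\<^sub>R f x) = (\<lambda>x. if x \<le> b then f x else 0)"
    by (auto simp: fun_eq_iff)
  finally show ?thesis .
qed

lemma sq_integrable_cutoff:
  assumes "sq_integrable f"
  shows "sq_integrable (\<lambda>x. if x \<le> b then f x else 0)"
proof (rule sq_integrable_bounded)
  show "(\<lambda>x. if x \<le> b then f x else 0) \<in> borel_measurable (lebesgue_on {0..})"
    using assms by (intro cutoff_measurable) (simp add: sq_integrable_def)
  show "integrable (lebesgue_on {0..}) (\<lambda>x. (norm (f x))\<^sup>2)" using assms by (simp add: sq_integrable_def)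
qed auto

lemma sq_integrable_continuous_cutoff:
  fixes f :: "real \<Rightarrow> complex^'n"
  assumes f: "continuous_on {0..} f"
  shows "sq_integrable (\<lambda>x. if x \<le> b then f x else 0)"
proof -
  have "bounded (f ` {0..b})"
    by (intro compact_imp_bounded compact_continuous_image continuous_on_subset[OF f]) auto
  then obtain C where C: "C > 0" "\<And>x. x \<in> {0..b} \<Longrightarrow> norm (f x) \<le> C" unfolding bounded_pos by blast
  show ?thesis
  proof (rule sq_integrable_bounded[OF cutoff_measurable[OF continuous_halfline_measurable[OF f]] integrable_halfline_indicator_Icc])
    show "AE x in lebesgue_on {0..}. (norm (if x \<le> b then f x else 0))\<^sup>2 \<le> C\<^sup>2 * indicator {0..b} x"
      using AE_halfline_nonneg
    proof eventually_elim
      case (elim x)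
      then show ?case using C(2)[of x] by (simp add: power_mono)
    qed
  qed
qed

context dirac_system begin

text \<open>
  Let \<open>R\<close> be the primitive of \<open>\<Psi>\<^sup>* h\<close> and \<open>q = (J \<Psi>)\<^sup>* g\<close>.  Testing \<open>(g, h)\<close> with \<open>\<Psi> \<phi>\<close>, where \<open>\<phi>' = p\<close> has mean
  zero on \<open>[0, b]\<close>, and integrating by parts shows that \<open>q + R\<close> is orthogonal to \<open>p\<close>; so \<open>q + R\<close> is a
  constant \<open>C\<close>.  By the Wronskian identity \<open>\<Phi> J\<close> inverts \<open>(J \<Psi>)\<^sup>*\<close>, hence \<open>g = \<Phi> J (C - R)\<close> is locally
  absolutely continuous, and differentiating this product gives \<open>D(Q\<^sup>*) g = h\<close>.
\<close>
lemma adjoint_of_compactly_supported: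
  assumes gh: "(g, h) \<in> adj (dirac_graph J Q {y \<in> max_funs J Q. compact_support y \<and> y 0 = 0})"
  shows "(g, h) \<in> D_max J Qs"
proof -
  interpret adj: dirac_system J Qs by (rule adjoint_system)
  let ?M = "lebesgue_on {0::real..}" and ?H = hermitian_adjoint
  obtain g0 where g0: "sq_integrable g0" "g = abs_L2 g0" by (rule L2_obtain_function)
  obtain h0 where h0: "sq_integrable h0" "h = abs_L2 h0" by (rule L2_obtain_function)
  obtain \<Psi> where \<Psi>: "primitive \<Psi> (\<lambda>x. (J ** Q x) ** \<Psi> x)" "\<Psi> 0 = mat 1"
    by (rule fundamental_solution_exists)
  obtain \<Phi> where \<Phi>: "primitive \<Phi> (\<lambda>x. (J ** Qs x) ** \<Phi> x)" "\<Phi> 0 = mat 1"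
    by (rule adj.fundamental_solution_exists)
  have HP: "continuous_on {0..} (\<lambda>x. ?H (\<Psi> x))"
    by (rule bounded_linear.continuous_on[OF bounded_linear_hermitian_adjoint primitive_imp_continuous[OF \<Psi>(1)]])
  have JP: "continuous_on {0..} (\<lambda>x. ?H (J ** \<Psi> x))"
    by (intro bounded_linear.continuous_on[OF bounded_linear_hermitian_adjoint]
        bounded_linear.continuous_on[OF bounded_bilinear.bounded_linear_right[OF bounded_bilinear_matrix_matrix]]
        primitive_imp_continuous[OF \<Psi>(1)])
  define r where "r x = ?H (\<Psi> x) *v h0 x" for x
  have rl: "locally_integrable r"
    unfolding r_def[abs_def]
    by (rule locally_integrable_bilinear[OF bounded_bilinear_matrix_vector HP sq_integrable_imp_locally_integrable[OF h0(1)]])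
  define R where "R x = integral {0..x} r" for x
  have Rp: "primitive R r" using primitive_integral[OF rl, of 0] by (simp add: R_def[abs_def])
  define q where "q x = ?H (J ** \<Psi> x) *v g0 x" for x
  define s where "s x = q x + R x" for x
  have const: "\<exists>m. AE x in ?M. x \<le> b \<longrightarrow> s x = m" if "0 < b" for b
  proof (rule orthogonal_to_mean_zero_imp_constant[OF _ that])
    have "sq_integrable (\<lambda>x. ?H (J ** \<Psi> x) *v (if x \<le> b then g0 x else 0))"
      by (rule sq_integrable_times_continuous[OF JP sq_integrable_cutoff[OF g0(1)], where b = b]) simp
    from sq_integrable_add[OF this sq_integrable_continuous_cutoff[OF primitive_imp_continuous[OF Rp], of b]]
    show "sq_integrable (\<lambda>x. if x \<le> b then s x else 0)"
      by (rule sq_integrable_cong_AE) (auto simp: s_def q_def intro!: AE_I2)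
  next
    fix p :: "real \<Rightarrow> complex^'n"
    assume p: "sq_integrable p" "\<And>x. x > b \<Longrightarrow> p x = 0" and pm: "integral {0..b} p = 0"
    have pl: "locally_integrable p" by (rule sq_integrable_imp_locally_integrable[OF p(1)])
    define \<phi> where "\<phi> x = integral {0..x} p" for x
    have \<phi>p: "primitive \<phi> p" using primitive_integral[OF pl, of 0] by (simp add: \<phi>_def[abs_def])
    define f where "f x = \<Psi> x *v (0 + integral {0..x} p)" for x
    have "0 \<le> b" using that by simp
    have e0: "0 + integral {0..b} p = 0" using pm by simp
    have gauge: "f \<in> max_funs J Q" "compact_support f" "f 0 = 0"
      "sq_integrable (\<lambda>x. (J ** \<Psi> x) *v p x)"
      "abs_L2 (dirac_expr J Q f) = abs_L2 (\<lambda>x. (J ** \<Psi> x) *v p x)"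
      "\<And>x. x > b \<Longrightarrow> f x = 0"
      unfolding f_def[abs_def] using gauge_test_function[OF \<Psi> p \<open>0 \<le> b\<close> e0] by blast+
    have fsq: "sq_integrable f" using gauge(1) by (simp add: max_funs_def)
    have "(abs_L2 f, abs_L2 (dirac_expr J Q f)) \<in> dirac_graph J Q {y \<in> max_funs J Q. compact_support y \<and> y 0 = 0}"
      unfolding dirac_graph_def using gauge(1-3) by blast
    then have "cinner (abs_L2 (dirac_expr J Q f)) g = cinner (abs_L2 f) h"
      using gh unfolding adj_def by blast
    then have pair: "integral\<^sup>L ?M (\<lambda>x. cdot ((J ** \<Psi> x) *v p x) (g0 x)) = integral\<^sup>L ?M (\<lambda>x. cdot (f x) (h0 x))"
      unfolding gauge(5) g0(2) h0(2) by (simp only: cinner_abs_L2[OF gauge(4) g0(1)] cinner_abs_L2[OF fsq h0(1)])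
    note i1 = integrable_cdot[OF gauge(4) g0(1)] and i2 = integrable_cdot[OF fsq h0(1)]
    have "integral\<^sup>L ?M (\<lambda>x. cdot ((J ** \<Psi> x) *v p x) (g0 x)) = integral {0..b} (\<lambda>x. cdot ((J ** \<Psi> x) *v p x) (g0 x))"
      by (rule integral_halfline_compact[OF i1]) (simp add: p(2))
    moreover have "integral\<^sup>L ?M (\<lambda>x. cdot (f x) (h0 x)) = integral {0..b} (\<lambda>x. cdot (f x) (h0 x))"
      by (rule integral_halfline_compact[OF i2]) (simp add: gauge(6))
    moreover have 1: "cdot ((J ** \<Psi> x) *v p x) (g0 x) = cdot (p x) (q x)" for x
      by (simp only: cdot_matrix_left[of "J ** \<Psi> x"] q_def)
    moreover have 2: "cdot (f x) (h0 x) = cdot (\<phi> x) (r x)" for x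
      by (simp add: cdot_matrix_left[of "\<Psi> x"] r_def f_def \<phi>_def)
    ultimately have e1: "integral {0..b} (\<lambda>x. cdot (p x) (q x)) = integral {0..b} (\<lambda>x. cdot (\<phi> x) (r x))"
      using pair by simp
    note li = locally_integrableD(2)[OF halfline_integrable_imp_locally_integrable order_refl]
    have iq: "(\<lambda>x. cdot (p x) (q x)) integrable_on {0..b}" using li[OF i1] unfolding 1 .
    have ir: "(\<lambda>x. cdot (\<phi> x) (r x)) integrable_on {0..b}" using li[OF i2] unfolding 2 .
    have P: "primitive (\<lambda>x. cdot (\<phi> x) (R x)) (\<lambda>x. cdot (\<phi> x) (r x) + cdot (p x) (R x))"
      by (rule primitive_bilinear[OF bounded_bilinear_cdot \<phi>p Rp])
    have "(\<lambda>x. cdot (\<phi> x) (r x) + cdot (p x) (R x)) integrable_on {0..b}"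
      by (rule locally_integrableD(2)[OF P[unfolded primitive_def, THEN conjunct1] order_refl])
    from integrable_diff[OF this ir] have iR: "(\<lambda>x. cdot (p x) (R x)) integrable_on {0..b}" by simp
    have "integral {0..b} (\<lambda>x. cdot (\<phi> x) (r x) + cdot (p x) (R x)) = 0"
      using primitiveD[OF P order_refl \<open>0 \<le> b\<close>] by (simp add: \<phi>_def pm)
    then have "integral {0..b} (\<lambda>x. cdot (\<phi> x) (r x)) + integral {0..b} (\<lambda>x. cdot (p x) (R x)) = 0"
      by (simp only: Henstock_Kurzweil_Integration.integral_add[OF ir iR])
    then have "integral {0..b} (\<lambda>x. cdot (p x) (q x)) + integral {0..b} (\<lambda>x. cdot (p x) (R x)) = 0"
      by (simp only: e1)
    then show "integral {0..b} (\<lambda>x. cdot (p x) (s x)) = 0"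
      by (simp only: s_def cdot_add_right Henstock_Kurzweil_Integration.integral_add[OF iq iR])
  qed
  obtain C where C: "AE x in ?M. s x = C" using constant_on_all_intervals[OF const] by blast
  define Z where "Z x = \<Phi> x ** J" for x
  define y where "y x = Z x *v (C - R x)" for x
  have Zp: "primitive Z (\<lambda>x. (J ** Qs x) ** Z x)"
    using primitive_bounded_linear[OF bounded_bilinear.bounded_linear_left[OF bounded_bilinear_matrix_matrix] \<Phi>(1), of J]
    by (simp add: Z_def[abs_def] matrix_mul_assoc)
  have CR: "primitive (\<lambda>x. C - R x) (\<lambda>x. - r x)"
  proof -
    have "primitive (\<lambda>x. - R x) (\<lambda>x. - r x)"
      by (rule primitive_bounded_linear[OF bounded_linear_minus[OF bounded_linear_ident] Rp])
    then show ?thesis by (simp add: primitive_def)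
  qed
  have yp: "primitive y (\<lambda>x. Z x *v (- r x) + ((J ** Qs x) ** Z x) *v (C - R x))"
    unfolding y_def[abs_def] by (rule primitive_bilinear[OF bounded_bilinear_matrix_vector Zp CR])
  \<comment> \<open>The adjoint Wronskian identity gives a left inverse of \<open>\<Phi> x\<close>, which is also a right inverse.\<close>
  have W: "\<Phi> x ** (J ** ?H (\<Psi> x)) = J" if "0 \<le> x" for x
  proof -
    have "?H (\<Psi> x) ** (J ** \<Phi> x) = J"
      using arg_cong[OF wronskian[OF \<Psi> \<Phi> that], of ?H]
      by (simp add: hermitian_adjoint_mul J_adjoint matrix_neg_mul matrix_mul_assoc)
    then have "(- (J ** ?H (\<Psi> x) ** J)) ** \<Phi> x = mat 1"
      by (simp add: matrix_neg_mul matrix_mul_assoc[symmetric] J_square)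
    then have "\<Phi> x ** (- (J ** ?H (\<Psi> x) ** J)) = mat 1" by (rule matrix_left_right_inverse1)
    then have "(\<Phi> x ** (J ** ?H (\<Psi> x))) ** J ** J = - J"
      by (metis matrix_mul_assoc matrix_mul_lid matrix_neg_mul minus_minus)
    then show ?thesis by (simp add: matrix_mul_assoc[symmetric] J_square matrix_neg_mul)
  qed
  have Zq: "Z x *v q x = g0 x" if "0 \<le> x" for x
  proof -
    have "Z x *v q x = (\<Phi> x ** (J ** ?H (\<Psi> x))) *v (- (J *v g0 x))"
      by (simp add: Z_def q_def hermitian_adjoint_mul J_adjoint matrix_vector_mul_assoc matrix_neg_mul matrix_neg_vec matrix_mul_assoc)
    then show ?thesis by (simp add: W[OF that] matrix_neg_vec JJ_vec)
  qed
  have yg: "AE x in ?M. g0 x = y x"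
    using C AE_halfline_nonneg
  proof eventually_elim
    case (elim x)
    then have "C - R x = q x" by (simp add: s_def algebra_simps)
    then show ?case using Zq[OF elim(2)] by (simp add: y_def)
  qed
  have ysq: "sq_integrable y" by (rule sq_integrable_cong_AE[OF g0(1) yg])
  have eq: "AE x in ?M. J *v (Z x *v (- r x) + ((J ** Qs x) ** Z x) *v (C - R x)) + Qs x *v y x = h0 x"
    using AE_halfline_nonneg
  proof eventually_elim
    case (elim x)
    have "J *v (((J ** Qs x) ** Z x) *v (C - R x)) = - (Qs x *v y x)"
      by (simp add: y_def matrix_vector_mul_assoc[symmetric] JJ_vec)
    moreover have "J *v (Z x *v (- r x)) = h0 x"
    proof -
      have "Z x *v (- r x) = - ((\<Phi> x ** (J ** ?H (\<Psi> x))) *v h0 x)"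
        by (simp add: Z_def r_def matrix_neg_vec matrix_vector_mul_assoc matrix_mul_assoc)
      then show ?thesis by (simp add: W[OF elim] matrix_neg_vec JJ_vec)
    qed
    ultimately show ?case by (simp add: matrix_vector_right_distrib)
  qed
  have "y \<in> max_funs J Qs" "abs_L2 (dirac_expr J Qs y) = h"
    using adj.max_funsI[OF yp ysq h0(1) eq] h0(2) by auto
  moreover have "abs_L2 y = g" using abs_L2_eq_iff[OF g0(1) ysq] yg g0(2) by simp
  ultimately show ?thesis unfolding D_max_def dirac_graph_def by force
qed

end

section \<open>Boundary subspaces, adjoints and closures\<close>

text \<open>
  Orthogonality for the real part to both \<open>u\<close> and \<open>\<i> *s u\<close> is orthogonality for the Hermitian product.  The
  identification makes the double complement theorem for real subspaces applicable.
\<close>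
lemma complex_orthogonal_complement:
  assumes "vec.subspace (S :: (complex^'n) set)"
  shows "{v. \<forall>u\<in>S. cdot v u = 0} = orthogonal_comp S"
proof -
  have "cdot v u = 0" if v: "\<And>u. u \<in> S \<Longrightarrow> inner u v = 0" and u: "u \<in> S" for v u
  proof -
    have "\<i> *s u \<in> S" using assms u by (rule vec.subspace_scale)
    from v[OF this] have "Re (cdot v (\<i> *s u)) = 0" by (simp add: Re_cdot inner_commute)
    then have "Im (cdot v u) = 0" by (simp add: cdot_scale_right)
    moreover have "Re (cdot v u) = 0" using v[OF u] by (simp add: Re_cdot inner_commute)
    ultimately show ?thesis by (simp add: complex_eq_iff)
  qed
  moreover have "inner u v = 0" if "cdot v u = 0" for u v :: "complex^'n"
    using that Re_cdot[of v u] by (simp add: inner_commute)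
  ultimately show ?thesis
    unfolding orthogonal_comp_def orthogonal_def by auto
qed

lemma complex_subspace_real:
  assumes "vec.subspace (S :: (complex^'n) set)" shows "subspace S"
proof (rule subspaceI)
  fix c x assume "x \<in> S"
  then have "of_real c *s x \<in> S" using assms by (intro vec.subspace_scale)
  moreover have "of_real c *s x = c *\<^sub>R x"
    by (subst vec_eq_iff) (auto simp: complex_eq_iff)
  ultimately show "c *\<^sub>R x \<in> S" by simp
qed (use assms vec.subspace_0 vec.subspace_add in auto)

lemma dim_complex_orthogonal_complement:
  assumes S: "vec.subspace (S :: (complex^'n) set)"
  shows "vec.dim S + vec.dim {v. \<forall>u\<in>S. cdot v u = 0} = CARD('n)"
proof -
  let ?T = "{v. \<forall>u\<in>S. cdot v u = 0}"
  have T: "vec.subspace ?T"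
    by (auto simp: vec.subspace_def cdot_add_left cdot_scale_left)
  have sum: "S + ?T = UNIV"
    using subspace_sum_orthogonal_comp[OF complex_subspace_real[OF S]]
    unfolding complex_orthogonal_complement[OF S, symmetric] .
  have "v \<in> {x + y |x y. x \<in> S \<and> y \<in> ?T}" for v
    using UNIV_I[of v] unfolding sum[symmetric] by (elim set_plus_elim) blast
  then have "{x + y |x y. x \<in> S \<and> y \<in> ?T} = UNIV" by blast
  moreover have "S \<inter> ?T = {0}"
  proof -
    have "x = 0" if "x \<in> S" "x \<in> ?T" for x
      using that cdot_self_eq_0[of x] by blast
    then show ?thesis using vec.subspace_0[OF S] vec.subspace_0[OF T] by blast
  qed
  moreover have "vec.dim (UNIV :: (complex^'n) set) = CARD('n)" by (rule vec_dim_card)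
  moreover have "vec.dim ({0} :: (complex^'n) set) = 0"
    using vec.dim_eq_0[of "{0}"] by simp
  ultimately show ?thesis using vec.dim_sums_Int[OF S T] by (simp only: add_0_right)
qed

context dirac_system begin

lemma inj_J: "inj ((*v) J)"
  by (rule injI) (metis JJ_vec minus_equation_iff)

lemma subspace_image_J:
  assumes "vec.subspace \<theta>" shows "vec.subspace ((*v) J ` \<theta>)"
  unfolding vec.subspace_def
proof (intro conjI ballI allI)
  show "0 \<in> (*v) J ` \<theta>" using vec.subspace_0[OF assms] by (intro image_eqI[of _ _ 0]) simp_all
  fix u assume "u \<in> (*v) J ` \<theta>"
  then obtain a where a: "a \<in> \<theta>" "u = J *v a" by blast
  show "c *s u \<in> (*v) J ` \<theta>" for c
    using vec.subspace_scale[OF assms a(1)] by (intro image_eqI[of _ _ "c *s a"]) (simp_all add: a vector_scalar_commute)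
  fix v assume "v \<in> (*v) J ` \<theta>"
  then obtain b where b: "b \<in> \<theta>" "v = J *v b" by blast
  show "u + v \<in> (*v) J ` \<theta>"
    using vec.subspace_add[OF assms a(1) b(1)] by (intro image_eqI[of _ _ "a + b"]) (simp_all add: a b matrix_vector_right_distrib)
qed

lemma theta_cross_eq: "theta_cross J \<theta> = {v. \<forall>u\<in>(*v) J ` \<theta>. cdot v u = 0}"
  by (simp add: theta_cross_def)

lemma subspace_theta_cross: "vec.subspace (theta_cross J \<theta>)"
  by (auto simp: vec.subspace_def theta_cross_def cdot_add_left cdot_scale_left)

lemma dim_theta_cross:
  assumes "vec.subspace \<theta>"
  shows "vec.dim \<theta> + vec.dim (theta_cross J \<theta>) = CARD('n)"
proof -
  have "vec.dim ((*v) J ` \<theta>) = vec.dim \<theta>"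
    by (rule vec.dim_image_eq[OF matrix_vector_mul_linear_gen]) (rule inj_on_subset[OF inj_J subset_UNIV])
  then show ?thesis
    using dim_complex_orthogonal_complement[OF subspace_image_J[OF assms]] by (simp add: theta_cross_eq)
qed

text \<open>
  Since \<open>J\<close> is skew-Hermitian, \<open>v\<close> lies in the double cross of \<open>\<theta>\<close> exactly if \<open>J v\<close> lies in the double orthogonal
  complement of \<open>J \<theta>\<close>, which is \<open>J \<theta>\<close>.
\<close>
lemma theta_cross_involutive:
  assumes "vec.subspace \<theta>"
  shows "theta_cross J (theta_cross J \<theta>) = \<theta>"
proof -
  note sJ = subspace_image_J[OF assms]
  have dd: "{v. \<forall>u\<in>theta_cross J \<theta>. cdot v u = 0} = (*v) J ` \<theta>"
    unfolding complex_orthogonal_complement[OF subspace_theta_cross]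
    unfolding theta_cross_eq complex_orthogonal_complement[OF sJ]
    by (rule orthogonal_comp_self[OF complex_subspace_real[OF sJ]])
  have "v \<in> theta_cross J (theta_cross J \<theta>) \<longleftrightarrow> J *v v \<in> (*v) J ` \<theta>" for v
    unfolding dd[symmetric] by (simp add: theta_cross_def cdot_J)
  then show ?thesis using inj_J by (auto simp: inj_image_mem_iff)
qed

lemma theta_cross_zero: "theta_cross J {0} = UNIV"
  by (simp add: theta_cross_def)

end

lemma Im_cinner: "Im (cinner f g) = inner (scaleL2 (- \<i>) f) g"
  by (simp only: inner_L2_def cinner_scale_left) simp

text \<open>
  Expressed by real inner products, the defining equations of an adjoint and of orthogonality come
  within reach of the continuity and separation results for real inner product spaces.
\<close>
lemma cinner_eq_iff_inner:
  "cinner k g = cinner f h \<longleftrightarrow> inner k g = inner f h \<and> inner (scaleL2 (- \<i>) k) g = inner (scaleL2 (- \<i>) f) h"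
  by (simp only: complex_eq_iff Im_cinner inner_L2_def)

lemma closed_adj: "closed (adj A)"
proof -
  have "adj A = (\<Inter>(f, k)\<in>A. {p. inner k (fst p) = inner f (snd p)} \<inter>
      {p. inner (scaleL2 (- \<i>) k) (fst p) = inner (scaleL2 (- \<i>) f) (snd p)})"
    unfolding adj_def cinner_eq_iff_inner by auto
  then show ?thesis
    by (auto intro!: closed_INT closed_Int closed_Collect_eq continuous_intros)
qed

lemma adj_antimono: "A \<subseteq> B \<Longrightarrow> adj B \<subseteq> adj A"
  unfolding adj_def by auto

lemma primitive_add:
  assumes "primitive f k" "primitive g l"
  shows "primitive (\<lambda>x. f x + g x) (\<lambda>x. k x + l x)"
proof -
  have li: "locally_integrable k" "locally_integrable l" using assms by (auto simp: primitive_def)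
  have "f x + g x - (f 0 + g 0) = integral {0..x} (\<lambda>x. k x + l x)" if "x \<ge> 0" for x
  proof -
    have "integral {0..x} (\<lambda>x. k x + l x) = integral {0..x} k + integral {0..x} l"
      by (intro Henstock_Kurzweil_Integration.integral_add locally_integrableD(2)[OF _ order_refl] li)
    then show ?thesis
      unfolding primitiveD[OF assms(1) order_refl that, symmetric] primitiveD[OF assms(2) order_refl that, symmetric]
      by simp
  qed
  then show ?thesis using locally_integrable_add[OF li] by (simp add: primitive_def)
qed

text \<open>
  The integral of the continuous function \<open>norm (f t - g t)\<close> over any interval is zero.
\<close>
lemma primitive_eq_AE_imp_eq:
  assumes f: "primitive f k" and g: "primitive g l" and ae: "AE x in lebesgue_on {0..}. f x = g x" and "0 \<le> x"
  shows "f x = g x"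
proof -
  have c: "continuous_on {0..} f" "continuous_on {0..} g"
    by (rule primitive_imp_continuous[OF f], rule primitive_imp_continuous[OF g])
  have "continuous_on {0..x+1} (\<lambda>t. norm (f t - g t))"
    by (intro continuous_intros continuous_on_subset[OF c(1)] continuous_on_subset[OF c(2)]) auto
  moreover have "integral {0..x+1} (\<lambda>t. norm (f t - g t)) = 0"
  proof -
    have "AE t in lebesgue_on {0..}. norm (f t - g t) = 0" using ae by eventually_elim simp
    then have "integral {0..x+1} (\<lambda>t. norm (f t - g t)) = integral {0..x+1} (\<lambda>t. 0)"
      by (rule integral_cong_AE_halfline) simp
    then show ?thesis by simp
  qed
  ultimately have "\<forall>t\<in>{0..x+1}. norm (f t - g t) = 0"
    using integral_eq_0_iff[of 0 "x+1" "\<lambda>t. norm (f t - g t)"] \<open>0 \<le> x\<close> by auto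
  then show ?thesis using \<open>0 \<le> x\<close> by simp
qed

lemma compact_support_iff_bounded: "compact_support y \<longleftrightarrow> bounded {x \<in> {0..}. y x \<noteq> 0}"
  unfolding compact_support_def using compact_closure by blast

context dirac_system begin

lemma max_funs_sq:
  assumes "y \<in> max_funs J Q"
  shows "sq_integrable y" "sq_integrable (dirac_expr J Q y)"
  using assms by (auto simp: max_funs_def)

lemma max_funs_eq:
  assumes y: "y \<in> max_funs J Q" and z: "z \<in> max_funs J Q" and eq: "abs_L2 y = abs_L2 z"
  shows "y 0 = z 0" "abs_L2 (dirac_expr J Q y) = abs_L2 (dirac_expr J Q z)"
proof -
  note yp = max_funs_primitive[OF y] and zp = max_funs_primitive[OF z]
  have ae: "AE x in lebesgue_on {0..}. y x = z x"
    using abs_L2_eq_iff[OF max_funs_sq(1)[OF y] max_funs_sq(1)[OF z]] eq by simp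
  have pt: "y x = z x" if "0 \<le> x" for x
    by (rule primitive_eq_AE_imp_eq[OF yp zp ae that])
  then show "y 0 = z 0" by simp
  have zp': "primitive z (\<lambda>x. vector_derivative y (at x within {0..}))"
    using yp pt by (simp add: primitive_def)
  have "AE x in lebesgue_on {0..}. dirac_expr J Q y x = dirac_expr J Q z x"
    using dirac_expr_AE[OF yp] dirac_expr_AE[OF zp'] ae by eventually_elim simp
  then show "abs_L2 (dirac_expr J Q y) = abs_L2 (dirac_expr J Q z)"
    using abs_L2_eq_iff[OF max_funs_sq(2)[OF y] max_funs_sq(2)[OF z]] by simp
qed

lemma max_funs_add:
  assumes y: "y \<in> max_funs J Q" and z: "z \<in> max_funs J Q"
  shows "(\<lambda>x. y x + z x) \<in> max_funs J Q"
    "abs_L2 (dirac_expr J Q (\<lambda>x. y x + z x)) = abs_L2 (dirac_expr J Q y) + abs_L2 (dirac_expr J Q z)"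
proof -
  note p = primitive_add[OF max_funs_primitive[OF y] max_funs_primitive[OF z]]
  have "AE x in lebesgue_on {0..}. J *v (vector_derivative y (at x within {0..}) + vector_derivative z (at x within {0..}))
      + Q x *v (y x + z x) = dirac_expr J Q y x + dirac_expr J Q z x"
    by (simp add: dirac_expr_def matrix_vector_right_distrib)
  from max_funsI[OF p sq_integrable_add[OF max_funs_sq(1)[OF y] max_funs_sq(1)[OF z]]
      sq_integrable_add[OF max_funs_sq(2)[OF y] max_funs_sq(2)[OF z]] this]
  show "(\<lambda>x. y x + z x) \<in> max_funs J Q"
    "abs_L2 (dirac_expr J Q (\<lambda>x. y x + z x)) = abs_L2 (dirac_expr J Q y) + abs_L2 (dirac_expr J Q z)"
    by (auto simp: abs_L2_add max_funs_sq[OF y] max_funs_sq[OF z])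
qed

lemma max_funs_scale:
  assumes y: "y \<in> max_funs J Q"
  shows "(\<lambda>x. c *s y x) \<in> max_funs J Q"
    "abs_L2 (dirac_expr J Q (\<lambda>x. c *s y x)) = scaleL2 c (abs_L2 (dirac_expr J Q y))"
proof -
  have "bounded_linear ((*s) c :: complex^'n \<Rightarrow> _)"
    unfolding linear_conv_bounded_linear[symmetric]
    by (auto intro!: linearI simp: vec_eq_iff distrib_left)
  note p = primitive_bounded_linear[OF this max_funs_primitive[OF y]]
  have "AE x in lebesgue_on {0..}. J *v (c *s vector_derivative y (at x within {0..})) + Q x *v (c *s y x) = c *s dirac_expr J Q y x"
    by (simp add: dirac_expr_def vector_scalar_commute vec.scale_right_distrib)
  from max_funsI[OF p sq_integrable_scale[OF max_funs_sq(1)[OF y]] sq_integrable_scale[OF max_funs_sq(2)[OF y]] this]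
  show "(\<lambda>x. c *s y x) \<in> max_funs J Q"
    "abs_L2 (dirac_expr J Q (\<lambda>x. c *s y x)) = scaleL2 c (abs_L2 (dirac_expr J Q y))"
    by (auto simp: abs_L2_scale max_funs_sq[OF y])
qed

text \<open>
  The closure of the operator on these functions is \<open>D_theta0 J Q \<theta>\<close>.
\<close>
definition theta_core :: "(complex^'n) set \<Rightarrow> (real \<Rightarrow> complex^'n) set" where
  "theta_core \<theta> = {y \<in> max_funs J Q. y 0 \<in> \<theta> \<and> compact_support y}"

lemma theta_core_add:
  assumes "vec.subspace \<theta>" "y \<in> theta_core \<theta>" "z \<in> theta_core \<theta>"
  shows "(\<lambda>x. y x + z x) \<in> theta_core \<theta>"
proof -
  have "bounded ({x \<in> {0..}. y x \<noteq> 0} \<union> {x \<in> {0..}. z x \<noteq> 0})"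
    using assms by (simp add: theta_core_def compact_support_iff_bounded)
  then have "bounded {x \<in> {0..}. y x + z x \<noteq> 0}"
    by (rule bounded_subset) auto
  then show ?thesis
    using assms max_funs_add vec.subspace_add by (auto simp: theta_core_def compact_support_iff_bounded)
qed

lemma theta_core_scale:
  assumes "vec.subspace \<theta>" "y \<in> theta_core \<theta>"
  shows "(\<lambda>x. c *s y x) \<in> theta_core \<theta>"
proof -
  have "bounded {x \<in> {0..}. y x \<noteq> 0}"
    using assms by (simp add: theta_core_def compact_support_iff_bounded)
  then have "bounded {x \<in> {0..}. c *s y x \<noteq> 0}"
    by (rule bounded_subset) auto
  then show ?thesis
    using assms max_funs_scale vec.subspace_scale by (auto simp: theta_core_def compact_support_iff_bounded)
qed

lemma dirac_graph_add:
  assumes "Y \<subseteq> max_funs J Q" "\<And>y z. y \<in> Y \<Longrightarrow> z \<in> Y \<Longrightarrow> (\<lambda>x. y x + z x) \<in> Y"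
    and "(f, k) \<in> dirac_graph J Q Y" "(g, h) \<in> dirac_graph J Q Y"
  shows "(f + g, k + h) \<in> dirac_graph J Q Y"
proof -
  obtain y z where yz: "y \<in> Y" "z \<in> Y" "f = abs_L2 y" "k = abs_L2 (dirac_expr J Q y)" "g = abs_L2 z" "h = abs_L2 (dirac_expr J Q z)"
    using assms(3,4) by (auto simp: dirac_graph_def)
  then have m: "y \<in> max_funs J Q" "z \<in> max_funs J Q" using assms(1) by auto
  have "(f + g, k + h) = (abs_L2 (\<lambda>x. y x + z x), abs_L2 (dirac_expr J Q (\<lambda>x. y x + z x)))"
    using max_funs_add(2)[OF m] by (simp add: yz abs_L2_add max_funs_sq[OF m(1)] max_funs_sq[OF m(2)])
  then show ?thesis unfolding dirac_graph_def using assms(2)[OF yz(1,2)] by blast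
qed

lemma dirac_graph_scale:
  assumes "Y \<subseteq> max_funs J Q" "\<And>y. y \<in> Y \<Longrightarrow> (\<lambda>x. c *s y x) \<in> Y" and "(f, k) \<in> dirac_graph J Q Y"
  shows "(scaleL2 c f, scaleL2 c k) \<in> dirac_graph J Q Y"
proof -
  obtain y where y: "y \<in> Y" "f = abs_L2 y" "k = abs_L2 (dirac_expr J Q y)"
    using assms(3) by (auto simp: dirac_graph_def)
  then have m: "y \<in> max_funs J Q" using assms(1) by auto
  have "(scaleL2 c f, scaleL2 c k) = (abs_L2 (\<lambda>x. c *s y x), abs_L2 (dirac_expr J Q (\<lambda>x. c *s y x)))"
    using max_funs_scale(2)[OF m] by (simp add: y abs_L2_scale max_funs_sq[OF m])
  then show ?thesis unfolding dirac_graph_def using assms(2)[OF y(1)] by blast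
qed

lemma dirac_graph_zero:
  assumes "(\<lambda>x. 0) \<in> Y"
  shows "(0, 0) \<in> dirac_graph J Q Y"
proof -
  have "vector_derivative (\<lambda>x. 0 :: complex^'n) (at x within {0..}) = 0" if "0 \<le> x" for x :: real
    by (rule vector_derivative_within[OF nontrivial_at_within_halfline[OF that]]) simp
  then have ae: "AE x in lebesgue_on {0..}. 0 = dirac_expr J Q (\<lambda>x. 0) x"
    using AE_halfline_nonneg by (auto elim!: eventually_mono simp: dirac_expr_def)
  have "abs_L2 (dirac_expr J Q (\<lambda>x. 0)) = 0"
    using abs_L2_eq_iff[OF sq_integrable_zero sq_integrable_cong_AE[OF sq_integrable_zero ae]] ae by (simp add: zero_L2_def)
  then show ?thesis using assms unfolding dirac_graph_def zero_L2_def by force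
qed

lemma zero_max_funs: "(\<lambda>x. 0) \<in> max_funs J Q"
proof -
  obtain y where "y \<in> max_funs J Q" by (rule prescribed_initial_value[of 0])
  from max_funs_scale(1)[OF this, of 0] show ?thesis by simp
qed

lemma is_operator_D_theta:
  assumes "vec.subspace \<theta>"
  shows "is_operator (D_theta J Q \<theta>)"
proof -
  let ?Y = "{y \<in> max_funs J Q. y 0 \<in> \<theta>}"
  have add: "(\<lambda>x. y x + z x) \<in> ?Y" if "y \<in> ?Y" "z \<in> ?Y" for y z
    using that max_funs_add(1) vec.subspace_add[OF assms] by auto
  have scale: "(\<lambda>x. c *s y x) \<in> ?Y" if "y \<in> ?Y" for y c
    using that max_funs_scale(1) vec.subspace_scale[OF assms] by auto
  have "single_valued (D_theta J Q \<theta>)"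
  proof (rule single_valuedI)
    fix f k h assume "(f, k) \<in> D_theta J Q \<theta>" "(f, h) \<in> D_theta J Q \<theta>"
    then obtain y z where "y \<in> max_funs J Q" "f = abs_L2 y" "k = abs_L2 (dirac_expr J Q y)"
      "z \<in> max_funs J Q" "f = abs_L2 z" "h = abs_L2 (dirac_expr J Q z)"
      unfolding D_theta_def dirac_graph_def by blast
    then show "k = h" using max_funs_eq(2)[of y z] by simp
  qed
  moreover have "(0, 0) \<in> D_theta J Q \<theta>"
    unfolding D_theta_def by (rule dirac_graph_zero) (use zero_max_funs vec.subspace_0[OF assms] in simp)
  moreover have "(f + g, k + h) \<in> D_theta J Q \<theta>"
    if "(f, k) \<in> D_theta J Q \<theta>" "(g, h) \<in> D_theta J Q \<theta>" for f k g h
    using that unfolding D_theta_def by (intro dirac_graph_add[of ?Y] add) auto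
  moreover have "(scaleL2 c f, scaleL2 c k) \<in> D_theta J Q \<theta>" if "(f, k) \<in> D_theta J Q \<theta>" for c f k
    using that unfolding D_theta_def by (intro dirac_graph_scale[of ?Y] scale) auto
  ultimately show ?thesis unfolding is_operator_def by blast
qed

lemma mem_D_theta_iff:
  assumes "y \<in> max_funs J Q"
  shows "(abs_L2 y, abs_L2 (dirac_expr J Q y)) \<in> D_theta J Q \<theta> \<longleftrightarrow> y 0 \<in> \<theta>"
proof
  assume "(abs_L2 y, abs_L2 (dirac_expr J Q y)) \<in> D_theta J Q \<theta>"
  then obtain z where z: "z \<in> max_funs J Q" "z 0 \<in> \<theta>" "abs_L2 y = abs_L2 z"
    unfolding D_theta_def dirac_graph_def by blast
  then show "y 0 \<in> \<theta>" using max_funs_eq(1)[OF assms z(1,3)] by simp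
next
  assume "y 0 \<in> \<theta>"
  then show "(abs_L2 y, abs_L2 (dirac_expr J Q y)) \<in> D_theta J Q \<theta>"
    using assms unfolding D_theta_def dirac_graph_def by blast
qed

lemma green_pairing:
  assumes "vec.subspace \<theta>" "(f, k) \<in> D_theta J Q \<theta>" "(g, h) \<in> D_theta J Qs (theta_cross J \<theta>)"
  shows "cinner k g = cinner f h"
proof -
  obtain y where y: "y \<in> max_funs J Q" "y 0 \<in> \<theta>" "f = abs_L2 y" "k = abs_L2 (dirac_expr J Q y)"
    using assms(2) by (auto simp: D_theta_def dirac_graph_def)
  obtain z where z: "z \<in> max_funs J Qs" "z 0 \<in> theta_cross J \<theta>" "g = abs_L2 z" "h = abs_L2 (dirac_expr J Qs z)"
    using assms(3) by (auto simp: D_theta_def dirac_graph_def)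
  have "cdot (z 0) (J *v y 0) = 0" using z(2) y(2) by (auto simp: theta_cross_def)
  then have "cdot (J *v y 0) (z 0) = 0" by (subst cdot_commute) simp
  then show ?thesis using green_formula[OF y(1) z(1)] y z by simp
qed

lemma theta_core_subset: "dirac_graph J Q (theta_core \<theta>) \<subseteq> D_theta J Q \<theta>"
  unfolding D_theta_def dirac_graph_def theta_core_def by auto

text \<open>
  An element of the adjoint of the smaller operator comes from some \<open>z\<close> in the maximal domain, and Green's
  formula with functions of compact support and arbitrary initial value \<open>u\<close> in \<open>\<theta>\<close> puts \<open>z(0)\<close> into
  \<open>\<theta>\<^sup>\<times>\<close>.  Conversely, the boundary term vanishes for such \<open>z\<close>.
\<close>
lemma adj_theta_core:
  assumes "vec.subspace \<theta>"
  shows "adj (dirac_graph J Q (theta_core \<theta>)) = D_theta J Qs (theta_cross J \<theta>)"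
    and "adj (D_theta J Q \<theta>) = D_theta J Qs (theta_cross J \<theta>)"
proof -
  interpret adj: dirac_system J Qs by (rule adjoint_system)
  have 1: "D_theta J Qs (theta_cross J \<theta>) \<subseteq> adj (D_theta J Q \<theta>)"
    using green_pairing[OF assms] by (auto simp: adj_def)
  have 2: "adj (D_theta J Q \<theta>) \<subseteq> adj (dirac_graph J Q (theta_core \<theta>))"
    by (rule adj_antimono[OF theta_core_subset])
  have 3: "adj (dirac_graph J Q (theta_core \<theta>)) \<subseteq> D_theta J Qs (theta_cross J \<theta>)"
  proof clarify
    fix g h assume gh: "(g, h) \<in> adj (dirac_graph J Q (theta_core \<theta>))"
    have "dirac_graph J Q {y \<in> max_funs J Q. compact_support y \<and> y 0 = 0} \<subseteq> dirac_graph J Q (theta_core \<theta>)"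
      unfolding dirac_graph_def theta_core_def using vec.subspace_0[OF assms] by auto
    from adj_antimono[OF this] gh have "(g, h) \<in> D_max J Qs"
      using adjoint_of_compactly_supported by blast
    then obtain z where z: "z \<in> max_funs J Qs" "g = abs_L2 z" "h = abs_L2 (dirac_expr J Qs z)"
      by (auto simp: D_max_def dirac_graph_def)
    have "cdot (z 0) (J *v u) = 0" if "u \<in> \<theta>" for u
    proof -
      obtain y where y: "y \<in> max_funs J Q" "compact_support y" "y 0 = u" by (rule prescribed_initial_value)
      then have "(abs_L2 y, abs_L2 (dirac_expr J Q y)) \<in> dirac_graph J Q (theta_core \<theta>)"
        using that unfolding dirac_graph_def theta_core_def by auto
      then have "cinner (abs_L2 (dirac_expr J Q y)) g = cinner (abs_L2 y) h" using gh by (auto simp: adj_def)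
      then have "cdot (J *v u) (z 0) = 0" using green_formula[OF y(1) z(1)] y(3) z by simp
      then show ?thesis by (subst cdot_commute) simp
    qed
    then have "z 0 \<in> theta_cross J \<theta>" by (auto simp: theta_cross_def)
    then show "(g, h) \<in> D_theta J Qs (theta_cross J \<theta>)" using z by (auto simp: D_theta_def dirac_graph_def)
  qed
  show "adj (dirac_graph J Q (theta_core \<theta>)) = D_theta J Qs (theta_cross J \<theta>)"
    "adj (D_theta J Q \<theta>) = D_theta J Qs (theta_cross J \<theta>)" using 1 2 3 by blast+
qed

text \<open>
  Since \<open>\<theta>\<^sup>\<times>\<^sup>\<times> = \<theta>\<close>, this operator is itself an adjoint.
\<close>
lemma closed_D_theta:
  assumes "vec.subspace \<theta>"
  shows "closed (D_theta J Q \<theta>)"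
proof -
  interpret adj: dirac_system J Qs by (rule adjoint_system)
  have "adj (D_theta J Qs (theta_cross J \<theta>)) = D_theta J Q \<theta>"
    using adj.adj_theta_core(2)[OF subspace_theta_cross] theta_cross_involutive[OF assms] by simp
  then show ?thesis using closed_adj by metis
qed

text \<open>
  If \<open>(a, b)\<close> is orthogonal to the graph of the restriction, then \<open>(b, - a)\<close> belongs to its adjoint, which
  is also the adjoint of \<open>D_theta J Q \<theta>\<close>.  So \<open>(a, b)\<close> is orthogonal to the larger graph as well, and no point of
  the latter can be separated from the closure of the former.
\<close>
lemma closure_theta_core:
  assumes \<theta>: "vec.subspace \<theta>"
  shows "closure (dirac_graph J Q (theta_core \<theta>)) = D_theta J Q \<theta>"
proof
  let ?A = "dirac_graph J Q (theta_core \<theta>)"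
  show "closure ?A \<subseteq> D_theta J Q \<theta>"
    by (rule closure_minimal[OF theta_core_subset closed_D_theta[OF \<theta>]])
  show "D_theta J Q \<theta> \<subseteq> closure ?A"
  proof (rule subsetI, rule ccontr)
    fix x assume x: "x \<in> D_theta J Q \<theta>" "x \<notin> closure ?A"
    have sub: "theta_core \<theta> \<subseteq> max_funs J Q" by (auto simp: theta_core_def)
    have scale: "(scaleL2 c f, scaleL2 c k) \<in> ?A" if "(f, k) \<in> ?A" for c f k
      by (rule dirac_graph_scale[OF sub theta_core_scale[OF \<theta>] that])
    have "subspace ?A"
    proof (rule subspaceI)
      have "(\<lambda>x. 0) \<in> theta_core \<theta>"
        using zero_max_funs vec.subspace_0[OF \<theta>] by (simp add: theta_core_def compact_support_iff_bounded)
      then show "0 \<in> ?A" unfolding zero_prod_def by (rule dirac_graph_zero)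
      show "u + v \<in> ?A" if "u \<in> ?A" "v \<in> ?A" for u v
        unfolding plus_prod_def
        by (rule dirac_graph_add[OF sub theta_core_add[OF \<theta>]]) (use that in simp_all)
      show "c *\<^sub>R u \<in> ?A" if "u \<in> ?A" for c u
        unfolding scaleR_prod_def scaleR_L2_def by (rule scale) (use that in simp)
    qed
    then obtain w where w: "\<And>m. m \<in> ?A \<Longrightarrow> inner m w = 0" "inner x w \<noteq> 0"
      using orthogonal_separation[OF _ x(2)] by blast
    obtain a b where ab: "w = (a, b)" by (cases w)
    have "cinner k b = cinner f (- a)" if fk: "(f, k) \<in> ?A" for f k
    proof -
      have "inner f a + inner k b = 0" using w(1)[OF fk] by (simp add: ab inner_prod_def)
      moreover have "inner (scaleL2 (- \<i>) f) a + inner (scaleL2 (- \<i>) k) b = 0"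
        using w(1)[OF scale[OF fk, of "- \<i>"]] unfolding ab inner_prod_def fst_conv snd_conv .
      ultimately show ?thesis unfolding cinner_eq_iff_inner inner_minus_right by linarith
    qed
    then have "(b, - a) \<in> adj ?A" by (auto simp: adj_def)
    then have "(b, - a) \<in> adj (D_theta J Q \<theta>)" by (simp add: adj_theta_core[OF \<theta>])
    then have "cinner (snd x) b = cinner (fst x) (- a)"
      using x(1) unfolding adj_def by (auto split: prod.splits)
    then have "inner (snd x) b = inner (fst x) (- a)" unfolding cinner_eq_iff_inner by simp
    then show False using w(2) by (simp add: ab inner_prod_def)
  qed
qed

lemma D_theta0_eq: "vec.subspace \<theta> \<Longrightarrow> D_theta0 J Q \<theta> = D_theta J Q \<theta>"
  using closure_theta_core by (simp add: D_theta0_def theta_core_def)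

lemma D_min_eq: "D_min J Q = D_theta J Q {0}"
proof -
  have "{y \<in> max_funs J Q. compact_support y \<and> y 0 = 0} = theta_core {0}"
    by (auto simp: theta_core_def)
  then show ?thesis using closure_theta_core[of "{0}"] by (simp add: D_min_def vec.subspace_0 vec.subspace_def)
qed

end

section \<open>Proper extensions and their codimension\<close>

text \<open>
  In this situation \<open>\<tau>\<close> induces an isomorphism of \<open>V / W\<close> onto the finite dimensional space \<open>\<theta>\<close>, so that
  bases modulo \<open>W\<close> correspond to bases of \<open>\<theta>\<close>.
\<close>
locale quotient_map =
  fixes V W :: "('n::finite) L2 set" and \<tau> :: "'n L2 \<Rightarrow> complex^'n" and \<theta> :: "(complex^'n) set"
  assumes V: "L2.subspace V"
    and add: "\<And>u v. u \<in> V \<Longrightarrow> v \<in> V \<Longrightarrow> \<tau> (u + v) = \<tau> u + \<tau> v"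
    and scale: "\<And>c u. u \<in> V \<Longrightarrow> \<tau> (scaleL2 c u) = c *s \<tau> u"
    and W: "W = {v \<in> V. \<tau> v = 0}"
    and image: "\<tau> ` V = \<theta>"
begin

lemma zero: "\<tau> 0 = 0"
  using scale[OF L2.subspace_0[OF V], of 0] by simp

lemma sum_in_V: "F \<subseteq> V \<Longrightarrow> (\<Sum>v\<in>F. scaleL2 (c v) v) \<in> V"
  by (rule L2.subspace_sum[OF V]) (auto intro: L2.subspace_scale[OF V])

lemma sum_eq:
  assumes "finite F" "F \<subseteq> V"
  shows "\<tau> (\<Sum>v\<in>F. scaleL2 (c v) v) = (\<Sum>v\<in>F. c v *s \<tau> v)"
  using assms
proof (induction F)
  case (insert x F)
  then have "scaleL2 (c x) x \<in> V" "(\<Sum>v\<in>F. scaleL2 (c v) v) \<in> V" "x \<in> V"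
    by (auto intro: L2.subspace_scale[OF V] sum_in_V)
  then show ?case using insert by (simp add: add scale)
qed (simp add: zero)

lemma sum_mem_W_iff:
  assumes "finite F" "F \<subseteq> V"
  shows "(\<Sum>v\<in>F. scaleL2 (c v) v) \<in> W \<longleftrightarrow> (\<Sum>v\<in>F. c v *s \<tau> v) = 0"
  using sum_in_V[OF assms(2), of c] sum_eq[OF assms, of c] by (simp add: W)

lemma basis_mod_card:
  assumes S: "basis_mod V W S"
  shows "finite S" "card S = vec.dim \<theta>"
proof -
  have SV: "S \<subseteq> V" and ind: "\<And>F c v. finite F \<Longrightarrow> F \<subseteq> S \<Longrightarrow> (\<Sum>v\<in>F. scaleL2 (c v) v) \<in> W \<Longrightarrow> v \<in> F \<Longrightarrow> c v = 0"
    and span: "\<And>v. v \<in> V \<Longrightarrow> \<exists>s\<in>L2.span S. v - s \<in> W"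
    using S by (auto simp: basis_mod_def)
  have inj: "inj_on \<tau> S"
  proof (rule inj_onI, rule ccontr)
    fix s t assume st: "s \<in> S" "t \<in> S" "\<tau> s = \<tau> t" "s \<noteq> t"
    \<comment> \<open>If \<open>\<tau>\<close> identified \<open>s\<close> and \<open>t\<close>, the combination \<open>s - t\<close> would lie in \<open>W\<close>.\<close>
    define c where "c v = (if v = s then 1 else - 1 :: complex)" for v
    have "(\<Sum>v\<in>{s, t}. c v *s \<tau> v) = 0" using st by (simp add: c_def)
    then have "(\<Sum>v\<in>{s, t}. scaleL2 (c v) v) \<in> W"
      using st SV by (subst sum_mem_W_iff) auto
    then have "c s = 0" using st by (intro ind[of "{s, t}" c s]) auto
    then show False by (simp add: c_def)
  qed
  have indep: "vec.independent (\<tau> ` S)"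
    unfolding vec.independent_explicit_module
  proof (intro allI impI)
    fix T u w assume T: "finite T" "T \<subseteq> \<tau> ` S" "(\<Sum>v\<in>T. u v *s v) = 0" "w \<in> T"
    obtain F where F: "F \<subseteq> S" "finite F" "T = \<tau> ` F" using finite_subset_image[OF T(1,2)] by blast
    have "(\<Sum>v\<in>F. u (\<tau> v) *s \<tau> v) = 0"
      using T(3) unfolding F(3) by (subst (asm) sum.reindex[OF inj_on_subset[OF inj F(1)]]) (simp add: o_def)
    then have "(\<Sum>v\<in>F. scaleL2 (u (\<tau> v)) v) \<in> W"
      using F SV by (subst sum_mem_W_iff) auto
    moreover obtain v where "v \<in> F" "w = \<tau> v" using T(4) F(3) by blast
    ultimately show "u w = 0" using ind[OF F(2,1), of "\<lambda>v. u (\<tau> v)" v] by simp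
  qed
  have fin: "finite (\<tau> ` S)" by (rule vec.finiteI_independent[OF indep])
  then show "finite S" using inj by (rule finite_imageD)
  have spanS: "s \<in> V \<and> \<tau> s \<in> vec.span (\<tau> ` S)" if "s \<in> L2.span S" for s
    using that
  proof (induction rule: L2.span_induct_alt)
    case base
    then show ?case using zero L2.subspace_0[OF V] vec.span_zero by auto
  next
    case (step c x y)
    then have "x \<in> V" "scaleL2 c x \<in> V" using SV by (auto intro: L2.subspace_scale[OF V])
    moreover from this step have "\<tau> (scaleL2 c x + y) = c *s \<tau> x + \<tau> y" by (simp add: add scale)
    ultimately show ?case
      using step by (simp add: L2.subspace_add[OF V] vec.span_add vec.span_scale vec.span_base)
  qed
  have "\<theta> \<subseteq> vec.span (\<tau> ` S)"
  proof
    fix w assume "w \<in> \<theta>"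
    then obtain v where v: "v \<in> V" "w = \<tau> v" using image by blast
    obtain s where s: "s \<in> L2.span S" "v - s \<in> W" using span[OF v(1)] by blast
    have "\<tau> v = \<tau> (v - s) + \<tau> s"
      using add[of "v - s" s] s spanS[OF s(1)] by (simp add: W)
    then show "w \<in> vec.span (\<tau> ` S)" using s spanS[OF s(1)] v(2) by (simp add: W)
  qed
  moreover have "\<tau> ` S \<subseteq> \<theta>" using SV image by blast
  ultimately have "vec.dim \<theta> = card (\<tau> ` S)"
    using indep by (metis vec.basis_card_eq_dim)
  then show "card S = vec.dim \<theta>" using card_image[OF inj] by simp
qed

lemma basis_mod_exists:
  obtains S where "basis_mod V W S"
proof -
  obtain B where B: "B \<subseteq> \<theta>" "vec.independent B" "\<theta> \<subseteq> vec.span B"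
    by (rule vec.basis_exists[of \<theta>]) blast
  have finB: "finite B" by (rule vec.finiteI_independent[OF B(2)])
  have "\<forall>b\<in>B. \<exists>v. v \<in> V \<and> \<tau> v = b" using B(1) image by blast
  then obtain \<sigma> where \<sigma>: "\<And>b. b \<in> B \<Longrightarrow> \<sigma> b \<in> V" "\<And>b. b \<in> B \<Longrightarrow> \<tau> (\<sigma> b) = b" by metis
  have SV: "\<sigma> ` B \<subseteq> V" using \<sigma>(1) by blast
  have "basis_mod V W (\<sigma> ` B)"
    unfolding basis_mod_def
  proof (intro conjI allI impI ballI)
    show "\<sigma> ` B \<subseteq> V" by (rule SV)
    fix F c v assume F: "finite F" "F \<subseteq> \<sigma> ` B" "(\<Sum>v\<in>F. scaleL2 (c v) v) \<in> W" "v \<in> F"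
    have sig: "\<sigma> (\<tau> w) = w" if "w \<in> F" for w
    proof -
      obtain b where "b \<in> B" "w = \<sigma> b" using F(2) \<open>w \<in> F\<close> by blast
      then show ?thesis by (simp add: \<sigma>(2))
    qed
    have inj: "inj_on \<tau> F" by (rule inj_on_inverseI) (rule sig)
    have FV: "F \<subseteq> V" using F(2) SV by (rule order_trans)
    have "(\<Sum>v\<in>F. c v *s \<tau> v) = 0" using F(3) unfolding sum_mem_W_iff[OF F(1) FV] .
    then have "(\<Sum>b\<in>\<tau> ` F. c (\<sigma> b) *s b) = 0"
      by (subst sum.reindex[OF inj]) (simp add: o_def sig)
    moreover have "\<tau> ` F \<subseteq> B"
    proof (rule image_subsetI)
      fix w assume "w \<in> F"
      then obtain b where "b \<in> B" "w = \<sigma> b" using F(2) by blast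
      then show "\<tau> w \<in> B" by (simp add: \<sigma>(2))
    qed
    moreover have "finite (\<tau> ` F)" "\<tau> v \<in> \<tau> ` F" using F(1,4) by auto
    ultimately have "c (\<sigma> (\<tau> v)) = 0"
      using B(2)[unfolded vec.independent_explicit_module, rule_format, of "\<tau> ` F" "\<lambda>b. c (\<sigma> b)" "\<tau> v"] by simp
    then show "c v = 0" using sig[OF F(4)] by simp
  next
    fix v assume v: "v \<in> V"
    then have "\<tau> v \<in> vec.span B" using B(3) image by blast
    then obtain u where u: "\<tau> v = (\<Sum>b\<in>B. u b *s b)" unfolding vec.span_finite[OF finB] by blast
    define s where "s = (\<Sum>b\<in>B. scaleL2 (u b) (\<sigma> b))"
    have "s \<in> L2.span (\<sigma> ` B)"
      unfolding s_def by (intro L2.span_sum L2.span_scale L2.span_base) simp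
    moreover have "v - s \<in> W"
    proof -
      have inj: "inj_on \<sigma> B" by (rule inj_on_inverseI) (rule \<sigma>(2))
      have s: "s = (\<Sum>x\<in>\<sigma> ` B. scaleL2 (u (\<tau> x)) x)"
        unfolding s_def by (subst sum.reindex[OF inj]) (simp add: o_def \<sigma>(2))
      have sV: "s \<in> V" unfolding s by (rule sum_in_V[OF SV])
      have "\<tau> s = (\<Sum>x\<in>\<sigma> ` B. u (\<tau> x) *s \<tau> x)"
        unfolding s by (rule sum_eq) (use finB SV in auto)
      also have "\<dots> = (\<Sum>b\<in>B. u b *s b)" by (subst sum.reindex[OF inj]) (simp add: o_def \<sigma>(2))
      finally have "\<tau> s = \<tau> v" using u by simp
      moreover have "v + scaleL2 (- 1) s = v - s" by simp
      then have "\<tau> (v - s) = \<tau> v - \<tau> s"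
        using add[OF v L2.subspace_scale[OF V sV, of "- 1"]] scale[OF sV, of "- 1"] by simp
      ultimately show ?thesis using v sV L2.subspace_diff[OF V] by (simp add: W)
    qed
    ultimately show "\<exists>s\<in>L2.span (\<sigma> ` B). v - s \<in> W" by blast
  qed
  then show thesis by (rule that)
qed

end

lemma same_quotient_dim_iff:
  assumes "quotient_map V W \<tau> \<theta>" "quotient_map V' W' \<tau>' \<theta>'"
  shows "same_quotient_dim V W V' W' \<longleftrightarrow> vec.dim \<theta> = vec.dim \<theta>'"
proof -
  interpret a: quotient_map V W \<tau> \<theta> by fact
  interpret b: quotient_map V' W' \<tau>' \<theta>' by fact
  show ?thesis
  proof
    assume "same_quotient_dim V W V' W'"
    then obtain S S' where "basis_mod V W S" "basis_mod V' W' S'" "S \<approx> S'"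
      unfolding same_quotient_dim_def by blast
    then show "vec.dim \<theta> = vec.dim \<theta>'"
      using a.basis_mod_card b.basis_mod_card eqpoll_iff_card by metis
  next
    assume eq: "vec.dim \<theta> = vec.dim \<theta>'"
    obtain S where S: "basis_mod V W S" by (rule a.basis_mod_exists)
    obtain S' where S': "basis_mod V' W' S'" by (rule b.basis_mod_exists)
    have "S \<approx> S'"
      using a.basis_mod_card[OF S] b.basis_mod_card[OF S'] eq eqpoll_iff_card by metis
    then show "same_quotient_dim V W V' W'" using S S' unfolding same_quotient_dim_def by blast
  qed
qed

context dirac_system begin

text \<open>
  An element of the maximal domain determines its continuous representative, so the choice is
  irrelevant there; elsewhere the value is arbitrary.
\<close>
definition initial_value :: "'n L2 \<Rightarrow> complex^'n" where
  "initial_value f = (SOME v. \<exists>y\<in>max_funs J Q. f = abs_L2 y \<and> y 0 = v)"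

lemma initial_value_abs:
  assumes "y \<in> max_funs J Q"
  shows "initial_value (abs_L2 y) = y 0"
proof -
  have "\<exists>z\<in>max_funs J Q. abs_L2 y = abs_L2 z \<and> z 0 = initial_value (abs_L2 y)"
    unfolding initial_value_def by (rule someI[of _ "y 0"]) (use assms in blast)
  then obtain z where "z \<in> max_funs J Q" "abs_L2 y = abs_L2 z" "z 0 = initial_value (abs_L2 y)" by blast
  then show ?thesis using max_funs_eq(1)[OF assms] by metis
qed

lemma Domain_D_theta: "Domain (D_theta J Q \<theta>) = abs_L2 ` {y \<in> max_funs J Q. y 0 \<in> \<theta>}"
  by (auto simp: D_theta_def dirac_graph_def)

text \<open>
  The initial value is onto \<open>\<theta>\<close> because all initial values occur, and its kernel is the domain of the
  minimal operator because that operator is \<open>D_theta J Q {0}\<close>.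
\<close>
lemma quotient_map_initial_value:
  assumes \<theta>: "vec.subspace \<theta>"
  shows "quotient_map (Domain (D_theta J Q \<theta>)) (Domain (D_min J Q)) initial_value \<theta>"
proof
  let ?V = "Domain (D_theta J Q \<theta>)"
  have elem: "\<exists>y. y \<in> max_funs J Q \<and> y 0 \<in> \<theta> \<and> u = abs_L2 y" if "u \<in> ?V" for u
    using that unfolding Domain_D_theta by blast
  show "L2.subspace ?V"
    using is_operator_D_theta[OF \<theta>] unfolding L2.subspace_def is_operator_def by blast
  show "initial_value (u + v) = initial_value u + initial_value v" if u: "u \<in> ?V" and v: "v \<in> ?V" for u v
  proof -
    obtain y z where y: "y \<in> max_funs J Q" "u = abs_L2 y" and z: "z \<in> max_funs J Q" "v = abs_L2 z"
      using elem[OF u] elem[OF v] by blast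
    have "u + v = abs_L2 (\<lambda>x. y x + z x)"
      by (simp add: y z abs_L2_add max_funs_sq[OF y(1)] max_funs_sq[OF z(1)])
    then show ?thesis by (simp add: initial_value_abs max_funs_add(1) y z)
  qed
  show "initial_value (scaleL2 c u) = c *s initial_value u" if u: "u \<in> ?V" for c u
  proof -
    obtain y where y: "y \<in> max_funs J Q" "u = abs_L2 y" using elem[OF u] by blast
    have "scaleL2 c u = abs_L2 (\<lambda>x. c *s y x)" by (simp add: y abs_L2_scale max_funs_sq[OF y(1)])
    then show ?thesis by (simp add: initial_value_abs max_funs_scale(1) y)
  qed
  show "Domain (D_min J Q) = {v \<in> ?V. initial_value v = 0}"
    unfolding D_min_eq Domain_D_theta using initial_value_abs vec.subspace_0[OF \<theta>] by force
  show "initial_value ` ?V = \<theta>"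
  proof
    show "initial_value ` ?V \<subseteq> \<theta>" unfolding Domain_D_theta using initial_value_abs by force
    show "\<theta> \<subseteq> initial_value ` ?V"
    proof
      fix v assume v: "v \<in> \<theta>"
      obtain y where y: "y \<in> max_funs J Q" "y 0 = v" by (rule prescribed_initial_value)
      have "abs_L2 y \<in> ?V" unfolding Domain_D_theta using y v by blast
      then show "v \<in> initial_value ` ?V" using initial_value_abs[OF y(1)] y(2) by (metis imageI)
    qed
  qed
qed

lemma D_theta_mono_iff:
  "D_theta J Q \<theta> \<subseteq> D_theta J Q \<theta>' \<longleftrightarrow> \<theta> \<subseteq> \<theta>'"
proof
  assume sub: "D_theta J Q \<theta> \<subseteq> D_theta J Q \<theta>'"
  show "\<theta> \<subseteq> \<theta>'"
  proof
    fix v assume v: "v \<in> \<theta>"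
    obtain y where y: "y \<in> max_funs J Q" "y 0 = v" by (rule prescribed_initial_value)
    have "(abs_L2 y, abs_L2 (dirac_expr J Q y)) \<in> D_theta J Q \<theta>" using mem_D_theta_iff[OF y(1)] y(2) v by simp
    then show "v \<in> \<theta>'" using sub mem_D_theta_iff[OF y(1)] y(2) by blast
  qed
next
  assume "\<theta> \<subseteq> \<theta>'" then show "D_theta J Q \<theta> \<subseteq> D_theta J Q \<theta>'"
    unfolding D_theta_def dirac_graph_def by blast
qed

lemma subspace_zero: "vec.subspace ({0} :: (complex^'n) set)"
  by (simp add: vec.subspace_def)

lemma adj_D_min: "adj (D_min J Q) = D_theta J Qs UNIV"
  unfolding D_min_eq using adj_theta_core(2)[OF subspace_zero] theta_cross_zero by simp

lemma D_theta_mem_Ext: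
  assumes "vec.subspace \<theta>"
  shows "D_theta J Q \<theta> \<in> Ext (D_min J Q) (D_min J Qs)"
proof -
  interpret adj: dirac_system J Qs by (rule adjoint_system)
  have "D_min J Q \<subseteq> D_theta J Q \<theta>"
    unfolding D_min_eq D_theta_mono_iff using vec.subspace_0[OF assms] by simp
  moreover have "D_theta J Q \<theta> \<subseteq> adj (D_min J Qs)"
    using adj.adj_D_min D_theta_mono_iff by simp
  ultimately show ?thesis using is_operator_D_theta[OF assms] by (simp add: Ext_def)
qed

text \<open>
  Let \<open>\<theta>\<close> be the set of initial values of elements of \<open>T\<close>.  An element of the maximal operator with initial
  value in \<open>\<theta>\<close> differs from an element of \<open>T\<close> by an element of the minimal operator, which \<open>T\<close> contains.
\<close>
lemma Ext_imp_D_theta: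
  assumes T: "T \<in> Ext (D_min J Q) (D_min J Qs)"
  shows "\<exists>\<theta>. vec.subspace \<theta> \<and> T = D_theta J Q \<theta>"
proof -
  interpret adj: dirac_system J Qs by (rule adjoint_system)
  define \<theta> where "\<theta> = {y 0 |y. y \<in> max_funs J Q \<and> (abs_L2 y, abs_L2 (dirac_expr J Q y)) \<in> T}"
  have op: "is_operator T" and min: "D_min J Q \<subseteq> T" and max: "T \<subseteq> D_theta J Q UNIV"
    using T adj.adj_D_min by (auto simp: Ext_def)
  have Tadd: "(f + g, k + h) \<in> T" if "(f, k) \<in> T" "(g, h) \<in> T" for f k g h
    using op that unfolding is_operator_def by blast
  have Tscale: "(scaleL2 c f, scaleL2 c k) \<in> T" if "(f, k) \<in> T" for c f k
    using op that unfolding is_operator_def by blast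
  have add: "(abs_L2 (\<lambda>x. y x + z x), abs_L2 (dirac_expr J Q (\<lambda>x. y x + z x))) \<in> T"
    if y: "y \<in> max_funs J Q" "(abs_L2 y, abs_L2 (dirac_expr J Q y)) \<in> T"
      and z: "z \<in> max_funs J Q" "(abs_L2 z, abs_L2 (dirac_expr J Q z)) \<in> T" for y z
    using Tadd[OF y(2) z(2)] unfolding max_funs_add(2)[OF y(1) z(1)] abs_L2_add[OF max_funs_sq(1)[OF y(1)] max_funs_sq(1)[OF z(1)]] .
  have scale: "(abs_L2 (\<lambda>x. c *s y x), abs_L2 (dirac_expr J Q (\<lambda>x. c *s y x))) \<in> T"
    if y: "y \<in> max_funs J Q" "(abs_L2 y, abs_L2 (dirac_expr J Q y)) \<in> T" for c y
    using Tscale[OF y(2)] unfolding max_funs_scale(2)[OF y(1)] abs_L2_scale[OF max_funs_sq(1)[OF y(1)]] .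
  have minT: "(abs_L2 y, abs_L2 (dirac_expr J Q y)) \<in> T" if "y \<in> max_funs J Q" "y 0 = 0" for y
    using min mem_D_theta_iff[OF that(1), of "{0}"] that(2) unfolding D_min_eq by blast
  have "vec.subspace \<theta>"
    unfolding vec.subspace_def
  proof (intro conjI ballI allI)
    show "0 \<in> \<theta>" using minT[OF zero_max_funs] zero_max_funs unfolding \<theta>_def by force
    fix u assume "u \<in> \<theta>"
    then obtain y where y: "y \<in> max_funs J Q" "(abs_L2 y, abs_L2 (dirac_expr J Q y)) \<in> T" "u = y 0"
      unfolding \<theta>_def by blast
    show "c *s u \<in> \<theta>" for c using scale[OF y(1,2), of c] max_funs_scale(1)[OF y(1), of c] y(3) unfolding \<theta>_def by force
    fix v assume "v \<in> \<theta>"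
    then obtain z where z: "z \<in> max_funs J Q" "(abs_L2 z, abs_L2 (dirac_expr J Q z)) \<in> T" "v = z 0"
      unfolding \<theta>_def by blast
    show "u + v \<in> \<theta>" using add[OF y(1,2) z(1,2)] max_funs_add(1)[OF y(1) z(1)] y(3) z(3) unfolding \<theta>_def by force
  qed
  moreover have "T = D_theta J Q \<theta>"
  proof
    show "T \<subseteq> D_theta J Q \<theta>"
    proof clarify
      fix f k assume fk: "(f, k) \<in> T"
      then obtain y where y: "y \<in> max_funs J Q" "f = abs_L2 y" "k = abs_L2 (dirac_expr J Q y)"
        using max unfolding D_theta_def dirac_graph_def by blast
      then have "y 0 \<in> \<theta>" using fk unfolding \<theta>_def by blast
      then show "(f, k) \<in> D_theta J Q \<theta>" using mem_D_theta_iff[OF y(1)] y(2,3) by simp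
    qed
    show "D_theta J Q \<theta> \<subseteq> T"
    proof clarify
      fix f k assume "(f, k) \<in> D_theta J Q \<theta>"
      then obtain y where y: "y \<in> max_funs J Q" "y 0 \<in> \<theta>" "f = abs_L2 y" "k = abs_L2 (dirac_expr J Q y)"
        unfolding D_theta_def dirac_graph_def by blast
      obtain z where z: "z \<in> max_funs J Q" "(abs_L2 z, abs_L2 (dirac_expr J Q z)) \<in> T" "y 0 = z 0"
        using y(2) unfolding \<theta>_def by blast
      \<comment> \<open>Decompose \<open>y = (y - z) + z\<close>, where \<open>y - z\<close> vanishes at the origin.\<close>
      note mz = max_funs_scale(1)[OF z(1), of "- 1"]
      have "(abs_L2 (\<lambda>x. y x + - 1 *s z x), abs_L2 (dirac_expr J Q (\<lambda>x. y x + - 1 *s z x))) \<in> T"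
        by (rule minT[OF max_funs_add(1)[OF y(1) mz]]) (simp add: z(3))
      from add[OF max_funs_add(1)[OF y(1) mz] this z(1,2)] show "(f, k) \<in> T" by (simp add: y)
    qed
  qed
  ultimately show ?thesis by blast
qed

lemma D_theta_bij_Ext: "bij_betw (D_theta J Q) {\<theta>. vec.subspace \<theta>} (Ext (D_min J Q) (D_min J Qs))"
  unfolding bij_betw_def
proof
  show "inj_on (D_theta J Q) {\<theta>. vec.subspace \<theta>}"
    by (rule inj_onI) (metis D_theta_mono_iff order_refl subset_antisym)
  show "D_theta J Q ` {\<theta>. vec.subspace \<theta>} = Ext (D_min J Q) (D_min J Qs)"
    using D_theta_mem_Ext Ext_imp_D_theta by blast
qed

text \<open>
  The two codimensions are the dimensions of \<open>\<theta>\<close> and of \<open>\<theta>\<^sup>\<times>\<close>, which add up to \<open>n\<close>.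
\<close>
lemma quasi_selfadjoint_iff:
  assumes \<theta>: "vec.subspace \<theta>"
  shows "quasi_selfadjoint (D_min J Q) (D_min J Qs) (D_theta J Q \<theta>) \<longleftrightarrow> CARD('n) = 2 * vec.dim \<theta>"
proof -
  interpret adj: dirac_system J Qs by (rule adjoint_system)
  have "same_quotient_dim (Domain (D_theta J Q \<theta>)) (Domain (D_min J Q))
      (Domain (D_theta J Qs (theta_cross J \<theta>))) (Domain (D_min J Qs))
      \<longleftrightarrow> vec.dim \<theta> = vec.dim (theta_cross J \<theta>)"
    by (rule same_quotient_dim_iff[OF quotient_map_initial_value[OF \<theta>] adj.quotient_map_initial_value[OF subspace_theta_cross]])
  then show ?thesis
    using D_theta_mem_Ext[OF \<theta>] dim_theta_cross[OF \<theta>]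
    by (auto simp: quasi_selfadjoint_def adj_theta_core(2)[OF \<theta>])
qed

text \<open>
  If \<open>z\<close> is orthogonal to the domain, then \<open>(0, z)\<close> lies in the adjoint; this is an operator, so \<open>z = 0\<close>.
\<close>
lemma densely_defined_D_min: "densely_defined (D_min J Q)"
  unfolding densely_defined_def
proof (rule ccontr)
  interpret adj: dirac_system J Qs by (rule adjoint_system)
  let ?V = "Domain (D_min J Q)"
  assume "closure ?V \<noteq> UNIV"
  then obtain x where x: "x \<notin> closure ?V" by blast
  have op: "is_operator (D_min J Q)" unfolding D_min_eq by (rule is_operator_D_theta[OF subspace_zero])
  have scale: "scaleL2 c u \<in> ?V" if "u \<in> ?V" for c u using op that unfolding is_operator_def by blast
  have "subspace ?V"
  proof (rule subspaceI)
    show "0 \<in> ?V" "\<And>u v. u \<in> ?V \<Longrightarrow> v \<in> ?V \<Longrightarrow> u + v \<in> ?V" using op unfolding is_operator_def by blast+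
    show "c *\<^sub>R u \<in> ?V" if "u \<in> ?V" for c u unfolding scaleR_L2_def by (rule scale[OF that])
  qed
  then obtain z where z: "\<And>m. m \<in> ?V \<Longrightarrow> inner m z = 0" "inner x z \<noteq> 0"
    using orthogonal_separation[OF _ x] by blast
  have "cinner k 0 = cinner f z" if "(f, k) \<in> D_min J Q" for f k
  proof -
    have "f \<in> ?V" using that by blast
    then have "inner f z = 0" "inner (scaleL2 (- \<i>) f) z = 0" using z(1) scale by blast+
    then show ?thesis unfolding cinner_eq_iff_inner by simp
  qed
  then have "(0, z) \<in> D_theta J Qs UNIV" unfolding adj_D_min[symmetric] adj_def by blast
  moreover have "is_operator (D_theta J Qs UNIV)"
    by (rule adj.is_operator_D_theta) (simp add: vec.subspace_def)
  ultimately have "z = 0" unfolding is_operator_def single_valued_def by blast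
  then show False using z(2) by simp
qed

lemma dual_pair_D_min: "dual_pair (D_min J Q) (D_min J Qs)"
proof -
  interpret adj: dirac_system J Qs by (rule adjoint_system)
  have "D_min J Qs \<subseteq> adj (D_min J Q)"
    unfolding adj_D_min adj.D_min_eq adj.D_theta_mono_iff by simp
  then have "\<forall>(f, k)\<in>D_min J Q. \<forall>(g, h)\<in>D_min J Qs. cinner k g = cinner f h"
    unfolding adj_def by blast
  then show ?thesis
    unfolding dual_pair_def using is_operator_D_theta[OF subspace_zero] adj.is_operator_D_theta[OF subspace_zero]
    by (simp add: D_min_eq adj.D_min_eq)
qed

lemma correct_iff_even: "correct_dual_pair (D_min J Q) (D_min J Qs) \<longleftrightarrow> (\<exists>p. CARD('n) = 2 * p)"
proof
  assume "correct_dual_pair (D_min J Q) (D_min J Qs)"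
  then obtain T where T: "quasi_selfadjoint (D_min J Q) (D_min J Qs) T" unfolding correct_dual_pair_def by blast
  then have "T \<in> Ext (D_min J Q) (D_min J Qs)" by (simp add: quasi_selfadjoint_def)
  then obtain \<theta> where "vec.subspace \<theta>" "T = D_theta J Q \<theta>" using Ext_imp_D_theta by blast
  then show "\<exists>p. CARD('n) = 2 * p" using quasi_selfadjoint_iff T by blast
next
  interpret adj: dirac_system J Qs by (rule adjoint_system)
  assume "\<exists>p. CARD('n) = 2 * p"
  then obtain p where p: "CARD('n) = 2 * p" by blast
  have "p \<le> vec.dim (UNIV :: (complex^'n) set)" unfolding vec_dim_card p by simp
  then obtain \<theta> :: "(complex^'n) set" where \<theta>: "vec.subspace \<theta>" "vec.dim \<theta> = p"
    by (rule vec.choose_subspace_of_subspace) blast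
  then have "quasi_selfadjoint (D_min J Q) (D_min J Qs) (D_theta J Q \<theta>)"
    using quasi_selfadjoint_iff[OF \<theta>(1)] p by simp
  moreover have "closed (D_min J Q)" "closed (D_min J Qs)" by (simp_all add: D_min_def)
  ultimately show "correct_dual_pair (D_min J Q) (D_min J Qs)"
    unfolding correct_dual_pair_def
    using dual_pair_D_min densely_defined_D_min adj.densely_defined_D_min by blast
qed

lemma D_theta_bij_quasi_selfadjoint:
  assumes p: "CARD('n) = 2 * p"
  shows "bij_betw (D_theta J Q) {\<theta>. vec.subspace \<theta> \<and> vec.dim \<theta> = p}
    {T \<in> Ext (D_min J Q) (D_min J Qs). quasi_selfadjoint (D_min J Q) (D_min J Qs) T}"
  unfolding bij_betw_def
proof
  show "inj_on (D_theta J Q) {\<theta>. vec.subspace \<theta> \<and> vec.dim \<theta> = p}"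
    by (rule inj_on_subset[OF bij_betw_imp_inj_on[OF D_theta_bij_Ext]]) auto
  show "D_theta J Q ` {\<theta>. vec.subspace \<theta> \<and> vec.dim \<theta> = p}
      = {T \<in> Ext (D_min J Q) (D_min J Qs). quasi_selfadjoint (D_min J Q) (D_min J Qs) T}"
  proof (intro equalityI subsetI)
    fix T assume "T \<in> D_theta J Q ` {\<theta>. vec.subspace \<theta> \<and> vec.dim \<theta> = p}"
    then obtain \<theta> where "T = D_theta J Q \<theta>" "vec.subspace \<theta>" "vec.dim \<theta> = p" by blast
    then show "T \<in> {T \<in> Ext (D_min J Q) (D_min J Qs). quasi_selfadjoint (D_min J Q) (D_min J Qs) T}"
      using D_theta_mem_Ext quasi_selfadjoint_iff p by simp
  next
    fix T assume T: "T \<in> {T \<in> Ext (D_min J Q) (D_min J Qs). quasi_selfadjoint (D_min J Q) (D_min J Qs) T}"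
    then obtain \<theta> where \<theta>: "vec.subspace \<theta>" "T = D_theta J Q \<theta>" using Ext_imp_D_theta by blast
    then have "vec.dim \<theta> = p" using T quasi_selfadjoint_iff p by simp
    then show "T \<in> D_theta J Q ` {\<theta>. vec.subspace \<theta> \<and> vec.dim \<theta> = p}" using \<theta> by blast
  qed
qed

end

theorem theorem3p7:
  fixes J :: "complex^'n^'n" and Q :: "real \<Rightarrow> complex^'n^'n"
  assumes "invertible J"
    and "hermitian_adjoint J = matrix_inv J"
    and "matrix_inv J = - J"
    and "Q \<in> L1_loc"
  shows
    \<comment> \<open>(i)\<close>
    "(\<forall>\<theta>. vec.subspace \<theta> \<longrightarrow>
        D_theta0 J Q \<theta> = D_theta J Q \<theta> \<and>
        adj (D_theta J Q \<theta>) = D_theta J (adjoint_potential Q) (theta_cross J \<theta>))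
     \<comment> \<open>(ii)\<close>
   \<and> bij_betw (D_theta J Q) {\<theta>. vec.subspace \<theta>}
        (Ext (D_min J Q) (D_min J (adjoint_potential Q)))
   \<and> D_min J Q = D_theta J Q {0}
   \<and> Domain (D_min J Q) = abs_L2 ` {y \<in> max_funs J Q. y 0 = 0}
     \<comment> \<open>(iii)\<close>
   \<and> (correct_dual_pair (D_min J Q) (D_min J (adjoint_potential Q)) \<longleftrightarrow>
        (\<exists>p. CARD('n) = 2 * p))
   \<and> (\<forall>p. CARD('n) = 2 * p \<longrightarrow>
        bij_betw (D_theta J Q) {\<theta>. vec.subspace \<theta> \<and> vec.dim \<theta> = p}
          {T \<in> Ext (D_min J Q) (D_min J (adjoint_potential Q)).
             quasi_selfadjoint (D_min J Q) (D_min J (adjoint_potential Q)) T})"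
proof -
  have "J ** matrix_inv J = mat 1"
    using assms(1) unfolding invertible_def matrix_inv_def by (rule someI2_ex) blast
  then have "J ** J = - mat 1"
    unfolding assms(3) by (simp add: matrix_neg_mul minus_equation_iff)
  then interpret dirac_system J Q
    using assms by unfold_locales simp_all
  have "Domain (D_min J Q) = abs_L2 ` {y \<in> max_funs J Q. y 0 = 0}"
    unfolding D_min_eq Domain_D_theta by simp
  moreover have "\<forall>\<theta>. vec.subspace \<theta> \<longrightarrow> D_theta0 J Q \<theta> = D_theta J Q \<theta> \<and>
      adj (D_theta J Q \<theta>) = D_theta J (adjoint_potential Q) (theta_cross J \<theta>)"
    by (intro allI impI conjI D_theta0_eq adj_theta_core(2))
  ultimately show ?thesis
    by (intro conjI allI impI D_theta_bij_Ext D_min_eq correct_iff_even D_theta_bij_quasi_selfadjoint) simp_all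
qed

end
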